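(* Let $S$ be a polynomial ring in finitely many variables over a field $K$ and let $I\subset S$ be an ideal minimally generated by six quadratic squarefree binomials. Suppose that (i) $I$ is prime, (ii) the initial ideal $\operatorname{in}_<(I)$ with respect to some monomial order $<$ on $S$ is generated by squarefree quadratic monomials, and (iii) $I$ has linear resolution. Let $J=(x_iy_j-x_jy_i : 1\leq i<j\leq 4)\subset R=K[x_1,\ldots,x_4,y_1,\ldots,y_4]$, and let $<_{lex}$ be the lexicographic order on $R$ induced by $x_1>x_2>x_3>x_4>y_1>y_2>y_3>y_4$. Write $$\operatorname{in}_<(I)=I(G)\quad\text{and}\quad \operatorname{in}_{<_{lex}}(J)=I(H),$$ where $G$ and $H$ are finite simple graphs with no isolated vertices. Then $G$ and $H$ are isomorphic as finite graphs.
   Context: $S$ has the standard grading. A quadratic binomial is a polynomial $u-v$ with $u\neq v$ monomials of degree $2$; it is squarefree if both $u$ and $v$ are squarefree monomials. An ideal generated in degree $2$ has linear resolution if its minimal graded free resolution is linear, i.e. its Castelnuovo--Mumford regularity equals $2$. For a finite simple graph $G$ whose vertices are variables of a polynomial ring, the edge ideal $I(G)$ is the ideal generated by the monomials $uv$ with $\{u,v\}$ an edge of $G$. *)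

theory Defs
  imports
    "HOL-Library.Poly_Mapping"
    "HOL-Library.Numeral_Type"
    "Jordan_Normal_Form.Matrix_Kernel"
begin

section \<open>Polynomial rings in finitely many variables\<close>

text \<open>
  The variables of the ring are the elements of the finite type \<open>'v\<close>. A monomial is
  represented by its exponent vector, so that multiplication of monomials is addition.
\<close>

type_synonym 'v monomial = "'v \<Rightarrow>\<^sub>0 nat"
type_synonym ('v, 'k) mpoly = "('v \<Rightarrow>\<^sub>0 nat) \<Rightarrow>\<^sub>0 'k"

definition mono_poly :: "'v monomial \<Rightarrow> ('v, 'k::comm_ring_1) mpoly" where
  "mono_poly m = Poly_Mapping.single m 1"

definition var :: "'v \<Rightarrow> ('v, 'k::comm_ring_1) mpoly" where
  "var v = mono_poly (Poly_Mapping.single v 1)"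

definition mdeg :: "'v::finite monomial \<Rightarrow> nat" where
  "mdeg m = (\<Sum>v\<in>UNIV. Poly_Mapping.lookup m v)"

definition squarefree_monomial :: "'v monomial \<Rightarrow> bool" where
  "squarefree_monomial m \<longleftrightarrow> (\<forall>v. Poly_Mapping.lookup m v \<le> 1)"

definition squarefree_quadratic_binomial :: "('v::finite, 'k::comm_ring_1) mpoly \<Rightarrow> bool" where
  "squarefree_quadratic_binomial f \<longleftrightarrow>
     (\<exists>u v. u \<noteq> v \<and> mdeg u = 2 \<and> mdeg v = 2 \<and>
        squarefree_monomial u \<and> squarefree_monomial v \<and> f = mono_poly u - mono_poly v)"


section \<open>Ideals\<close>

text \<open>An ideal is a submodule of the ring regarded as a module over itself.\<close>

lemma module_times: "Modules.module ((*) :: 'a::comm_ring_1 \<Rightarrow> 'a \<Rightarrow> 'a)"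
  by unfold_locales (simp_all add: algebra_simps)

abbreviation is_ideal :: "'a::comm_ring_1 set \<Rightarrow> bool" where
  "is_ideal \<equiv> Modules.module.subspace (*)"

abbreviation ideal_gen :: "'a::comm_ring_1 set \<Rightarrow> 'a set" where
  "ideal_gen \<equiv> Modules.module.span (*)"

definition minimally_generates :: "'a::comm_ring_1 set \<Rightarrow> 'a set \<Rightarrow> bool" where
  "minimally_generates B I \<longleftrightarrow> ideal_gen B = I \<and> (\<forall>B'. B' \<subset> B \<longrightarrow> ideal_gen B' \<noteq> I)"

definition is_prime_ideal :: "'a::comm_ring_1 set \<Rightarrow> bool" where
  "is_prime_ideal P \<longleftrightarrow>
     is_ideal P \<and> P \<noteq> UNIV \<and> (\<forall>a b. a * b \<in> P \<longrightarrow> a \<in> P \<or> b \<in> P)"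


section \<open>Monomial orders and initial ideals\<close>

text \<open>
  A monomial order is given as its reflexive relation: \<open>(s, t) \<in> r\<close> means that \<open>s\<close> is less
  than or equal to \<open>t\<close>. The exponent vector \<open>0\<close> is the monomial \<open>1\<close>.
\<close>

definition monomial_order :: "'v monomial rel \<Rightarrow> bool" where
  "monomial_order r \<longleftrightarrow>
     linear_order r \<and> (\<forall>t. (0, t) \<in> r) \<and> (\<forall>s t u. (s, t) \<in> r \<longrightarrow> (s + u, t + u) \<in> r)"

definition leading_monomial :: "'v monomial rel \<Rightarrow> ('v, 'k::zero) mpoly \<Rightarrow> 'v monomial" where
  "leading_monomial r f = (THE m. m \<in> Poly_Mapping.keys f \<and> (\<forall>m'\<in>Poly_Mapping.keys f. (m', m) \<in> r))"

definition initial_ideal ::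
    "'v monomial rel \<Rightarrow> ('v, 'k::comm_ring_1) mpoly set \<Rightarrow> ('v, 'k) mpoly set" where
  "initial_ideal r I = ideal_gen {mono_poly (leading_monomial r f) | f. f \<in> I \<and> f \<noteq> 0}"

text \<open>The lexicographic order induced by \<open>xs ! 0 > xs ! 1 > \<dots>\<close>, where \<open>xs\<close> lists all variables.\<close>

definition lex_order :: "'v list \<Rightarrow> 'v monomial rel" where
  "lex_order xs = {(s, t). s = t \<or>
     (\<exists>i < length xs. Poly_Mapping.lookup s (xs ! i) < Poly_Mapping.lookup t (xs ! i) \<and>
        (\<forall>j < i. Poly_Mapping.lookup s (xs ! j) = Poly_Mapping.lookup t (xs ! j)))}"


section \<open>Minimal graded free resolutions\<close>

text \<open>
  A list \<open>D\<close> of integers stands for the graded free module \<open>\<Oplus>\<^sub>c S(- D ! c)\<close>, whose \<open>c\<close>-th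
  basis element has degree \<open>D ! c\<close>; its elements are the vectors of dimension \<open>length D\<close>.
  The degree-preserving maps into the module given by \<open>E\<close> are the matrices whose entry in
  row \<open>r\<close> and column \<open>c\<close> is homogeneous of degree \<open>D ! c - E ! r\<close>.
\<close>

definition graded_map :: "int list \<Rightarrow> int list \<Rightarrow> ('v::finite, 'k::comm_ring_1) mpoly mat \<Rightarrow> bool" where
  "graded_map D E A \<longleftrightarrow> A \<in> carrier_mat (length E) (length D) \<and>
     (\<forall>r < length E. \<forall>c < length D. \<forall>m \<in> Poly_Mapping.keys (A $$ (r, c)). int (mdeg m) = D ! c - E ! r)"

definition mat_image :: "'a::comm_ring_1 mat \<Rightarrow> 'a vec set" where
  "mat_image A = {A *\<^sub>v w | w. w \<in> carrier_vec (dim_col A)}"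

text \<open>
  The complex is \<open>\<dots> \<rightarrow> F\<^sub>2 \<rightarrow> F\<^sub>1 \<rightarrow> F\<^sub>0 \<rightarrow> I \<rightarrow> 0\<close>, where \<open>F\<^sub>i\<close> is given by \<open>D i\<close>, the map
  from \<open>F\<^sub>i\<close> to the preceding free module is \<open>A i\<close>, and the augmentation onto \<open>I\<close> is \<open>A 0\<close>, with
  codomain the rank one free module \<open>S\<close> containing \<open>I\<close>.
\<close>

definition graded_free_resolution ::
    "('v::finite, 'k::comm_ring_1) mpoly set \<Rightarrow> (nat \<Rightarrow> int list) \<Rightarrow> (nat \<Rightarrow> ('v, 'k) mpoly mat) \<Rightarrow> bool"
  where
  "graded_free_resolution I D A \<longleftrightarrow>
     graded_map (D 0) [0] (A 0) \<and>
     (\<forall>i. graded_map (D (Suc i)) (D i) (A (Suc i))) \<and>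
     mat_image (A 0) = {v \<in> carrier_vec 1. v $ 0 \<in> I} \<and>
     (\<forall>i. mat_image (A (Suc i)) = mat_kernel (A i))"

text \<open>
  Minimality: the image of \<open>F\<^bsub>i+1\<^esub>\<close> lies in \<open>\<mm> F\<^sub>i\<close>, where \<open>\<mm>\<close> is the ideal generated by the
  variables, i.e. no entry of the matrix has a constant term.
\<close>

definition minimal_graded_free_resolution ::
    "('v::finite, 'k::comm_ring_1) mpoly set \<Rightarrow> (nat \<Rightarrow> int list) \<Rightarrow> (nat \<Rightarrow> ('v, 'k) mpoly mat) \<Rightarrow> bool"
  where
  "minimal_graded_free_resolution I D A \<longleftrightarrow>
     graded_free_resolution I D A \<and>
     (\<forall>i. \<forall>r < length (D i). \<forall>c < length (D (Suc i)). Poly_Mapping.lookup (A (Suc i) $$ (r, c)) 0 = 0)"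

text \<open>
  For an ideal generated in degree \<open>d\<close>. As the minimal graded free resolution is unique up to
  isomorphism, its degrees \<open>D\<close> may be read off from any representative.
\<close>

definition has_linear_resolution :: "nat \<Rightarrow> ('v::finite, 'k::comm_ring_1) mpoly set \<Rightarrow> bool" where
  "has_linear_resolution d I \<longleftrightarrow>
     (\<exists>D A. minimal_graded_free_resolution I D A \<and> (\<forall>i. \<forall>a \<in> set (D i). a = int (d + i)))"


section \<open>Finite simple graphs and edge ideals\<close>

definition finite_simple_graph :: "'v set \<Rightarrow> 'v set set \<Rightarrow> bool" where
  "finite_simple_graph V E \<longleftrightarrow> finite V \<and> (\<forall>e \<in> E. e \<subseteq> V \<and> card e = 2)"

definition no_isolated_vertices :: "'v set \<Rightarrow> 'v set set \<Rightarrow> bool" where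
  "no_isolated_vertices V E \<longleftrightarrow> (\<forall>v \<in> V. \<exists>e \<in> E. v \<in> e)"

definition graph_isomorphic :: "'v set \<Rightarrow> 'v set set \<Rightarrow> 'w set \<Rightarrow> 'w set set \<Rightarrow> bool" where
  "graph_isomorphic V E W F \<longleftrightarrow>
     (\<exists>\<phi>. bij_betw \<phi> V W \<and> (\<forall>u \<in> V. \<forall>v \<in> V. {u, v} \<in> E \<longleftrightarrow> {\<phi> u, \<phi> v} \<in> F))"

definition edge_ideal :: "'v set set \<Rightarrow> ('v, 'k::comm_ring_1) mpoly set" where
  "edge_ideal E = ideal_gen {var u * var v | u v. {u, v} \<in> E}"


section \<open>The ideal of 2-minors of the generic matrix with two rows and four columns\<close>

text \<open>
  The variables are indexed by the type \<open>4 + 4\<close>. Its summand \<open>4\<close> has the elements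
  \<open>0 < 1 < 2 < 3\<close>, so \<open>Inl i\<close> stands for \<open>x\<close> and \<open>Inr i\<close> for \<open>y\<close> with index \<open>i + 1\<close>.
\<close>

definition minors_ideal :: "(4 + 4, 'k::comm_ring_1) mpoly set" where
  "minors_ideal =
     ideal_gen {var (Inl i) * var (Inr j) - var (Inl j) * var (Inr i) | i j. i < j}"

definition minors_lex :: "(4 + 4) monomial rel" where
  "minors_lex = lex_order [Inl 0, Inl 1, Inl 2, Inl 3, Inr 0, Inr 1, Inr 2, Inr 3]"

end

theory Submission
  imports Defs "HOL-Library.Function_Algebras"
begin

text \<open>
  Since \<open>I\<close> is prime and generated by binomials, \<open>u \<approx> v \<longleftrightarrow> u - v \<in> I\<close> is a cancellative congruence
  on the monomials, and each of its classes contains exactly one monomial whose support is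
  independent in \<open>G\<close>, the normal form. Comparing the normal forms of \<open>a ^ n * m\<close> for large \<open>n\<close> (Dickson's
  lemma) shows that \<open>G\<close> has no two vertices with the same nonempty set of remaining neighbours, and
  that every maximal independent set carries integral coordinates which are constant on classes.

  The linear resolution enters through the graded pieces of degree at most four: a linear first
  syzygy module bounds the Hilbert function of \<open>I\<close>, which is that of its initial ideal. In terms of
  the edges \<open>E\<close> of \<open>G\<close>, this says that the sum of \<open>(-1) ^ card S\<close> over all sets \<open>S \<subseteq> E\<close> covering
  exactly four vertices is not positive. Only five graphs with six edges satisfy this and have
  no twins. The coordinates exclude four of them; the fifth is the half graph with edges
  \<open>x\<^sub>i y\<^sub>j\<close>, \<open>i < j\<close>, which is \<open>H\<close> because the quadrics of the ideal of minors are spanned by the minors.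
\<close>

section \<open>Monomials\<close>

text \<open>Only the Hilbert function passes from I to \<open>edge_ideal E\<close>, so the linear
  resolution reaches the graph as a numerical condition. The Hilbert series of S/I has numerator 1 -
  6 t^2 + b1 t^3 - b2 t^4 + ... with Betti numbers b1, b2. The coefficient of t^3 is nonnegative for
  every graph, so degree four is the first in which the condition shows: there the coefficient is
  minus a Betti number. Such a condition cannot isolate the half graph, since the edge ideals of the
  house and of the net have linear resolutions themselves: the complements of these graphs, a path
  and the 3-sun, are chordal. They are excluded by weights on the variables that are constant on
  classes. Equations for the weights have two sources: the normal form of an edge is another pair of
  variables, and some power of p times a neighbour q of p has a normal form that avoids p and its
  neighbours. The other two graphs have maximal independent sets of different sizes, and three
  independent weights cannot be determined by their values on two variables.\<close>

definition monom_of :: "('v::finite \<Rightarrow> nat) \<Rightarrow> 'v monomial" where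
  "monom_of f = Abs_poly_mapping f"

lemma lookup_monom_of [simp]: "Poly_Mapping.lookup (monom_of f) = f"
  by (simp add: monom_of_def)

lemma lookup_plus [simp]:
  "Poly_Mapping.lookup (s + t :: 'a \<Rightarrow>\<^sub>0 nat) x = Poly_Mapping.lookup s x + Poly_Mapping.lookup t x"
  by (rule lookup_add)

lemma monomial_eq_iff: "s = t \<longleftrightarrow> (\<forall>x. Poly_Mapping.lookup s x = Poly_Mapping.lookup t x)"
  for s t :: "'a \<Rightarrow>\<^sub>0 nat"
  by (metis poly_mapping_eqI)

definition mono_times :: "nat \<Rightarrow> 'v::finite monomial \<Rightarrow> 'v monomial" where
  "mono_times n t = monom_of (\<lambda>x. n * Poly_Mapping.lookup t x)"

lemma lookup_mono_times [simp]: "Poly_Mapping.lookup (mono_times n t) x = n * Poly_Mapping.lookup t x"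
  by (simp add: mono_times_def)

lemma mono_times_split:
  assumes "i \<le> j" shows "mono_times j t = mono_times i t + mono_times (j - i) t"
proof -
  have "j = i + (j - i)" using assms by simp
  then have "j * k = i * k + (j - i) * k" for k by (metis add_mult_distrib)
  then show ?thesis by (simp add: monomial_eq_iff)
qed

definition X :: "'v \<Rightarrow> 'v monomial" where "X v = Poly_Mapping.single v 1"

lemma lookup_X: "Poly_Mapping.lookup (X v) w = (if v = w then 1 else 0)"
  by (auto simp: lookup_single X_def)

definition msupp :: "'v monomial \<Rightarrow> 'v set" where
  "msupp m = {x. Poly_Mapping.lookup m x \<noteq> 0}"

lemma msupp_plus [simp]: "msupp (s + t) = msupp s \<union> msupp t"
  by (auto simp: msupp_def)

lemma msupp_X [simp]: "msupp (X v) = {v}"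
  by (auto simp: msupp_def lookup_X)

lemma msupp_0 [simp]: "msupp 0 = {}"
  by (auto simp: msupp_def)

lemma msupp_mono_times: "msupp (mono_times n t) = (if n = 0 then {} else msupp t)"
  by (auto simp: msupp_def)

lemma mdeg_plus [simp]: "mdeg (s + t) = mdeg s + mdeg t"
  by (simp add: mdeg_def sum.distrib)

lemma mdeg_X [simp]: "mdeg (X v) = 1"
  by (simp add: mdeg_def lookup_X)

lemma mdeg_0 [simp]: "mdeg 0 = 0"
  by (simp add: mdeg_def)

lemma mdeg_eq_0_iff [simp]: "mdeg m = 0 \<longleftrightarrow> m = 0"
  by (auto simp: mdeg_def monomial_eq_iff)

lemma monom_split:
  assumes "x \<in> msupp m"
  obtains m' where "m = X x + m'"
proof
  show "m = X x + (m - X x)"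
    using assms by (auto simp: monomial_eq_iff lookup_minus lookup_X msupp_def)
qed

lemma mdeg_1E:
  assumes "mdeg m = 1"
  obtains x where "m = X x"
proof -
  have "m \<noteq> 0" using assms by auto
  then obtain x where "x \<in> msupp m" by (auto simp: msupp_def monomial_eq_iff)
  then obtain m' where m': "m = X x + m'" by (rule monom_split)
  then have "m' = 0" using assms by simp
  then show thesis using that m' by simp
qed

lemma mdeg_2E:
  assumes "mdeg m = 2"
  obtains x y where "m = X x + X y"
proof -
  have "m \<noteq> 0" using assms by auto
  then obtain x where "x \<in> msupp m" by (auto simp: msupp_def monomial_eq_iff)
  then obtain m' where m': "m = X x + m'" by (rule monom_split)
  then have "mdeg m' = 1" using assms by simp
  then show thesis using that m' by (metis mdeg_1E)
qed

lemma finite_mdeg: "finite {m :: 'v::finite monomial. mdeg m = d}"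
proof -
  have "inj_on Poly_Mapping.lookup {m :: 'v monomial. mdeg m = d}"
    by (auto simp: inj_on_def monomial_eq_iff)
  moreover have "Poly_Mapping.lookup ` {m :: 'v monomial. mdeg m = d} \<subseteq> (UNIV :: 'v set) \<rightarrow>\<^sub>E {..d}"
    by (auto simp: mdeg_def member_le_sum)
  ultimately show ?thesis
    using finite_PiE[of "UNIV :: 'v set" "\<lambda>_. {..d}"] by (meson finite finite_atMost finite_imageD finite_subset)
qed

section \<open>Dickson's lemma for sequences\<close>

lemma nat_seq_incseq_subseq:
  fixes s :: "nat \<Rightarrow> nat"
  obtains \<phi> :: "nat \<Rightarrow> nat" where "strict_mono \<phi>" "incseq (s \<circ> \<phi>)"
proof -
  obtain \<phi> :: "nat \<Rightarrow> nat" where \<phi>: "strict_mono \<phi>" "monoseq (\<lambda>n. s (\<phi> n))"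
    using seq_monosub by blast
  from \<phi>(2) consider "incseq (s \<circ> \<phi>)" | "decseq (s \<circ> \<phi>)"
    unfolding monoseq_iff comp_def by blast
  then show thesis
  proof cases
    case 1 then show thesis using that \<phi> by blast
  next
    case 2
    \<comment> \<open>A decreasing sequence of natural numbers is constant from the point
      \<open>N\<close> where it reaches its least value; dropping the terms before \<open>N\<close>
      makes it weakly increasing.\<close>
    define k where "k = (LEAST k. \<exists>n. (s \<circ> \<phi>) n = k)"
    have "\<exists>n. (s \<circ> \<phi>) n = k" unfolding k_def by (rule LeastI_ex) blast
    then obtain N where N: "(s \<circ> \<phi>) N = k" by blast
    have "(s \<circ> \<phi>) n \<ge> k" for n unfolding k_def by (rule Least_le) blast
    moreover have "(s \<circ> \<phi>) n \<le> k" if "n \<ge> N" for n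
      using 2 N that by (metis decseqD)
    ultimately have const: "(s \<circ> \<phi>) n = k" if "n \<ge> N" for n
      using that by (metis le_antisym)
    show thesis
    proof (rule that)
      show "strict_mono (\<lambda>n. \<phi> (n + N))"
        using \<phi>(1) by (simp add: strict_mono_def)
      show "incseq (s \<circ> (\<lambda>n. \<phi> (n + N)))"
        using const by (auto simp: incseq_def)
    qed
  qed
qed

text \<open>One coordinate at a time: passing to a further subsequence keeps the monotonicity
  already achieved.\<close>

lemma dickson_subseq:
  fixes s :: "nat \<Rightarrow> 'v \<Rightarrow> nat"
  assumes "finite A"
  shows "\<exists>\<phi> :: nat \<Rightarrow> nat. strict_mono \<phi> \<and> (\<forall>x\<in>A. incseq (\<lambda>n. s (\<phi> n) x))"
  using assms
proof induction
  case empty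
  then show ?case by (auto intro: strict_mono_id[unfolded id_def])
next
  case (insert a A)
  then obtain \<phi> where \<phi>: "strict_mono \<phi>" "\<forall>x\<in>A. incseq (\<lambda>n. s (\<phi> n) x)" by blast
  obtain \<psi> where \<psi>: "strict_mono \<psi>" "incseq ((\<lambda>n. s (\<phi> n) a) \<circ> \<psi>)"
    by (rule nat_seq_incseq_subseq)
  have "strict_mono (\<phi> \<circ> \<psi>)" using \<phi>(1) \<psi>(1) by (rule strict_mono_o)
  moreover have "\<forall>x\<in>insert a A. incseq (\<lambda>n. s ((\<phi> \<circ> \<psi>) n) x)"
    using \<phi>(2) \<psi> by (auto simp: incseq_def strict_mono_less_eq)
  ultimately show ?case by blast
qed

lemma dickson:
  fixes s :: "nat \<Rightarrow> 'v::finite monomial"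
  obtains i j w where "i < j" "s j = s i + w"
proof -
  obtain \<phi> :: "nat \<Rightarrow> nat" where \<phi>: "strict_mono \<phi>"
      "\<forall>x\<in>UNIV. incseq (\<lambda>n. Poly_Mapping.lookup (s (\<phi> n)) x)"
    using dickson_subseq[of UNIV "\<lambda>n. Poly_Mapping.lookup (s n)"] by auto
  have "Poly_Mapping.lookup (s (\<phi> 0)) x \<le> Poly_Mapping.lookup (s (\<phi> 1)) x" for x
    using \<phi>(2) by (simp add: incseq_def)
  then have "s (\<phi> 1) = s (\<phi> 0) + (s (\<phi> 1) - s (\<phi> 0))"
    by (simp add: monomial_eq_iff lookup_minus)
  moreover have "\<phi> 0 < \<phi> 1" using \<phi>(1) by (simp add: strict_mono_def)
  ultimately show thesis using that by blast
qed

section \<open>Monomial congruences with a squarefree quadratic initial ideal\<close>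

text \<open>What the combinatorial half of the argument has to know about I, with the field and the
  monomial order left out. \<open>deg1\<close> reflects that I contains no linear forms.
  \<open>squarefree\<close> records that the generators are squarefree; it makes the normal form of
  an edge a product of two distinct variables.\<close>

locale toric_congruence =
  fixes eqv :: "'v::finite monomial \<Rightarrow> 'v monomial \<Rightarrow> bool" (infix "\<approx>" 50)
    and E :: "'v set set"
  assumes refl: "u \<approx> u"
    and sym: "u \<approx> v \<Longrightarrow> v \<approx> u"
    and trans [trans]: "u \<approx> v \<Longrightarrow> v \<approx> w \<Longrightarrow> u \<approx> w"
    and add: "u \<approx> v \<Longrightarrow> u + w \<approx> v + w"
    and cancel: "u + w \<approx> v + w \<Longrightarrow> u \<approx> v"
    and deg: "u \<approx> v \<Longrightarrow> mdeg u = mdeg v"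
    and deg1: "X x \<approx> X y \<Longrightarrow> x = y"
    and squarefree: "u \<approx> v \<Longrightarrow> mdeg u = 2 \<Longrightarrow> squarefree_monomial u \<Longrightarrow> squarefree_monomial v"
    and edges: "e \<in> E \<Longrightarrow> card e = 2"
    and normal_form_ex: "\<exists>v. u \<approx> v \<and> (\<forall>e\<in>E. \<not> e \<subseteq> msupp v)"
    and normal_form_unique: "u \<approx> v \<Longrightarrow> (\<forall>e\<in>E. \<not> e \<subseteq> msupp u) \<Longrightarrow> (\<forall>e\<in>E. \<not> e \<subseteq> msupp v) \<Longrightarrow> u = v"
begin

section \<open>Independent sets as supports of normal forms, lifting, and twins\<close>

definition indep :: "'v set \<Rightarrow> bool" where
  "indep A \<longleftrightarrow> (\<forall>e\<in>E. \<not> e \<subseteq> A)"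

lemma indep_mono: "A \<subseteq> B \<Longrightarrow> indep B \<Longrightarrow> indep A"
  by (auto simp: indep_def)

lemma indep_iff: "indep A \<longleftrightarrow> (\<forall>x\<in>A. \<forall>y\<in>A. {x, y} \<notin> E)"
proof
  assume *: "\<forall>x\<in>A. \<forall>y\<in>A. {x, y} \<notin> E"
  show "indep A"
    unfolding indep_def
  proof (intro ballI notI)
    fix e assume "e \<in> E" "e \<subseteq> A"
    then obtain x y where "e = {x, y}" by (meson edges card_2_iff)
    with * \<open>e \<in> E\<close> \<open>e \<subseteq> A\<close> show False by auto
  qed
qed (auto simp: indep_def)

lemma not_edge_self [simp]: "{x} \<notin> E"
  using edges by force

lemma nf: obtains v where "u \<approx> v" "indep (msupp v)"
  using normal_form_ex unfolding indep_def by blast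

lemma nf_unique: "u \<approx> v \<Longrightarrow> indep (msupp u) \<Longrightarrow> indep (msupp v) \<Longrightarrow> u = v"
  using normal_form_unique unfolding indep_def by blast

lemma add2: "u \<approx> v \<Longrightarrow> u' \<approx> v' \<Longrightarrow> u + u' \<approx> v + v'"
  using trans[of "u + u'" "v + u'" "v + v'"] add[of u v u'] add[of u' v' v] by (simp add: add.commute)

lemma add_left: "u \<approx> v \<Longrightarrow> w + u \<approx> w + v"
  using add[of u v w] by (simp add: add.commute)

lemma cancel_left: "w + u \<approx> w + v \<Longrightarrow> u \<approx> v"
  using cancel[of u w v] by (simp add: add.commute)

text \<open>In the ring of the congruence localised at \<open>a\<close> every monomial has a normal form which is
  compatible with \<open>a\<close>.\<close>

lemma lift:
  assumes a: "indep (msupp a)"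
  obtains n m' where "mono_times n a + m \<approx> m'" "indep (msupp a \<union> msupp m')"
proof -
  define s where "s n = (SOME v. mono_times n a + m \<approx> v \<and> indep (msupp v))" for n
  have s: "mono_times n a + m \<approx> s n" "indep (msupp (s n))" for n
  proof -
    have "\<exists>v. mono_times n a + m \<approx> v \<and> indep (msupp v)" using nf by blast
    from someI_ex[OF this] show "mono_times n a + m \<approx> s n" "indep (msupp (s n))"
      unfolding s_def by blast+
  qed
  \<comment> \<open>\<open>s i\<close> divides \<open>s j\<close>, and cancellation will show that
    the quotient \<open>w\<close> is equivalent to a power of \<open>a\<close>. Both have
    independent support, so \<open>w\<close> is that power. Hence \<open>s i\<close> times a power
    of \<open>a\<close> is still a normal form.\<close>
  obtain i j w where ij: "i < j" and w: "s j = s i + w" by (rule dickson)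
  have split: "mono_times j a + m = mono_times (j - i) a + (mono_times i a + m)"
    using mono_times_split[of i j a] ij by (simp add: ac_simps)
  have "s i + w \<approx> mono_times (j - i) a + (mono_times i a + m)"
    using sym[OF s(1)[of j]] w split by simp
  also have "mono_times (j - i) a + (mono_times i a + m) \<approx> mono_times (j - i) a + s i"
    by (rule add_left[OF s(1)])
  finally have "s i + w \<approx> s i + mono_times (j - i) a" by (simp add: add.commute)
  then have "w \<approx> mono_times (j - i) a" by (rule cancel_left)
  moreover have "indep (msupp w)" using s(2)[of j] w by (auto intro: indep_mono)
  moreover have "msupp (mono_times (j - i) a) = msupp a" using ij by (simp add: msupp_mono_times)
  ultimately have weq: "w = mono_times (j - i) a" using a nf_unique by simp
  then have "msupp w = msupp a" using ij by (simp add: msupp_mono_times)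
  then have "indep (msupp a \<union> msupp (s i))" using s(2)[of j] w by (simp add: Un_commute)
  with s(1)[of i] show thesis by (rule that)
qed

lemma deg1_eqv:
  assumes "X x \<approx> u" shows "u = X x"
proof -
  have "mdeg u = 1" using deg[OF assms] by simp
  then obtain y where "u = X y" by (rule mdeg_1E)
  then show ?thesis using assms deg1 by metis
qed

text \<open>In the localisation at p the variable q is written as m / p^n, with p cancelled from m.
  The edge makes n positive: otherwise q would be equivalent, hence equal, to some p^k m, whose
  support stays independent when p is added, although q is adjacent to p.\<close>

lemma lift_edge:
  assumes pq: "{p, q} \<in> E"
  obtains n m where "n \<ge> 1" "mono_times n (X p) + X q \<approx> m" "p \<notin> msupp m" "indep (insert p (msupp m))"
proof -
  have "p \<noteq> q" using edges[OF pq] by auto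
  have "indep (msupp (X p))" by (simp add: indep_iff)
  then obtain N m' where m': "mono_times N (X p) + X q \<approx> m'" "indep (msupp (X p) \<union> msupp m')"
    by (rule lift)
  define j where "j = Poly_Mapping.lookup m' p"
  define m where "m = monom_of ((Poly_Mapping.lookup m')(p := 0))"
  have mm': "m' = mono_times j (X p) + m"
    by (auto simp: m_def j_def monomial_eq_iff lookup_X)
  have pm: "p \<notin> msupp m" by (simp add: m_def msupp_def)
  have ind: "indep (insert p (msupp m))"
    using m'(2) by (rule indep_mono[rotated]) (auto simp: mm')
  have "j < N"
  proof (rule ccontr)
    assume "\<not> j < N"
    then have "m' = mono_times N (X p) + (mono_times (j - N) (X p) + m)"
      using mono_times_split[of N j "X p"] mm' by (simp add: ac_simps)
    with m'(1) have "X q \<approx> mono_times (j - N) (X p) + m"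
      using cancel_left[of "mono_times N (X p)"] by simp
    then have "mono_times (j - N) (X p) + m = X q" by (rule deg1_eqv)
    then have "q \<in> msupp (mono_times (j - N) (X p) + m)" by simp
    then have "q \<in> insert p (msupp m)" by (auto simp: msupp_mono_times split: if_splits)
    then show False using ind pq by (auto simp: indep_iff)
  qed
  then have "mono_times N (X p) + X q = mono_times j (X p) + (mono_times (N - j) (X p) + X q)"
    using mono_times_split[of j N "X p"] by (simp add: ac_simps)
  with m'(1) mm' have "mono_times (N - j) (X p) + X q \<approx> m"
    using cancel_left[of "mono_times j (X p)"] by simp
  moreover have "N - j \<ge> 1" using \<open>j < N\<close> by simp
  ultimately show thesis using that pm ind by blast
qed

definition nbh :: "'v \<Rightarrow> 'v set" where
  "nbh x = {y. {x, y} \<in> E}"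

text \<open>If p^n q and p'^n' q lift to m and m', then p'^n' m and p^n m' are both equivalent to
  p^n p'^n' q. As p and p' have the same other neighbours, m is compatible with p' and m' with p, so
  the two monomials are normal forms and therefore equal. But only the second is divisible by
  p.\<close>

lemma no_twins:
  assumes "p \<noteq> p'" and twins: "nbh p - {p'} = nbh p' - {p}" and q: "q \<in> nbh p - {p'}"
  shows False
proof -
  have "{p, q} \<in> E" "{p', q} \<in> E" using twins q by (auto simp: nbh_def)
  then obtain n m n' m' where
    m: "n \<ge> 1" "mono_times n (X p) + X q \<approx> m" "p \<notin> msupp m" "indep (insert p (msupp m))" and
    m': "n' \<ge> 1" "mono_times n' (X p') + X q \<approx> m'" "p' \<notin> msupp m'" "indep (insert p' (msupp m'))"
    using lift_edge by metis
  have nbh: "z \<in> nbh p \<longleftrightarrow> z \<in> nbh p'" if "z \<noteq> p" "z \<noteq> p'" for z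
    using twins that by blast
  have "indep (insert p' (msupp m))"
  proof -
    have "z \<notin> nbh p'" if "z \<in> msupp m" for z
    proof
      assume "z \<in> nbh p'"
      moreover have "z \<noteq> p'" using \<open>z \<in> nbh p'\<close> by (auto simp: nbh_def)
      ultimately have "z \<in> nbh p" using nbh m(3) that by metis
      then show False using m(4) that by (auto simp: indep_iff nbh_def)
    qed
    then show ?thesis using m(4) by (auto simp: indep_iff nbh_def insert_commute)
  qed
  moreover have "indep (insert p (msupp m'))"
  proof -
    have "z \<notin> nbh p" if "z \<in> msupp m'" for z
    proof
      assume "z \<in> nbh p"
      moreover have "z \<noteq> p" using \<open>z \<in> nbh p\<close> by (auto simp: nbh_def)
      ultimately have "z \<in> nbh p'" using nbh m'(3) that by metis
      then show False using m'(4) that by (auto simp: indep_iff nbh_def)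
    qed
    then show ?thesis using m'(4) by (auto simp: indep_iff nbh_def insert_commute)
  qed
  moreover have "mono_times n' (X p') + m \<approx> mono_times n (X p) + m'"
  proof -
    have "mono_times n' (X p') + m \<approx> mono_times n' (X p') + (mono_times n (X p) + X q)"
      by (rule add_left[OF sym[OF m(2)]])
    also have "\<dots> = mono_times n (X p) + (mono_times n' (X p') + X q)" by (simp add: ac_simps)
    also have "\<dots> \<approx> mono_times n (X p) + m'" by (rule add_left[OF m'(2)])
    finally show ?thesis .
  qed
  ultimately have "mono_times n' (X p') + m = mono_times n (X p) + m'"
    using m(1) m'(1) by (rule_tac nf_unique) (auto simp: msupp_mono_times)
  from arg_cong[OF this, of "\<lambda>u. Poly_Mapping.lookup u p"] show False
    using m(1,3) \<open>p \<noteq> p'\<close> by (simp add: lookup_X msupp_def)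
qed

section \<open>Invariant weights and the coordinates of a facet\<close>

definition val :: "('v \<Rightarrow> int) \<Rightarrow> 'v monomial \<Rightarrow> int" where
  "val e m = (\<Sum>x\<in>UNIV. e x * int (Poly_Mapping.lookup m x))"

lemma val_plus [simp]: "val e (s + t) = val e s + val e t"
  by (simp add: val_def sum.distrib algebra_simps)

lemma val_X [simp]: "val e (X x) = e x"
proof -
  have "val e (X x) = (\<Sum>y\<in>UNIV. if y = x then e x else 0)"
    unfolding val_def by (rule sum.cong) (auto simp: lookup_X)
  then show ?thesis by simp
qed

lemma val_mono_times [simp]: "val e (mono_times n t) = int n * val e t"
  by (simp add: val_def sum_distrib_left algebra_simps)

text \<open>In terms of the ring, an integral grading for which I is homogeneous; in terms of
  exponent vectors, a linear functional that vanishes on the lattice of the congruence.\<close>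

definition invariant :: "('v \<Rightarrow> int) \<Rightarrow> bool" where
  "invariant e \<longleftrightarrow> (\<forall>u v. u \<approx> v \<longrightarrow> val e u = val e v)"

definition facet :: "'v set \<Rightarrow> bool" where
  "facet F \<longleftrightarrow> indep F \<and> (\<forall>x. x \<notin> F \<longrightarrow> \<not> indep (insert x F))"

lemma facetD:
  assumes "facet F" "indep (F \<union> A)" shows "A \<subseteq> F"
proof
  fix x assume "x \<in> A"
  then have "indep (insert x F)" using assms(2) by (auto elim: indep_mono[rotated])
  then show "x \<in> F" using assms(1) by (auto simp: facet_def)
qed

text \<open>Facets of a squarefree initial complex are unimodular: they carry integral coordinates.\<close>

lemma facet_coordinate:
  assumes F: "facet F" and f: "f \<in> F"
  obtains e where "invariant e" "e f = 1" "\<And>x. x \<in> F \<Longrightarrow> x \<noteq> f \<Longrightarrow> e x = 0"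
proof -
  \<comment> \<open>The product of the variables of F. Since F is maximal, inverting it turns every
    monomial into a Laurent monomial in the variables of F.\<close>
  define a :: "'v monomial" where "a = monom_of (\<lambda>x. if x \<in> F then 1 else 0)"
  have sa: "msupp a = F" by (simp add: a_def msupp_def)
  have indF: "indep F" using F by (simp add: facet_def)
  have "\<exists>n m'. mono_times n a + m \<approx> m' \<and> msupp m' \<subseteq> F" for m
  proof -
    have "indep (msupp a)" using indF sa by simp
    then obtain n m' where "mono_times n a + m \<approx> m'" "indep (msupp a \<union> msupp m')" by (rule lift)
    then show ?thesis using facetD[OF F] sa by blast
  qed
  then obtain n nm where nm: "\<And>m. mono_times (n m) a + m \<approx> nm m" "\<And>m. msupp (nm m) \<subseteq> F"
    by metis
  \<comment> \<open>The exponent of f in this Laurent monomial, possibly negative. The next fact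
    shows that it does not depend on the power of \<open>a\<close> used to clear
    denominators.\<close>
  define c where "c m = int (Poly_Mapping.lookup (nm m) f) - int (n m)" for m
  have c: "c u = int (Poly_Mapping.lookup u' f) - int k" if "mono_times k a + u \<approx> u'" "msupp u' \<subseteq> F" for k u u'
  proof -
    have "mono_times (n u) a + u' \<approx> mono_times (n u) a + (mono_times k a + u)"
      by (rule add_left[OF sym[OF that(1)]])
    also have "\<dots> = mono_times k a + (mono_times (n u) a + u)" by (simp add: ac_simps)
    also have "\<dots> \<approx> mono_times k a + nm u" by (rule add_left[OF nm(1)])
    finally have "mono_times (n u) a + u' \<approx> mono_times k a + nm u" .
    then have "mono_times (n u) a + u' = mono_times k a + nm u"
      using that(2) nm(2) sa
      by (rule_tac nf_unique) (auto intro!: indep_mono[OF _ indF] simp: msupp_mono_times)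
    from arg_cong[OF this, of "\<lambda>u. Poly_Mapping.lookup u f"] show ?thesis
      using f by (simp add: c_def a_def)
  qed
  have c_eqv: "c u = c v" if "u \<approx> v" for u v
  proof -
    have "mono_times (n v) a + u \<approx> nm v"
      using trans[OF add_left[OF that] nm(1)] .
    from c[OF this nm(2)] show ?thesis by (simp add: c_def)
  qed
  have c_plus: "c (u + v) = c u + c v" for u v
  proof -
    have "mono_times (n u + n v) a + (u + v) = (mono_times (n u) a + u) + (mono_times (n v) a + v)"
      by (simp add: monomial_eq_iff algebra_simps)
    then have "mono_times (n u + n v) a + (u + v) \<approx> nm u + nm v" using add2 nm(1) by metis
    moreover have "msupp (nm u + nm v) \<subseteq> F" using nm(2) by simp
    ultimately show ?thesis using c[of "n u + n v" "u + v"] by (simp add: c_def)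
  qed
  have c_0: "c 0 = 0" using c_plus[of 0 0] by simp
  define e where "e x = c (X x)" for x
  have val_c: "val e m = c m" for m
  proof (induction "mdeg m" arbitrary: m)
    case 0
    then show ?case using c_0 by (simp add: val_def)
  next
    case (Suc d)
    then have "m \<noteq> 0" by auto
    then obtain x where "x \<in> msupp m" by (auto simp: msupp_def monomial_eq_iff)
    then obtain m' where m': "m = X x + m'" by (rule monom_split)
    then have "val e m' = c m'" using Suc by simp
    then show ?case using m' c_plus by (simp add: e_def)
  qed
  have e_F: "e x = (if x = f then 1 else 0)" if "x \<in> F" for x
  proof -
    have "mono_times 0 a + X x = X x" by (simp add: monomial_eq_iff)
    then have "mono_times 0 a + X x \<approx> X x" using refl by simp
    from c[OF this] show ?thesis using that by (auto simp: e_def lookup_X)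
  qed
  show thesis
  proof (rule that)
    show "invariant e" unfolding invariant_def using val_c c_eqv by metis
    show "e f = 1" "\<And>x. x \<in> F \<Longrightarrow> x \<noteq> f \<Longrightarrow> e x = 0" using e_F f by auto
  qed
qed


text \<open>Cone points of the initial complex: they belong to every facet. They have to be carried
  along because the type \<open>'v\<close> may contain variables that occur in no edge.\<close>

definition isolated :: "'v set" where
  "isolated = {z. nbh z = {}}"

lemma isolated_iff: "z \<in> isolated \<longleftrightarrow> z \<notin> \<Union>E"
proof
  assume *: "z \<in> isolated"
  show "z \<notin> \<Union>E"
  proof
    assume "z \<in> \<Union>E"
    then obtain e where e: "e \<in> E" "z \<in> e" by auto
    then obtain x y where "e = {x, y}" by (meson edges card_2_iff)
    with e * show False by (auto simp: isolated_def nbh_def insert_commute)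
  qed
qed (auto simp: isolated_def nbh_def)

text \<open>Maximality among the vertices of edges suffices, since isolated vertices can be added to
  every independent set.\<close>

lemma facet_isolated:
  assumes "indep S" and "\<And>x. x \<in> \<Union>E \<Longrightarrow> x \<notin> S \<Longrightarrow> \<exists>s\<in>S. {x, s} \<in> E"
  shows "facet (S \<union> isolated)"
proof -
  have "indep (S \<union> isolated)"
    using assms(1) by (auto simp: indep_iff isolated_iff)
  moreover have "\<not> indep (insert x (S \<union> isolated))" if x: "x \<notin> S \<union> isolated" for x
  proof -
    have "x \<in> \<Union>E" "x \<notin> S" using x by (auto simp: isolated_iff)
    then obtain s where "s \<in> S" "{x, s} \<in> E" using assms(2) by blast
    then show ?thesis by (auto simp: indep_iff)
  qed
  ultimately show ?thesis by (auto simp: facet_def)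
qed

lemma invariantD: "invariant e \<Longrightarrow> u \<approx> v \<Longrightarrow> val e u = val e v"
  by (simp add: invariant_def)

lemma val_zero: "(\<And>x. x \<in> msupp m \<Longrightarrow> e x = 0) \<Longrightarrow> val e m = 0"
  by (auto simp: val_def msupp_def intro!: sum.neutral)

lemma val_pair:
  assumes "msupp m \<subseteq> {a, b} \<union> Z" "a \<noteq> b" "a \<notin> Z" "b \<notin> Z" "\<And>z. z \<in> Z \<Longrightarrow> e z = 0"
  shows "val e m = e a * int (Poly_Mapping.lookup m a) + e b * int (Poly_Mapping.lookup m b)"
proof -
  have "val e m = (\<Sum>x\<in>{a, b}. e x * int (Poly_Mapping.lookup m x))"
    unfolding val_def using assms(1,5)
    by (intro sum.mono_neutral_right) (auto simp: msupp_def)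
  then show ?thesis using assms(2) by simp
qed

text \<open>The pair s, t is the normal form of p q, which is squarefree because p q is. A variable
  shared with the edge could be cancelled; the remaining two variables would be equivalent, hence
  equal, and p q would be its own normal form.\<close>

lemma edge_partner:
  assumes pq: "{p, q} \<in> E"
  obtains s t where "X p + X q \<approx> X s + X t" "s \<noteq> t" "{s, t} \<notin> E" "s \<notin> {p, q}" "t \<notin> {p, q}"
proof -
  have "p \<noteq> q" using edges[OF pq] by auto
  obtain v where v: "X p + X q \<approx> v" "indep (msupp v)" by (rule nf)
  have "mdeg v = 2" using deg[OF v(1)] by simp
  then obtain s t where st: "v = X s + X t" by (rule mdeg_2E)
  have "squarefree_monomial v"
    using \<open>p \<noteq> q\<close> by (intro squarefree[OF v(1)]) (auto simp: squarefree_monomial_def lookup_X)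
  then have "s \<noteq> t" by (auto simp: st squarefree_monomial_def lookup_X dest: spec[of _ t])
  have ne: "{s, t} \<notin> E" using v(2) by (auto simp: st indep_iff)
  have swap: "X p + X q = X q + X p" by (rule add.commute)
  have swap': "X s + X t = X t + X s" by (rule add.commute)
  have "s \<noteq> p" using v(1) ne pq by (auto simp: st dest!: cancel_left deg1)
  moreover have "t \<noteq> q" using v(1) ne pq by (auto simp: st dest!: cancel deg1)
  moreover have "s \<noteq> q" using v(1)[unfolded st swap] ne pq
    by (auto simp: insert_commute dest!: cancel_left deg1)
  moreover have "t \<noteq> p" using v(1)[unfolded st swap'] ne pq
    by (auto simp: insert_commute dest!: cancel_left deg1)
  ultimately show thesis using that v(1) st \<open>s \<noteq> t\<close> ne by auto
qed

lemma edge_partner_val: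
  assumes "{p, q} \<in> E" "invariant e"
  obtains s t where "e p + e q = e s + e t" "s \<noteq> t" "{s, t} \<notin> E" "s \<notin> {p, q}" "t \<notin> {p, q}"
proof -
  obtain s t where st: "X p + X q \<approx> X s + X t" "s \<noteq> t" "{s, t} \<notin> E" "s \<notin> {p, q}" "t \<notin> {p, q}"
    using edge_partner[OF assms(1)] by metis
  then show thesis using that invariantD[OF assms(2) st(1)] by simp
qed

lemma lift_edge_val:
  assumes "{p, q} \<in> E" "invariant e"
  obtains n m where "n \<ge> 1" "int n * e p + e q = val e m"
    "\<And>x. x \<in> msupp m \<Longrightarrow> x \<noteq> p \<and> {x, p} \<notin> E"
proof -
  obtain n m where m: "n \<ge> 1" "mono_times n (X p) + X q \<approx> m" "p \<notin> msupp m" "indep (insert p (msupp m))"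
    using lift_edge[OF assms(1)] by metis
  then show thesis
    using that[of n m] invariantD[OF assms(2) m(2)] by (auto simp: indep_iff)
qed

text \<open>All facets of the initial complex have the same size; here for sizes two and three up to
  cone points.\<close>

lemma no_facets_2_3:
  assumes F: "facet ({x, y, z} \<union> isolated)" and G: "facet ({a, b} \<union> isolated)"
    and dist: "distinct [x, y, z]" "a \<noteq> b" and ni: "{x, y, z, a, b} \<inter> isolated = {}"
  shows False
proof -
  obtain e1 where e1: "invariant e1" "e1 x = 1" "\<And>u. u \<in> {x, y, z} \<union> isolated \<Longrightarrow> u \<noteq> x \<Longrightarrow> e1 u = 0"
    by (rule facet_coordinate[OF F, of x]) simp_all
  obtain e2 where e2: "invariant e2" "e2 y = 1" "\<And>u. u \<in> {x, y, z} \<union> isolated \<Longrightarrow> u \<noteq> y \<Longrightarrow> e2 u = 0"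
    by (rule facet_coordinate[OF F, of y]) simp_all
  obtain e3 where e3: "invariant e3" "e3 z = 1" "\<And>u. u \<in> {x, y, z} \<union> isolated \<Longrightarrow> u \<noteq> z \<Longrightarrow> e3 u = 0"
    by (rule facet_coordinate[OF F, of z]) simp_all
  have Z: "e1 u = 0" "e2 u = 0" "e3 u = 0" if "u \<in> isolated" for u
    using that e1(3)[of u] e2(3)[of u] e3(3)[of u] ni by auto
  \<comment> \<open>Lifting w along the facet of size two expresses the value of an invariant at w
    by its values at a and b, with coefficients that do not depend on the invariant. The coordinates
    of x, y, z would thus factor through a space of rank two.\<close>
  have coord: "\<exists>\<alpha> \<beta>. \<forall>e\<in>{e1, e2, e3}. e w = \<alpha> * e a + \<beta> * e b" for w
  proof -
    have "indep (msupp (X a + X b))" using G by (auto simp: facet_def indep_iff)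
    then obtain n m where m: "mono_times n (X a + X b) + X w \<approx> m" "indep (msupp (X a + X b) \<union> msupp m)"
      by (rule lift)
    have "msupp m \<subseteq> {a, b} \<union> isolated"
    proof -
      have "indep (({a, b} \<union> isolated) \<union> msupp m)"
        using m(2) by (auto simp: indep_iff isolated_iff)
      from facetD[OF G this] show ?thesis .
    qed
    then have val: "val e m = e a * int (Poly_Mapping.lookup m a) + e b * int (Poly_Mapping.lookup m b)"
      if "e \<in> {e1, e2, e3}" for e
      using that Z dist ni by (intro val_pair[of _ _ _ isolated]) auto
    have "e w = (int (Poly_Mapping.lookup m a) - int n) * e a + (int (Poly_Mapping.lookup m b) - int n) * e b"
      if "e \<in> {e1, e2, e3}" for e
    proof -
      have "invariant e" using that e1 e2 e3 by auto
      from invariantD[OF this m(1)] val[OF that] show ?thesis by (simp add: algebra_simps)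
    qed
    then show ?thesis by (intro exI ballI)
  qed
  obtain \<alpha>1 \<beta>1 where 1: "\<forall>e\<in>{e1, e2, e3}. e x = \<alpha>1 * e a + \<beta>1 * e b" using coord by blast
  obtain \<alpha>2 \<beta>2 where 2: "\<forall>e\<in>{e1, e2, e3}. e y = \<alpha>2 * e a + \<beta>2 * e b" using coord by blast
  obtain \<alpha>3 \<beta>3 where 3: "\<forall>e\<in>{e1, e2, e3}. e z = \<alpha>3 * e a + \<beta>3 * e b" using coord by blast
  have 0: "e1 y = 0" "e2 x = 0" "e3 x = 0" "e3 y = 0"
    using dist by (auto intro!: e1(3) e2(3) e3(3))
  have r: "\<alpha>1 * e1 a + \<beta>1 * e1 b = 1" "\<alpha>1 * e2 a + \<beta>1 * e2 b = 0" "\<alpha>1 * e3 a + \<beta>1 * e3 b = 0"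
    "\<alpha>2 * e1 a + \<beta>2 * e1 b = 0" "\<alpha>2 * e2 a + \<beta>2 * e2 b = 1" "\<alpha>2 * e3 a + \<beta>2 * e3 b = 0"
    "\<alpha>3 * e3 a + \<beta>3 * e3 b = 1"
    using bspec[OF 1, of e1] bspec[OF 1, of e2] bspec[OF 1, of e3] bspec[OF 2, of e1] bspec[OF 2, of e2]
      bspec[OF 2, of e3] bspec[OF 3, of e3] 0 e1(2) e2(2) e3(2) by (simp_all only: insert_iff simp_thms)
  \<comment> \<open>The first identity below is the determinant with columns \<alpha>, \<beta> and p
    \<alpha> + q \<beta>, which vanishes; at the values of \<open>e3\<close> it reduces to
    \<open>n = 0\<close>. The second is the product rule for 2 by 2 determinants, which makes n a
    divisor of 1.\<close>
  define n where "n = \<alpha>1 * \<beta>2 - \<alpha>2 * \<beta>1"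
  have "(\<alpha>2 * \<beta>3 - \<alpha>3 * \<beta>2) * (\<alpha>1 * p + \<beta>1 * q) + (\<alpha>3 * \<beta>1 - \<alpha>1 * \<beta>3) * (\<alpha>2 * p + \<beta>2 * q)
      + n * (\<alpha>3 * p + \<beta>3 * q) = 0" for p q
    by (simp add: n_def algebra_simps)
  from this[of "e3 a" "e3 b"] have "n = 0" unfolding r by simp
  moreover have "(\<alpha>1 * p + \<beta>1 * q) * (\<alpha>2 * p' + \<beta>2 * q') - (\<alpha>1 * p' + \<beta>1 * q') * (\<alpha>2 * p + \<beta>2 * q)
      = n * (p * q' - q * p')" for p q p' q'
    by (simp add: n_def algebra_simps)
  from this[of "e1 a" "e1 b" "e2 a" "e2 b"] have "n * (e1 a * e2 b - e1 b * e2 a) = 1"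
    unfolding r by simp
  ultimately show False by simp
qed

text \<open>Up to cone points all facets have size three here, so \<open>no_facets_2_3\<close> does
  not apply. Instead, the coordinate e of p3 on the facet of the three pendant vertices is shown to
  vanish on the triangle. Then e has the value 1 on the edge p3 q3, but 0 on every pair of variables
  disjoint from it.\<close>

lemma no_net:
  assumes E: "E = {{q1, q2}, {q1, q3}, {q2, q3}, {p1, q1}, {p2, q2}, {p3, q3}}"
    and dist: "distinct [q1, q2, q3, p1, p2, p3]"
  shows False
proof -
  have adj: "{x, y} \<in> E \<longleftrightarrow> x = q1 \<and> y = q2 \<or> x = q2 \<and> y = q1 \<or> x = q1 \<and> y = q3 \<or> x = q3 \<and> y = q1 \<or> x = q2 \<and> y = q3 \<or> x = q3 \<and> y = q2 \<or> x = p1 \<and> y = q1 \<or> x = q1 \<and> y = p1 \<or> x = p2 \<and> y = q2 \<or> x = q2 \<and> y = p2 \<or> x = p3 \<and> y = q3 \<or> x = q3 \<and> y = p3" for x y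
    by (auto simp: E doubleton_eq_iff)
  have verts: "\<Union>E = {q1, q2, q3, p1, p2, p3}" by (auto simp: E)
  have ni: "x \<notin> isolated" if "x \<in> {q1, q2, q3, p1, p2, p3}" for x
    using that by (simp add: isolated_iff verts)
  have cases: "x \<in> {q1, q2, q3, p1, p2, p3} \<or> x \<in> isolated" for x
    by (auto simp: isolated_iff verts)
  have "indep {p1, p2, p3}" using dist by (auto simp: indep_iff adj)
  then have F: "facet ({p1, p2, p3} \<union> isolated)"
    by (rule facet_isolated) (unfold verts, auto simp: adj)
  obtain e where e: "invariant e" "e p3 = 1"
      "\<And>x. x \<in> {p1, p2, p3} \<union> isolated \<Longrightarrow> x \<noteq> p3 \<Longrightarrow> e x = 0"
    by (rule facet_coordinate[OF F, of p3]) simp_all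
  have e0: "e p1 = 0" "e p2 = 0" "\<And>z. z \<in> isolated \<Longrightarrow> e z = 0"
    by (rule e(3); use dist ni in auto)+
  \<comment> \<open>A power of q3 times q is equivalent to a monomial that avoids q1, q2, q3 and p3,
    where e vanishes; so \<open>e q\<close> is minus a positive multiple of
    \<open>e q3\<close>.\<close>
  have lift: "\<exists>n\<ge>1. e q = - (int n * e q3)" if q: "q \<in> {q1, q2}" for q
  proof -
    have "{q3, q} \<in> E" using q by (auto simp: adj)
    then obtain n m where n: "n \<ge> 1" "int n * e q3 + e q = val e m"
        "\<And>x. x \<in> msupp m \<Longrightarrow> x \<noteq> q3 \<and> {x, q3} \<notin> E"
      using lift_edge_val e(1) by metis
    have "e x = 0" if "x \<in> msupp m" for x
    proof -
      have "x \<notin> {q1, q2, q3, p3}" using n(3)[OF that] by (auto simp: adj)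
      then show ?thesis using cases[of x] e0 by auto
    qed
    then have "val e m = 0" by (rule val_zero)
    then show ?thesis using n by (intro exI[of _ n]) auto
  qed
  obtain n1 where n1: "n1 \<ge> 1" "e q1 = - (int n1 * e q3)" using lift by blast
  obtain n2 where n2: "n2 \<ge> 1" "e q2 = - (int n2 * e q3)" using lift by blast
  have "{q1, q2} \<in> E" by (simp add: adj)
  then obtain s t where st: "e q1 + e q2 = e s + e t" "s \<noteq> t" "{s, t} \<notin> E" "s \<notin> {q1, q2}" "t \<notin> {q1, q2}"
    using edge_partner_val e(1) by metis
  have "(s, t) \<notin> {(q3, p3), (p3, q3)}" using st(3) by (auto simp: adj)
  \<comment> \<open>Of the vertices left for s and t only q3 and p3 can have nonzero values, and
    these two are adjacent. As n1 + n2 is at least 2, each of the three values forces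
    \<open>e q3 = 0\<close>; the value 1 is ruled out by divisibility.\<close>
  then have "e s + e t \<in> {0, 1, e q3}"
    using cases[of s] cases[of t] st(2,4,5) e0 e(2) by auto
  moreover have "e s + e t = - (int (n1 + n2) * e q3)"
    using st(1) n1 n2 by (simp add: algebra_simps)
  ultimately consider "int (n1 + n2) * e q3 = 0" | "int (n1 + n2) * e q3 = -1" | "int (n1 + n2) * e q3 = - e q3"
    by fastforce
  then have g: "e q3 = 0"
  proof cases
    case 1
    then show ?thesis using n1 by simp
  next
    case 2
    then have "int (n1 + n2) dvd 1" by (metis dvd_minus_iff dvd_triv_left)
    then show ?thesis using n1 n2 by simp
  next
    case 3
    then have "(int (n1 + n2) + 1) * e q3 = 0" by (simp add: distrib_right)
    then show ?thesis by simp
  qed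
  have "{p3, q3} \<in> E" by (simp add: adj)
  then obtain s t where st: "e p3 + e q3 = e s + e t" "s \<noteq> t" "{s, t} \<notin> E" "s \<notin> {p3, q3}" "t \<notin> {p3, q3}"
    using edge_partner_val e(1) by metis
  have "e s = 0" "e t = 0"
    using cases[of s] cases[of t] st(4,5) e0 n1 n2 g by auto
  then show False using st(1) g e(2) by simp
qed

text \<open>The graph is the complement of the path w1 w2 w3 w4 w5, so up to cone points its facets
  are the pairs of consecutive vertices; e is the coordinate of w2 on the first of them. Lifting
  along w1, whose neighbours are w3, w4, w5, shows that e is nonnegative there, and the partners of
  three edges then leave a single solution.\<close>

lemma house_coordinate:
  assumes E: "E = {{w1, w3}, {w1, w4}, {w1, w5}, {w2, w4}, {w2, w5}, {w3, w5}}"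
    and dist: "distinct [w1, w2, w3, w4, w5]"
  obtains e where "invariant e" "e w1 = 0" "e w2 = 1" "e w3 = 1" "e w4 = 0" "e w5 = 0"
    "\<And>z. z \<in> isolated \<Longrightarrow> e z = 0"
proof -
  have adj: "{x, y} \<in> E \<longleftrightarrow> x = w1 \<and> y = w3 \<or> x = w3 \<and> y = w1 \<or> x = w1 \<and> y = w4 \<or> x = w4 \<and> y = w1 \<or> x = w1 \<and> y = w5 \<or> x = w5 \<and> y = w1 \<or> x = w2 \<and> y = w4 \<or> x = w4 \<and> y = w2 \<or> x = w2 \<and> y = w5 \<or> x = w5 \<and> y = w2 \<or> x = w3 \<and> y = w5 \<or> x = w5 \<and> y = w3" for x y
    by (auto simp: E doubleton_eq_iff)
  have verts: "\<Union>E = {w1, w2, w3, w4, w5}" by (auto simp: E)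
  have ni: "x \<notin> isolated" if "x \<in> {w1, w2, w3, w4, w5}" for x
    using that by (simp add: isolated_iff verts)
  have cases: "x \<in> {w1, w2, w3, w4, w5} \<or> x \<in> isolated" for x
    by (auto simp: isolated_iff verts)
  have "indep {w1, w2}" using dist by (auto simp: indep_iff adj)
  then have F: "facet ({w1, w2} \<union> isolated)"
    by (rule facet_isolated) (unfold verts, auto simp: adj)
  obtain e where e: "invariant e" "e w2 = 1"
      "\<And>x. x \<in> {w1, w2} \<union> isolated \<Longrightarrow> x \<noteq> w2 \<Longrightarrow> e x = 0"
    by (rule facet_coordinate[OF F, of w2]) simp_all
  have e0: "e w1 = 0" "\<And>z. z \<in> isolated \<Longrightarrow> e z = 0"
    by (rule e(3); use dist ni in auto)+
  have nonneg: "e x \<ge> 0" if x: "x \<in> {w3, w4, w5}" for x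
  proof -
    have "{w1, x} \<in> E" using x by (auto simp: adj)
    then obtain n m where n: "int n * e w1 + e x = val e m"
        "\<And>x. x \<in> msupp m \<Longrightarrow> x \<noteq> w1 \<and> {x, w1} \<notin> E"
      using lift_edge_val e(1) by metis
    have "e y \<ge> 0" if "y \<in> msupp m" for y
    proof -
      have "y \<notin> {w3, w4, w5}" using n(2)[OF that] by (auto simp: adj)
      then show ?thesis using cases[of y] e0 e(2) by auto
    qed
    then have "val e m \<ge> 0"
      unfolding val_def by (intro sum_nonneg) (auto simp: msupp_def zero_le_mult_iff)
    then show ?thesis using n(1) e0 by simp
  qed
  have partner: "\<exists>s t. e p + e q = e s + e t \<and> s \<noteq> t \<and> {s, t} \<notin> E \<and> s \<notin> {p, q} \<and> t \<notin> {p, q}"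
    if "{p, q} \<in> E" for p q
    using edge_partner_val[OF that e(1)] by metis
  have "{w2, w4} \<in> E" "{w2, w5} \<in> E" "{w3, w5} \<in> E" by (auto simp: adj)
  note p = this[THEN partner]
  \<comment> \<open>The partner of an edge is disjoint from it and is not an edge. The sets in
    \<open>1\<close>, \<open>2\<close> and \<open>3\<close> list the values that such a pair can
    have, isolated vertices contributing 0.\<close>
  have 1: "1 + e w4 \<in> {0, e w3, e w5}"
    using p(1)
  proof (elim exE conjE)
    fix s t assume "e w2 + e w4 = e s + e t" "s \<noteq> t" "{s, t} \<notin> E" "s \<notin> {w2, w4}" "t \<notin> {w2, w4}"
    moreover have "(s, t) \<notin> {(w1, w3), (w3, w1), (w1, w5), (w5, w1), (w3, w5), (w5, w3)}"
      using \<open>{s, t} \<notin> E\<close> by (auto simp: adj)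
    ultimately show ?thesis using cases[of s] cases[of t] e0 e(2) by auto
  qed
  have 2: "1 + e w5 \<in> {0, e w3, e w4, e w3 + e w4}"
    using p(2)
  proof (elim exE conjE)
    fix s t assume "e w2 + e w5 = e s + e t" "s \<noteq> t" "{s, t} \<notin> E" "s \<notin> {w2, w5}" "t \<notin> {w2, w5}"
    moreover have "(s, t) \<notin> {(w1, w3), (w3, w1), (w1, w4), (w4, w1)}"
      using \<open>{s, t} \<notin> E\<close> by (auto simp: adj)
    ultimately show ?thesis using cases[of s] cases[of t] e0 e(2) by auto
  qed
  have 3: "e w3 + e w5 \<in> {0, 1, e w4}"
    using p(3)
  proof (elim exE conjE)
    fix s t assume "e w3 + e w5 = e s + e t" "s \<noteq> t" "{s, t} \<notin> E" "s \<notin> {w3, w5}" "t \<notin> {w3, w5}"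
    moreover have "(s, t) \<notin> {(w1, w4), (w4, w1), (w2, w4), (w4, w2)}"
      using \<open>{s, t} \<notin> E\<close> by (auto simp: adj)
    ultimately show ?thesis using cases[of s] cases[of t] e0 e(2) by auto
  qed
  have "e w3 \<ge> 0" "e w4 \<ge> 0" "e w5 \<ge> 0" using nonneg by auto
  with 1 2 3 have "e w3 = 1 \<and> e w4 = 0 \<and> e w5 = 0" by (smt (verit) insert_iff empty_iff)
  with that[of e] e e0 show thesis by auto
qed

text \<open>Reversing the path is an automorphism of the graph, which gives a second coordinate f
  with mirrored values. Both e and f have the value 1 on w1 w3. A pair that avoids w1 and w3 and has
  both values 1 could only be w2 w4, which is an edge.\<close>

lemma no_house:
  assumes E: "E = {{w1, w3}, {w1, w4}, {w1, w5}, {w2, w4}, {w2, w5}, {w3, w5}}"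
    and dist: "distinct [w1, w2, w3, w4, w5]"
  shows False
proof -
  have adj: "{x, y} \<in> E \<longleftrightarrow> x = w1 \<and> y = w3 \<or> x = w3 \<and> y = w1 \<or> x = w1 \<and> y = w4 \<or> x = w4 \<and> y = w1 \<or> x = w1 \<and> y = w5 \<or> x = w5 \<and> y = w1 \<or> x = w2 \<and> y = w4 \<or> x = w4 \<and> y = w2 \<or> x = w2 \<and> y = w5 \<or> x = w5 \<and> y = w2 \<or> x = w3 \<and> y = w5 \<or> x = w5 \<and> y = w3" for x y
    by (auto simp: E doubleton_eq_iff)
  have verts: "\<Union>E = {w1, w2, w3, w4, w5}" by (auto simp: E)
  have ni: "x \<notin> isolated" if "x \<in> {w1, w2, w3, w4, w5}" for x
    using that by (simp add: isolated_iff verts)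
  have cases: "x \<in> {w1, w2, w3, w4, w5} \<or> x \<in> isolated" for x
    by (auto simp: isolated_iff verts)
  obtain e where e: "invariant e" "e w1 = 0" "e w2 = 1" "e w3 = 1" "e w4 = 0" "e w5 = 0"
    "\<And>z. z \<in> isolated \<Longrightarrow> e z = 0" using house_coordinate[OF assms] by metis
  have E': "E = {{w5, w3}, {w5, w2}, {w5, w1}, {w4, w2}, {w4, w1}, {w3, w1}}"
    by (auto simp: E insert_commute)
  have dist': "distinct [w5, w4, w3, w2, w1]" using dist by auto
  obtain f where f: "invariant f" "f w5 = 0" "f w4 = 1" "f w3 = 1" "f w2 = 0" "f w1 = 0"
    "\<And>z. z \<in> isolated \<Longrightarrow> f z = 0" using house_coordinate[OF E' dist'] by metis
  have "{w1, w3} \<in> E" by (simp add: adj)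
  then obtain s t where st: "X w1 + X w3 \<approx> X s + X t" "s \<noteq> t" "{s, t} \<notin> E" "s \<notin> {w1, w3}" "t \<notin> {w1, w3}"
    using edge_partner by metis
  have "e s + e t = 1" "f s + f t = 1" using invariantD[OF e(1) st(1)] invariantD[OF f(1) st(1)] e f by simp_all
  moreover have "x \<in> {w2, w3}" if "e x \<noteq> 0" for x using cases[of x] e that by auto
  moreover have "x \<in> {w4, w3}" if "f x \<noteq> 0" for x using cases[of x] f that by auto
  moreover have "(s, t) \<notin> {(w2, w4), (w4, w2)}" using st(3) adj by auto
  ultimately show False using st(4,5) e(3,5) f(3,5)
    by (metis add.right_neutral add_0 insert_iff empty_iff zero_neq_one)
qed

lemma no_triangle_with_tails:
  assumes E: "E = {{a, b}, {a, c}, {a, d}, {b, c}, {b, f}, {d, g}}"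
    and dist: "distinct [a, b, c, d, f, g]"
  shows False
proof -
  have adj: "{x, y} \<in> E \<longleftrightarrow> x = a \<and> y = b \<or> x = b \<and> y = a \<or> x = a \<and> y = c \<or> x = c \<and> y = a \<or> x = a \<and> y = d \<or> x = d \<and> y = a \<or> x = b \<and> y = c \<or> x = c \<and> y = b \<or> x = b \<and> y = f \<or> x = f \<and> y = b \<or> x = d \<and> y = g \<or> x = g \<and> y = d" for x y
    by (auto simp: E doubleton_eq_iff)
  have verts: "\<Union>E = {a, b, c, d, f, g}" by (auto simp: E)
  have ni: "x \<notin> isolated" if "x \<in> {a, b, c, d, f, g}" for x
    using that by (simp add: isolated_iff verts)
  have ind: "indep {b, d}" "indep {a, f, g}" using dist by (auto simp: indep_iff adj)
  have F: "facet ({b, d} \<union> isolated)"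
    by (rule facet_isolated[OF ind(1)]) (unfold verts, auto simp: adj)
  have G: "facet ({a, f, g} \<union> isolated)"
    by (rule facet_isolated[OF ind(2)]) (unfold verts, auto simp: adj)
  show False using no_facets_2_3[OF G F] dist ni by auto
qed

lemma no_pendant_pentagon:
  assumes E: "E = {{a, b}, {a, c}, {a, d}, {b, f}, {c, g}, {f, g}}"
    and dist: "distinct [a, b, c, d, f, g]"
  shows False
proof -
  have adj: "{x, y} \<in> E \<longleftrightarrow> x = a \<and> y = b \<or> x = b \<and> y = a \<or> x = a \<and> y = c \<or> x = c \<and> y = a \<or> x = a \<and> y = d \<or> x = d \<and> y = a \<or> x = b \<and> y = f \<or> x = f \<and> y = b \<or> x = c \<and> y = g \<or> x = g \<and> y = c \<or> x = f \<and> y = g \<or> x = g \<and> y = f" for x y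
    by (auto simp: E doubleton_eq_iff)
  have verts: "\<Union>E = {a, b, c, d, f, g}" by (auto simp: E)
  have ni: "x \<notin> isolated" if "x \<in> {a, b, c, d, f, g}" for x
    using that by (simp add: isolated_iff verts)
  have ind: "indep {a, f}" "indep {b, d, g}" using dist by (auto simp: indep_iff adj)
  have F: "facet ({a, f} \<union> isolated)"
    by (rule facet_isolated[OF ind(1)]) (unfold verts, auto simp: adj)
  have G: "facet ({b, d, g} \<union> isolated)"
    by (rule facet_isolated[OF ind(2)]) (unfold verts, auto simp: adj)
  show False using no_facets_2_3[OF G F] dist ni by auto
qed

end

section \<open>Linear algebra\<close>

context vector_space
begin

text \<open>Stated for an indexed family, because the hypothesis also rules out repetitions; this
  yields the cardinality.\<close>

lemma independent_family:
  assumes fin: "finite A"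
    and indep: "\<And>c. (\<Sum>a\<in>A. c a *s g a) = 0 \<Longrightarrow> \<forall>a\<in>A. c a = 0"
  shows "independent (g ` A)" "card (g ` A) = card A"
proof -
  have inj: "inj_on g A"
  proof (rule inj_onI, rule ccontr)
    fix a b assume ab: "a \<in> A" "b \<in> A" "g a = g b" "a \<noteq> b"
    define c where "c x = (if x = a then 1 else if x = b then -1 else 0 :: 'a)" for x
    have "(\<Sum>x\<in>A. c x *s g x) = (\<Sum>x\<in>{a, b}. c x *s g x)"
      using ab fin by (intro sum.mono_neutral_right) (auto simp: c_def)
    also have "\<dots> = 0" using ab by (simp add: c_def)
    finally have "c a = 0" using indep ab by blast
    then show False by (simp add: c_def)
  qed
  show "independent (g ` A)"
  proof (rule independent_if_scalars_zero)
    fix f x assume "(\<Sum>x\<in>g ` A. f x *s x) = 0" "x \<in> g ` A"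
    then show "f x = 0" using indep[of "f \<circ> g"] by (auto simp: sum.reindex[OF inj])
  qed (use fin in auto)
  show "card (g ` A) = card A" using inj by (rule card_image)
qed

lemma dim_family:
  assumes "finite A" "\<And>c. (\<Sum>a\<in>A. c a *s g a) = 0 \<Longrightarrow> \<forall>a\<in>A. c a = 0"
    and "\<And>a. a \<in> A \<Longrightarrow> g a \<in> V" "V \<subseteq> span (g ` A)"
  shows "dim V = card A"
proof -
  have "g ` A \<subseteq> V" using assms(3) by auto
  then show ?thesis
    using basis_card_eq_dim[OF _ assms(4)] independent_family[OF assms(1,2)] by simp
qed

end

context vector_space_pair
begin

text \<open>A relative form: the ambient space may be infinite-dimensional, as the polynomial ring
  is, and \<open>W\<close> keeps V finite-dimensional. A basis of the kernel is extended to one of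
  V, and f is injective on the span of the added vectors.\<close>

lemma rank_nullity:
  assumes f: "Vector_Spaces.linear s1 s2 f" and V: "vs1.subspace V" "V \<subseteq> vs1.span W" "finite W"
  shows "vs1.dim V = vs2.dim (f ` V) + vs1.dim {x \<in> V. f x = 0}"
proof -
  interpret f: Vector_Spaces.linear s1 s2 f by (rule f)
  obtain B where B: "B \<subseteq> {x \<in> V. f x = 0}" "vs1.independent B" "{x \<in> V. f x = 0} \<subseteq> vs1.span B"
    using vs1.maximal_independent_subset by blast
  obtain A where A: "B \<subseteq> A" "A \<subseteq> V" "vs1.independent A" "V \<subseteq> vs1.span A"
    using vs1.maximal_independent_subset_extend[of B V] B by blast
  have finA: "finite A" using vs1.independent_span_bound[of W A] V A by blast
  define C where "C = A - B"
  have AC: "A = B \<union> C" "B \<inter> C = {}" using A by (auto simp: C_def)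
  have finC: "finite C" using finA by (simp add: C_def)
  have inj: "inj_on f (vs1.span C)"
  proof (subst f.inj_on_iff_eq_0)
    show "\<forall>x\<in>vs1.span C. f x = 0 \<longrightarrow> x = 0"
    proof (intro ballI impI)
      fix x assume x: "x \<in> vs1.span C" "f x = 0"
      have "vs1.span C \<subseteq> V" using A AC V(1) by (intro vs1.span_minimal) auto
      then have "x \<in> vs1.span B" using x B(3) by blast
      then have 1: "vs1.representation A x = vs1.representation B x"
        using A by (intro vs1.representation_extend)
      have 2: "vs1.representation A x = vs1.representation C x"
        using A x(1) AC by (intro vs1.representation_extend) auto
      have "vs1.representation A x b = 0" for b
        using vs1.representation_ne_zero[of B x b] vs1.representation_ne_zero[of C x b] 1 2 AC(2) by fastforce
      moreover have "x \<in> vs1.span A" using x(1) AC(1) vs1.span_mono[of C A] by auto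
      ultimately show "x = 0" using vs1.sum_representation_eq[OF A(3) _ finA subset_refl, of x] by simp
    qed
  qed simp
  have indC: "vs1.independent C" using A(3) AC(1) by (meson Un_upper2 vs1.independent_mono)
  have "vs2.independent (f ` C)" using f.independent_injective_image[OF indC inj] .
  moreover have "f ` V \<subseteq> vs2.span (f ` C)"
  proof -
    have "f ` V \<subseteq> vs2.span (f ` A)" by (rule f.spans_image[OF A(4)])
    also have "f ` A \<subseteq> insert 0 (f ` C)" using B(1) AC by auto
    then have "vs2.span (f ` A) \<subseteq> vs2.span (f ` C)"
      using vs2.span_mono[of "f ` A" "insert 0 (f ` C)"] by simp
    finally show ?thesis .
  qed
  moreover have "f ` C \<subseteq> f ` V" using A AC by auto
  ultimately have "card (f ` C) = vs2.dim (f ` V)" by (intro vs2.basis_card_eq_dim)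
  moreover have "card (f ` C) = card C"
    by (intro card_image inj_on_subset[OF inj] vs1.span_superset)
  moreover have "card B = vs1.dim {x \<in> V. f x = 0}" by (rule vs1.basis_card_eq_dim[OF B(1,3,2)])
  moreover have "card A = vs1.dim V" by (rule vs1.basis_card_eq_dim[OF A(2,4,3)])
  moreover have "card A = card B + card C"
    using finA AC(2) unfolding AC(1) by (intro card_Un_disjoint) auto
  ultimately show ?thesis by simp
qed

end

section \<open>Homogeneous polynomials\<close>

lemma poly_sum_single: "f = (\<Sum>m\<in>Poly_Mapping.keys f. Poly_Mapping.single m (Poly_Mapping.lookup f m))"
proof (rule poly_mapping_eqI)
  fix k
  have "(\<Sum>m\<in>Poly_Mapping.keys f. Poly_Mapping.lookup (Poly_Mapping.single m (Poly_Mapping.lookup f m)) k) =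
      (\<Sum>m\<in>Poly_Mapping.keys f. if m = k then Poly_Mapping.lookup f m else 0)"
    by (intro sum.cong) (auto simp: lookup_single)
  then show "Poly_Mapping.lookup f k =
      Poly_Mapping.lookup (\<Sum>m\<in>Poly_Mapping.keys f. Poly_Mapping.single m (Poly_Mapping.lookup f m)) k"
    by (simp add: lookup_sum in_keys_iff)
qed

lemma single_times_sum:
  fixes f :: "('a::comm_monoid_add) \<Rightarrow>\<^sub>0 'k::comm_ring_1"
  shows "Poly_Mapping.single t a * f =
    (\<Sum>m\<in>Poly_Mapping.keys f. Poly_Mapping.single (t + m) (a * Poly_Mapping.lookup f m))"
proof -
  have "Poly_Mapping.single t a * f = Poly_Mapping.single t a *
      (\<Sum>m\<in>Poly_Mapping.keys f. Poly_Mapping.single m (Poly_Mapping.lookup f m))"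
    by (rule arg_cong[OF poly_sum_single])
  then show ?thesis unfolding sum_distrib_left mult_single .
qed

lemma lookup_single_times:
  fixes f :: "('a::cancel_comm_monoid_add) \<Rightarrow>\<^sub>0 'k::comm_ring_1"
  shows "Poly_Mapping.lookup (Poly_Mapping.single t a * f) (t + m) = a * Poly_Mapping.lookup f m"
proof -
  have "Poly_Mapping.lookup (Poly_Mapping.single t a * f) (t + m) =
      (\<Sum>m'\<in>Poly_Mapping.keys f. if m' = m then a * Poly_Mapping.lookup f m' else 0)"
    unfolding single_times_sum lookup_sum by (intro sum.cong) (auto simp: lookup_single when_def)
  then show ?thesis by (simp add: in_keys_iff)
qed

lemma keys_single_times:
  fixes f :: "('a::comm_monoid_add) \<Rightarrow>\<^sub>0 'k::comm_ring_1"
  shows "Poly_Mapping.keys (Poly_Mapping.single t a * f) \<subseteq> (+) t ` Poly_Mapping.keys f"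
proof -
  have "Poly_Mapping.keys (Poly_Mapping.single t a * f) \<subseteq>
      (\<Union>m\<in>Poly_Mapping.keys f. Poly_Mapping.keys (Poly_Mapping.single (t + m) (a * Poly_Mapping.lookup f m)))"
    unfolding single_times_sum by (rule keys_sum)
  also have "\<dots> \<subseteq> (+) t ` Poly_Mapping.keys f" by (auto split: if_splits)
  finally show ?thesis .
qed

text \<open>Scalar multiplication over the field becomes multiplication in the ring, so that linear
  algebra and ideal arguments share one product.\<close>

definition cpoly :: "'k \<Rightarrow> ('v, 'k::comm_ring_1) mpoly" where
  "cpoly c = Poly_Mapping.single 0 c"

lemma lookup_cpoly_times [simp]: "Poly_Mapping.lookup (cpoly c * f) m = c * Poly_Mapping.lookup f m"
  using lookup_single_times[of 0 c f m] by (simp add: cpoly_def)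

lemma cpoly_simps: "cpoly (a + b) = cpoly a + cpoly b" "cpoly (a * b) = cpoly a * cpoly b"
  "cpoly 1 = 1" "cpoly 0 = 0"
  by (simp_all add: cpoly_def single_add mult_single)

lemma lookup_mono_poly: "Poly_Mapping.lookup (mono_poly m) k = (if m = k then 1 else 0)"
  by (simp add: mono_poly_def lookup_single when_def)

lemma mono_poly_times: "mono_poly s * mono_poly t = mono_poly (s + t)"
  by (simp add: mono_poly_def mult_single)

lemma poly_sum_mono: "f = (\<Sum>m\<in>Poly_Mapping.keys f. cpoly (Poly_Mapping.lookup f m) * mono_poly m)"
  using poly_sum_single[of f] by (simp add: cpoly_def mono_poly_def mult_single)

definition homogeneous :: "nat \<Rightarrow> ('v::finite, 'k::comm_ring_1) mpoly \<Rightarrow> bool" where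
  "homogeneous d f \<longleftrightarrow> (\<forall>m\<in>Poly_Mapping.keys f. mdeg m = d)"

definition component :: "nat \<Rightarrow> ('v::finite, 'k::comm_ring_1) mpoly \<Rightarrow> ('v, 'k) mpoly" where
  "component d f = (\<Sum>m | m \<in> Poly_Mapping.keys f \<and> mdeg m = d. Poly_Mapping.single m (Poly_Mapping.lookup f m))"

lemma lookup_component:
  "Poly_Mapping.lookup (component d f) k = (if mdeg k = d then Poly_Mapping.lookup f k else 0)"
proof -
  have "Poly_Mapping.lookup (component d f) k =
      (\<Sum>m | m \<in> Poly_Mapping.keys f \<and> mdeg m = d. if m = k then Poly_Mapping.lookup f m else 0)"
    unfolding component_def lookup_sum by (intro sum.cong) (auto simp: lookup_single when_def)
  then show ?thesis by (simp add: in_keys_iff)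
qed

lemma component_0 [simp]: "component d 0 = 0"
  by (simp add: component_def)

lemma component_plus: "component d (f + g) = component d f + component d g"
  by (rule poly_mapping_eqI) (simp add: lookup_component lookup_add)

lemma component_sum: "component d (\<Sum>i\<in>A. f i) = (\<Sum>i\<in>A. component d (f i))"
  by (induction A rule: infinite_finite_induct) (auto simp: component_plus)

lemma component_single: "component d (Poly_Mapping.single m a) = (if mdeg m = d then Poly_Mapping.single m a else 0)"
  by (rule poly_mapping_eqI) (auto simp: lookup_component lookup_single when_def)

lemma homogeneous_component [simp]: "homogeneous d (component d f)"
  by (auto simp: homogeneous_def in_keys_iff lookup_component split: if_splits)

lemma component_homogeneous: "homogeneous d f \<Longrightarrow> component d f = f"
  by (rule poly_mapping_eqI) (auto simp: lookup_component homogeneous_def in_keys_iff)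

lemma component_single_times:
  "component (mdeg t + d) (Poly_Mapping.single t a * f) = Poly_Mapping.single t a * component d f"
proof -
  have "component (mdeg t + d) (Poly_Mapping.single t a * f) =
      component (mdeg t + d) (Poly_Mapping.single t a * (\<Sum>m\<in>Poly_Mapping.keys f. Poly_Mapping.single m (Poly_Mapping.lookup f m)))"
    by (rule arg_cong[OF poly_sum_single])
  also have "\<dots> = (\<Sum>m\<in>Poly_Mapping.keys f. component (mdeg t + d) (Poly_Mapping.single (t + m) (a * Poly_Mapping.lookup f m)))"
    by (simp add: sum_distrib_left component_sum mult_single)
  also have "\<dots> = (\<Sum>m\<in>Poly_Mapping.keys f. Poly_Mapping.single t a * component d (Poly_Mapping.single m (Poly_Mapping.lookup f m)))"
    by (intro sum.cong) (auto simp: component_single mult_single)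
  also have "\<dots> = Poly_Mapping.single t a * component d f"
    unfolding sum_distrib_left[symmetric] component_sum[symmetric] poly_sum_single[of f, symmetric] ..
  finally show ?thesis .
qed

lemma component_times:
  assumes "homogeneous e a" shows "component (e + d) (a * f) = a * component d f"
proof -
  have "component (e + d) (a * f) =
      component (e + d) ((\<Sum>m\<in>Poly_Mapping.keys a. Poly_Mapping.single m (Poly_Mapping.lookup a m)) * f)"
    by (rule arg_cong[OF poly_sum_single])
  also have "\<dots> = (\<Sum>m\<in>Poly_Mapping.keys a. component (e + d) (Poly_Mapping.single m (Poly_Mapping.lookup a m) * f))"
    by (simp add: sum_distrib_right component_sum)
  also have "\<dots> = (\<Sum>m\<in>Poly_Mapping.keys a. Poly_Mapping.single m (Poly_Mapping.lookup a m) * component d f)"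
    using assms by (intro sum.cong) (auto simp: homogeneous_def simp flip: component_single_times)
  also have "\<dots> = a * component d f"
    unfolding sum_distrib_right[symmetric] poly_sum_single[of a, symmetric] ..
  finally show ?thesis .
qed

lemma component_times_less:
  assumes "homogeneous e a" "d < e" shows "component d (a * f) = 0"
proof (rule poly_mapping_eqI)
  fix k
  have "Poly_Mapping.lookup (a * f) k = 0" if "mdeg k = d"
  proof (rule ccontr)
    assume "Poly_Mapping.lookup (a * f) k \<noteq> 0"
    then obtain s t where "k = s + t" "s \<in> Poly_Mapping.keys a" using keys_mult[of a f] by (auto simp: in_keys_iff)
    then show False using assms that by (auto simp: homogeneous_def)
  qed
  then show "Poly_Mapping.lookup (component d (a * f)) k = Poly_Mapping.lookup 0 k"
    by (simp add: lookup_component)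
qed

lemma homogeneous_times:
  assumes "homogeneous d f" "homogeneous e g" shows "homogeneous (d + e) (f * g)"
proof -
  have "component (d + e) (f * g) = f * g" using component_times[OF assms(1)] component_homogeneous[OF assms(2)] by simp
  then show ?thesis by (metis homogeneous_component)
qed

lemma homogeneous_plus: "homogeneous d f \<Longrightarrow> homogeneous d g \<Longrightarrow> homogeneous d (f + g)"
  by (metis component_homogeneous component_plus homogeneous_component)

lemma homogeneous_sum: "(\<And>i. i \<in> A \<Longrightarrow> homogeneous d (f i)) \<Longrightarrow> homogeneous d (\<Sum>i\<in>A. f i)"
  by (metis (mono_tags, lifting) component_homogeneous component_sum homogeneous_component sum.cong)

lemma homogeneous_mono_poly [simp]: "homogeneous (mdeg m) (mono_poly m)"
  by (auto simp: homogeneous_def in_keys_iff lookup_mono_poly split: if_splits)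

lemma homogeneous_cpoly_times: "homogeneous d f \<Longrightarrow> homogeneous d (cpoly c * f)"
  by (auto simp: homogeneous_def in_keys_iff)

lemma homogeneous_0_cpoly:
  assumes "homogeneous 0 f" shows "f = cpoly (Poly_Mapping.lookup f 0)"
proof (rule poly_mapping_eqI)
  fix k :: "'a \<Rightarrow>\<^sub>0 nat"
  have "k = 0" if "mdeg k = 0"
    using that by (intro poly_mapping_eqI) (simp add: mdeg_def)
  then have "Poly_Mapping.lookup f k = 0" if "k \<noteq> 0"
    using assms that by (meson homogeneous_def in_keys_iff)
  then show "Poly_Mapping.lookup f k = Poly_Mapping.lookup (cpoly (Poly_Mapping.lookup f 0)) k"
    by (auto simp: cpoly_def lookup_single when_def)
qed

section \<open>Ideals generated by homogeneous polynomials\<close>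

interpretation ideal: Modules.module "(*) :: 'a::comm_ring_1 \<Rightarrow> 'a \<Rightarrow> 'a"
  by (rule module_times)

lemma vector_space_poly: "vector_space (\<lambda>(c :: 'k::field) (f :: ('v::finite, 'k) mpoly). cpoly c * f)"
proof
  fix a b :: 'k and x y :: "('v, 'k) mpoly"
  show "cpoly a * (x + y) = cpoly a * x + cpoly a * y" by (rule distrib_left)
  show "cpoly (a + b) * x = cpoly a * x + cpoly b * x" unfolding cpoly_simps by (rule distrib_right)
  show "cpoly a * (cpoly b * x) = cpoly (a * b) * x" unfolding cpoly_simps by (rule mult.assoc[symmetric])
  show "cpoly 1 * x = x" unfolding cpoly_simps by (rule mult_1_left)
qed

interpretation poly: vector_space "\<lambda>(c :: 'k::field) (f :: ('v::finite, 'k) mpoly). cpoly c * f"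
  by (rule vector_space_poly)

text \<open>In degree e only the constant terms of the coefficients contribute, and below degree e
  nothing does.\<close>

lemma ideal_lowest_degree:
  assumes "f \<in> ideal_gen B" "\<And>b. b \<in> B \<Longrightarrow> homogeneous e b"
  shows "component e f \<in> poly.span B" "d < e \<Longrightarrow> component d f = 0"
proof -
  show "component e f \<in> poly.span B"
    using assms(1)
  proof (induction rule: ideal.span_induct_alt)
    case base
    then show ?case by (simp add: poly.span_zero)
  next
    case (step c b f)
    have "component (e + 0) (b * c) = b * component 0 c"
      by (rule component_times[OF assms(2)[OF step(1)]])
    also have "\<dots> = cpoly (Poly_Mapping.lookup (component 0 c) 0) * b"
      using homogeneous_0_cpoly[OF homogeneous_component, of c] by (metis mult.commute)
    finally have eq: "component e (c * b) = cpoly (Poly_Mapping.lookup (component 0 c) 0) * b"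
      by (simp add: mult.commute)
    have "component e (c * b) \<in> poly.span B"
      unfolding eq by (rule poly.span_scale[OF poly.span_base[OF step(1)]])
    then show ?case using step(2) by (simp add: component_plus poly.span_add)
  qed
  show "component d f = 0" if "d < e"
    using assms(1)
  proof (induction rule: ideal.span_induct_alt)
    case (step c b f)
    then show ?case using component_times_less[OF assms(2)[OF step(1)] that, of c]
      by (simp add: component_plus mult.commute)
  qed simp
qed

lemma ideal_monomials:
  assumes "f \<in> ideal_gen (mono_poly ` M)" "m \<in> Poly_Mapping.keys f"
  shows "\<exists>m0\<in>M. \<exists>t. m = m0 + t"
  using assms
proof (induction arbitrary: m rule: ideal.span_induct_alt)
  case (step c b f)
  then obtain m0 where m0: "m0 \<in> M" "b = Poly_Mapping.single m0 1" by (auto simp: mono_poly_def)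
  show ?case
  proof (cases "m \<in> Poly_Mapping.keys f")
    case False
    then have "m \<in> Poly_Mapping.keys (Poly_Mapping.single m0 1 * c)"
      using step.prems keys_add[of "c * b" f] m0 by (auto simp: mult.commute)
    then show ?thesis using keys_single_times m0 by blast
  qed (use step in blast)
qed simp

lemma mono_in_monomial_ideal_iff:
  "mono_poly m \<in> (ideal_gen (mono_poly ` M) :: ('v, 'k::comm_ring_1) mpoly set) \<longleftrightarrow> (\<exists>m0\<in>M. \<exists>t. m = m0 + t)"
proof
  assume "mono_poly m \<in> (ideal_gen (mono_poly ` M) :: ('v, 'k) mpoly set)"
  then show "\<exists>m0\<in>M. \<exists>t. m = m0 + t"
    by (rule ideal_monomials) (simp add: in_keys_iff lookup_mono_poly)
next
  assume "\<exists>m0\<in>M. \<exists>t. m = m0 + t"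
  then obtain m0 t where "m0 \<in> M" "m = m0 + t" by blast
  then have "mono_poly m = mono_poly t * (mono_poly m0 :: ('v, 'k) mpoly)" by (simp add: mono_poly_times add.commute)
  then show "mono_poly m \<in> (ideal_gen (mono_poly ` M) :: ('v, 'k) mpoly set)"
    using \<open>m0 \<in> M\<close> by (simp add: ideal.span_scale ideal.span_base)
qed

section \<open>Graphs with six edges\<close>

text \<open>A graph with vertices \<open>0, \<dots>, n - 1\<close> is encoded as \<open>(n, es)\<close>, every edge being listed once
  as a pair \<open>(a, b)\<close> with \<open>a < b\<close>.\<close>

type_synonym lgraph = "nat \<times> (nat \<times> nat) list"

definition adjacent :: "(nat \<times> nat) list \<Rightarrow> nat \<Rightarrow> nat \<Rightarrow> bool" where
  "adjacent es a b \<longleftrightarrow> (a, b) \<in> set es \<or> (b, a) \<in> set es"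

text \<open>The edges are kept in lexicographic order so that isomorphic graphs with suitable labels
  become equal lists, which \<open>remdups\<close> merges. The correctness proofs use only the set
  and the length of the result.\<close>

fun insert_edge :: "nat \<times> nat \<Rightarrow> (nat \<times> nat) list \<Rightarrow> (nat \<times> nat) list" where
  "insert_edge (a, b) [] = [(a, b)]"
| "insert_edge (a, b) ((c, d) # es) =
     (if a < c \<or> a = c \<and> b < d then (a, b) # (c, d) # es else (c, d) # insert_edge (a, b) es)"

text \<open>The new edge joins two old vertices, an old and a new one, or two new ones. Starting
  from a single edge, this reaches every graph without isolated vertices up to labelling.\<close>

definition extensions :: "lgraph \<Rightarrow> lgraph list" where
  "extensions = (\<lambda>(n, es).
     [(n, insert_edge (a, b) es). a \<leftarrow> [0..<n], b \<leftarrow> [Suc a..<n], (a, b) \<notin> set es] @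
     [(Suc n, insert_edge (a, n) es). a \<leftarrow> [0..<n]] @ [(Suc (Suc n), insert_edge (n, Suc n) es)])"

fun map_edges :: "nat list \<Rightarrow> (nat \<times> nat) list \<Rightarrow> (nat \<times> nat) list" where
  "map_edges \<rho> [] = []"
| "map_edges \<rho> ((a, b) # es) =
     insert_edge (if \<rho> ! a < \<rho> ! b then (\<rho> ! a, \<rho> ! b) else (\<rho> ! b, \<rho> ! a)) (map_edges \<rho> es)"

text \<open>Falls back on the given edges unless \<rho> is a permutation of the labels, which makes
  relabelling sound for arbitrary data.\<close>

definition relabel :: "nat list \<Rightarrow> lgraph \<Rightarrow> lgraph" where
  "relabel \<rho> = (\<lambda>(n, es).
     (n, if length \<rho> = n \<and> distinct \<rho> \<and> list_all (\<lambda>i. i < n) \<rho> then map_edges \<rho> es else es))"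

fun relabel_all :: "nat list list \<Rightarrow> lgraph list \<Rightarrow> lgraph list" where
  "relabel_all (\<rho> # \<rho>s) (G # Gs) = relabel \<rho> G # relabel_all \<rho>s Gs"
| "relabel_all _ Gs = Gs"

fun neighbours :: "(nat \<times> nat) list \<Rightarrow> nat \<Rightarrow> nat \<Rightarrow> nat list" where
  "neighbours [] a b = []"
| "neighbours ((x, y) # es) a b =
     (if x = a \<and> y \<noteq> b then y # neighbours es a b
      else if y = a \<and> x \<noteq> b then x # neighbours es a b else neighbours es a b)"

text \<open>Neighbours are compared as lists in edge order. Equal lists give equal neighbourhoods,
  which justifies discarding the graph; an overlooked pair of twins could only leave more graphs to
  treat.\<close>

definition has_twins :: "lgraph \<Rightarrow> bool" where
  "has_twins = (\<lambda>(n, es). list_ex (\<lambda>a. list_ex (\<lambda>b. neighbours es a b = neighbours es b a \<and> neighbours es a b \<noteq> [])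
     [Suc a..<n]) [0..<n])"

text \<open>Runs through all sets of edges by deciding for each edge in turn whether it belongs to
  the set: \<open>vs\<close> holds the vertices covered so far and \<open>s\<close> the sign. A
  branch is cut beyond four vertices, since the covered set only grows.\<close>

fun kappa4 :: "(nat \<times> nat) list \<Rightarrow> nat list \<Rightarrow> int \<Rightarrow> int" where
  "kappa4 [] vs s = (if length vs = 4 then s else 0)"
| "kappa4 ((a, b) # es) vs s = kappa4 es vs s +
     (let ws = List.insert a (List.insert b vs) in if length ws \<le> 4 then kappa4 es ws (- s) else 0)"

text \<open>The condition on the length excludes repeated edges, which would spoil the signs in
  \<open>kappa4\<close>.\<close>

fun realises :: "'v list \<Rightarrow> lgraph \<Rightarrow> 'v set set \<Rightarrow> bool" where
  "realises vs (n, es) E \<longleftrightarrow> distinct vs \<and> length vs = n \<and> length es = card E \<and>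
     (\<forall>(a, b)\<in>set es. a < b \<and> b < n) \<and> E = (\<lambda>(a, b). {vs ! a, vs ! b}) ` set es"

section \<open>Soundness of the operations on encoded graphs\<close>

lemma set_insert_edge [simp]: "set (insert_edge e es) = insert e (set es)"
  by (induction e es rule: insert_edge.induct) auto

lemma length_insert_edge [simp]: "length (insert_edge e es) = Suc (length es)"
  by (induction e es rule: insert_edge.induct) auto

lemma set_neighbours: "x \<in> set (neighbours es a b) \<longleftrightarrow> x \<noteq> b \<and> adjacent es a x"
  by (induction es a b rule: neighbours.induct) (auto simp: adjacent_def)

lemma realises_adjacent:
  assumes "realises vs (n, es) E" "a < n" "b < n"
  shows "adjacent es a b \<longleftrightarrow> {vs ! a, vs ! b} \<in> E"
  using assms by (fastforce simp: adjacent_def doubleton_eq_iff nth_eq_iff_index_eq)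

lemma realises_extension:
  assumes r: "realises vs G E" and e: "card e = 2" "e \<notin> E"
  shows "\<exists>G'\<in>set (extensions G). \<exists>vs'. realises vs' G' (insert e E)"
proof -
  obtain n es where G: "G = (n, es)" by (cases G)
  obtain x y where xy: "e = {x, y}" "x \<noteq> y" using e(1) by (meson card_2_iff)
  have E: "distinct vs" "length vs = n" "length es = card E" "\<And>a b. (a, b) \<in> set es \<Longrightarrow> a < b \<and> b < n"
    "E = (\<lambda>(a, b). {vs ! a, vs ! b}) ` set es"
    using r by (auto simp: G)
  have card: "card (insert e E) = Suc (card E)" using e(2) E(5) by (simp only: card_insert_disjoint finite_imageI finite_set not_False_eq_True)
  consider (old) a b where "a < b" "b < n" "e = {vs ! a, vs ! b}"
    | (half) a v where "a < n" "v \<notin> set vs" "e = {vs ! a, v}"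
    | (new) "x \<notin> set vs" "y \<notin> set vs"
  proof -
    have "\<exists>a<n. z = vs ! a" if "z \<in> set vs" for z
      using that E(2) by (auto simp: in_set_conv_nth)
    then consider a b where "a < n" "b < n" "x = vs ! a" "y = vs ! b" "a \<noteq> b"
      | a where "a < n" "x = vs ! a" "y \<notin> set vs" | a where "a < n" "y = vs ! a" "x \<notin> set vs"
      | "x \<notin> set vs" "y \<notin> set vs"
      using xy(2) by metis
    then show thesis
    proof cases
      case (1 a b)
      then show thesis
        using that(1)[of a b] that(1)[of b a] xy(1) by (cases "a < b") (auto simp: insert_commute)
    qed (use that(2,3) xy(1) in \<open>auto simp: insert_commute\<close>)
  qed
  then show ?thesis
  proof cases
    case old
    have "(a, b) \<notin> set es" using old e(2) E(5) by force
    then have "(n, insert_edge (a, b) es) \<in> set (extensions G)"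
      using old by (auto simp: extensions_def G) (rule bexI[of _ a], rule bexI[of _ b], simp_all)
    moreover have "realises vs (n, insert_edge (a, b) es) (insert e E)"
      using old E card by auto
    ultimately show ?thesis by blast
  next
    case half
    have "(Suc n, insert_edge (a, n) es) \<in> set (extensions G)" using half by (auto simp: extensions_def G)
    moreover have "(\<lambda>(a, b). {(vs @ [v]) ! a, (vs @ [v]) ! b}) ` set es = E"
      unfolding E(5) by (rule image_cong) (auto simp: nth_append E(2) dest!: E(4))
    then have "realises (vs @ [v]) (Suc n, insert_edge (a, n) es) (insert e E)"
      using half E card by (auto simp: nth_append dest: E(4) less_SucI)
    ultimately show ?thesis by blast
  next
    case new
    have "(Suc (Suc n), insert_edge (n, Suc n) es) \<in> set (extensions G)" by (auto simp: extensions_def G)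
    moreover have "(\<lambda>(a, b). {(vs @ [x, y]) ! a, (vs @ [x, y]) ! b}) ` set es = E"
      unfolding E(5) by (rule image_cong) (auto simp: nth_append E(2) dest!: E(4))
    then have "realises (vs @ [x, y]) (Suc (Suc n), insert_edge (n, Suc n) es) (insert e E)"
      using new xy E card by (auto simp: nth_append dest: E(4) less_SucI)
    ultimately show ?thesis by blast
  qed
qed

lemma length_map_edges: "length (map_edges \<rho> es) = length es"
  by (induction \<rho> es rule: map_edges.induct) auto

lemma set_map_edges:
  "set (map_edges \<rho> es) = (\<lambda>(a, b). if \<rho> ! a < \<rho> ! b then (\<rho> ! a, \<rho> ! b) else (\<rho> ! b, \<rho> ! a)) ` set es"
  by (induction \<rho> es rule: map_edges.induct) auto

lemma realises_relabel:
  assumes r: "realises vs G E" shows "\<exists>vs'. realises vs' (relabel \<rho> G) E"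
proof -
  obtain n es where G: "G = (n, es)" by (cases G)
  show ?thesis
  proof (cases "length \<rho> = n \<and> distinct \<rho> \<and> list_all (\<lambda>i. i < n) \<rho>")
    case False
    then show ?thesis using r by (auto simp: relabel_def G)
  next
    case True
    have vs: "distinct vs" "length vs = n" "length es = card E" "\<And>a b. (a, b) \<in> set es \<Longrightarrow> a < b \<and> b < n"
      "E = (\<lambda>(a, b). {vs ! a, vs ! b}) ` set es"
      using r by (auto simp: G)
    have \<rho>: "\<rho> ! i < n" if "i < n" for i using True that by (auto simp: list_all_iff)
    have inj: "\<rho> ! i = \<rho> ! j \<longleftrightarrow> i = j" if "i < n" "j < n" for i j
      using True that by (auto simp: nth_eq_iff_index_eq)
    have bij: "bij_betw (\<lambda>i. \<rho> ! i) {..<n} {..<n}"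
    proof -
      have "inj_on (\<lambda>i. \<rho> ! i) {..<n}" using inj by (simp add: inj_on_def)
      moreover from this have "(\<lambda>i. \<rho> ! i) ` {..<n} = {..<n}" using \<rho> by (intro endo_inj_surj) auto
      ultimately show ?thesis by (simp add: bij_betw_def)
    qed
    define \<sigma> where "\<sigma> = inv_into {..<n} (\<lambda>i. \<rho> ! i)"
    \<comment> \<open>The vertex with label i receives the label \<open>\<rho> ! i\<close>, so the
      new list of vertices is the old one composed with the inverse permutation.\<close>
    define ws where "ws = map (\<lambda>j. vs ! \<sigma> j) [0..<n]"
    have \<sigma>: "\<sigma> (\<rho> ! i) = i" if "i < n" for i
      unfolding \<sigma>_def using bij that by (intro inv_into_f_f) (auto simp: bij_betw_def)
    have ws: "ws ! (\<rho> ! i) = vs ! i" if "i < n" for i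
      using \<rho> that by (simp add: ws_def \<sigma>)
    have "bij_betw \<sigma> {..<n} {..<n}" unfolding \<sigma>_def by (rule bij_betw_inv_into[OF bij])
    then have "\<sigma> i < n" "\<sigma> i = \<sigma> j \<longleftrightarrow> i = j" if "i < n" "j < n" for i j
      using that by (auto simp: bij_betw_def inj_on_eq_iff)
    then have "distinct ws" using vs(1,2)
      by (simp add: ws_def distinct_map inj_on_def nth_eq_iff_index_eq)
    define h where "h = (\<lambda>(a, b). if \<rho> ! a < \<rho> ! b then (\<rho> ! a, \<rho> ! b) else (\<rho> ! b, \<rho> ! a))"
    have h: "set (map_edges \<rho> es) = h ` set es" unfolding set_map_edges h_def ..
    have edge: "{vs ! fst e, vs ! snd e} = {ws ! fst (h e), ws ! snd (h e)}" "fst (h e) < snd (h e)" "snd (h e) < n"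
      if "e \<in> set es" for e
    proof -
      obtain a b where e: "e = (a, b)" by (cases e)
      have ab: "a < n" "b < n" "a \<noteq> b" using vs(4)[of a b] that e by auto
      have "\<rho> ! a \<noteq> \<rho> ! b" using inj[OF ab(1,2)] ab(3) by simp
      then show "{vs ! fst e, vs ! snd e} = {ws ! fst (h e), ws ! snd (h e)}" "fst (h e) < snd (h e)" "snd (h e) < n"
        using ws[OF ab(1)] ws[OF ab(2)] \<rho>[OF ab(1)] \<rho>[OF ab(2)] by (simp_all add: h_def e insert_commute)
    qed
    have "E = (\<lambda>(a, b). {ws ! a, ws ! b}) ` set (map_edges \<rho> es)"
      unfolding vs(5) h image_image case_prod_beta by (intro image_cong refl edge(1))
    moreover have "\<forall>(a, b)\<in>set (map_edges \<rho> es). a < b \<and> b < n"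
      unfolding h case_prod_beta using edge(2,3) by simp
    ultimately have "realises ws (n, map_edges \<rho> es) E"
      using \<open>distinct ws\<close> vs(3) by (simp add: ws_def length_map_edges)
    then show ?thesis using True by (auto simp: relabel_def G)
  qed
qed

lemma realises_relabel_all:
  assumes "G \<in> set Gs" "realises vs G E"
  shows "\<exists>G'\<in>set (relabel_all \<rho>s Gs). \<exists>vs'. realises vs' G' E"
  using assms(1)
proof (induction \<rho>s Gs rule: relabel_all.induct)
  case (1 \<rho> \<rho>s G' Gs)
  then show ?case using realises_relabel[OF assms(2)] by auto
qed (use assms(2) in auto)

definition graph_nbh :: "'v set set \<Rightarrow> 'v \<Rightarrow> 'v set" where
  "graph_nbh E x = {y. {x, y} \<in> E}"

text \<open>Twins may be adjacent or not. Pairs without further neighbours, such as the ends of an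
  isolated edge, do not count, because the argument against twins starts from a common
  neighbour.\<close>

definition twin_free :: "'v set set \<Rightarrow> bool" where
  "twin_free E \<longleftrightarrow> (\<forall>x y. x \<noteq> y \<longrightarrow> graph_nbh E x - {y} = graph_nbh E y - {x} \<longrightarrow> graph_nbh E x - {y} = {})"

lemma realises_twins:
  assumes r: "realises vs G E" and "has_twins G" shows "\<not> twin_free E"
proof -
  obtain n es where G: "G = (n, es)" by (cases G)
  obtain a b where ab: "a < b" "b < n" "neighbours es a b = neighbours es b a" "neighbours es a b \<noteq> []"
    using assms(2) by (auto simp: has_twins_def list_ex_iff G Suc_le_eq)
  have vs: "distinct vs" "length vs = n" using r by (auto simp: G)
  have edge_lt: "x < n" if "adjacent es c x" for c x using r that by (auto simp: adjacent_def G)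
  have sub: "E \<subseteq> Pow (set vs)"
  proof
    fix e assume "e \<in> E"
    then obtain c d where "(c, d) \<in> set es" "e = {vs ! c, vs ! d}" using r by (auto simp: G)
    moreover from this have "c < n" "d < n" using r by (auto simp: G)
    ultimately show "e \<in> Pow (set vs)" using vs by auto
  qed
  have nb: "graph_nbh E (vs ! c) - {vs ! d} = (\<lambda>x. vs ! x) ` set (neighbours es c d)" if "c < n" "d < n" for c d
  proof (intro equalityI subsetI)
    fix y assume y: "y \<in> graph_nbh E (vs ! c) - {vs ! d}"
    then have "y \<in> set vs" using sub by (auto simp: graph_nbh_def)
    then obtain x where "x < n" "y = vs ! x" using vs by (metis in_set_conv_nth)
    with y that show "y \<in> (\<lambda>x. vs ! x) ` set (neighbours es c d)"
      using realises_adjacent[OF r[unfolded G], of c x] by (auto simp: set_neighbours graph_nbh_def)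
  next
    fix y assume "y \<in> (\<lambda>x. vs ! x) ` set (neighbours es c d)"
    then obtain x where "x < n" "x \<noteq> d" "adjacent es c x" "y = vs ! x"
      using edge_lt by (auto simp: set_neighbours)
    then show "y \<in> graph_nbh E (vs ! c) - {vs ! d}"
      using realises_adjacent[OF r[unfolded G], of c x] that vs
      by (auto simp: graph_nbh_def nth_eq_iff_index_eq)
  qed
  have "vs ! a \<noteq> vs ! b" using ab vs by (simp add: nth_eq_iff_index_eq)
  moreover have "graph_nbh E (vs ! a) - {vs ! b} = graph_nbh E (vs ! b) - {vs ! a}"
    "graph_nbh E (vs ! a) - {vs ! b} \<noteq> {}"
    using nb[of a b] nb[of b a] ab by auto
  ultimately show ?thesis by (auto simp: twin_free_def)
qed

text \<open>The coefficient of \<open>t ^ j\<close> in the numerator of the Hilbert series of the Stanley-Reisner ring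
  whose minimal nonfaces are \<open>E\<close>, read off from the Taylor resolution.\<close>

definition kappa :: "nat \<Rightarrow> 'v set set \<Rightarrow> int" where
  "kappa j E = (\<Sum>S | S \<subseteq> E \<and> card (\<Union>S) = j. (-1) ^ card S)"

text \<open>Generalised over the covered vertices and the sign for the sake of the induction, which
  splits the sets of edges by whether they contain the first edge.\<close>

lemma kappa4_sum:
  assumes "distinct vs" "length vs = n" "distinct es" "\<And>a b. (a, b) \<in> set es \<Longrightarrow> a < b \<and> b < n"
    and "distinct ws" "\<And>w. w \<in> set ws \<Longrightarrow> w < n" "length ws \<le> 4"
  shows "kappa4 es ws s = s * (\<Sum>S\<in>Pow ((\<lambda>(a, b). {vs ! a, vs ! b}) ` set es).
    if card (((!) vs) ` set ws \<union> \<Union>S) = 4 then (-1) ^ card S else 0)"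
  using assms(3-)
proof (induction es arbitrary: ws s)
  case Nil
  have "card ((!) vs ` set ws) = length ws"
    using Nil assms(1,2) by (subst card_image) (auto simp: inj_on_def nth_eq_iff_index_eq distinct_card)
  then show ?case by simp
next
  case (Cons e es)
  obtain a b where e: "e = (a, b)" by (cases e)
  have ab: "a < b" "b < n" using Cons.prems(2)[of a b] e by auto
  define E' where "E' = (\<lambda>(a, b). {vs ! a, vs ! b}) ` set es"
  define W where "W = ((!) vs) ` set ws"
  define g where "g S = (if card (W \<union> \<Union>S) = 4 then (-1) ^ card S else 0 :: int)" for S
  have new: "{vs ! a, vs ! b} \<notin> E'"
  proof
    assume "{vs ! a, vs ! b} \<in> E'"
    then obtain c d where cd: "(c, d) \<in> set es" "{vs ! a, vs ! b} = {vs ! c, vs ! d}" by (auto simp: E'_def)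
    then have "c < d" "d < n" using Cons.prems(2)[of c d] by auto
    with cd(2) ab have "a = c \<and> b = d"
      using assms(1,2) by (auto simp: doubleton_eq_iff nth_eq_iff_index_eq)
    with cd(1) Cons.prems(1) e show False by simp
  qed
  define xs where "xs = List.insert a (List.insert b ws)"
  have xs: "(!) vs ` set xs = W \<union> {vs ! a, vs ! b}" by (auto simp: xs_def W_def)
  have dxs: "distinct xs" using Cons.prems(3) by (simp add: xs_def)
  have lxs: "\<And>w. w \<in> set xs \<Longrightarrow> w < n" using Cons.prems(4) ab by (auto simp: xs_def)
  have card_xs: "card (W \<union> {vs ! a, vs ! b}) = length xs"
    using dxs lxs assms(1,2) unfolding xs[symmetric]
    by (subst card_image) (auto simp: inj_on_def nth_eq_iff_index_eq distinct_card)
  have fin: "finite E'" "\<And>S. S \<subseteq> E' \<Longrightarrow> finite S" "\<And>S. S \<subseteq> E' \<Longrightarrow> finite (\<Union>S)"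
    by (auto simp: E'_def dest: finite_subset intro!: finite_Union)
  have ih1: "kappa4 es ws s = s * (\<Sum>S\<in>Pow E'. g S)"
    unfolding E'_def g_def W_def using Cons.prems by (intro Cons.IH) auto
  have ih2: "(if length xs \<le> 4 then kappa4 es xs (- s) else 0) = s * (\<Sum>S\<in>Pow E'. g (insert {vs ! a, vs ! b} S))"
  proof (cases "length xs \<le> 4")
    case True
    have "kappa4 es xs (- s) = - s * (\<Sum>S\<in>Pow E'.
        if card ((!) vs ` set xs \<union> \<Union>S) = 4 then (-1) ^ card S else 0)"
      unfolding E'_def using Cons.prems(1,2) dxs lxs True by (intro Cons.IH) auto
    also have "\<dots> = s * (\<Sum>S\<in>Pow E'. g (insert {vs ! a, vs ! b} S))"
    proof -
      have "g (insert {vs ! a, vs ! b} S) =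
          - (if card ((!) vs ` set xs \<union> \<Union>S) = 4 then (-1) ^ card S else 0)" if "S \<in> Pow E'" for S
      proof -
        have "{vs ! a, vs ! b} \<notin> S" "finite S" using that new fin by auto
        then show ?thesis by (simp add: g_def xs Un_assoc)
      qed
      then show ?thesis by (simp add: sum_negf)
    qed
    finally show ?thesis using True by simp
  next
    case False
    have "g (insert {vs ! a, vs ! b} S) = 0" if "S \<in> Pow E'" for S
    proof -
      have "card (W \<union> {vs ! a, vs ! b}) \<le> card (W \<union> \<Union>(insert {vs ! a, vs ! b} S))"
        using fin(3)[of S] that by (intro card_mono) (auto simp: W_def)
      then show ?thesis using False card_xs by (simp add: g_def)
    qed
    then show ?thesis using False by simp
  qed
  have "Pow (insert {vs ! a, vs ! b} E') = Pow E' \<union> insert {vs ! a, vs ! b} ` Pow E'" by (rule Pow_insert)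
  moreover have "Pow E' \<inter> insert {vs ! a, vs ! b} ` Pow E' = {}" using new by auto
  moreover have "inj_on (insert {vs ! a, vs ! b}) (Pow E')"
    using new by (intro inj_onI) (metis Pow_iff insert_ident subset_iff)
  ultimately have "(\<Sum>S\<in>Pow (insert {vs ! a, vs ! b} E'). g S) =
      (\<Sum>S\<in>Pow E'. g S) + (\<Sum>S\<in>Pow E'. g (insert {vs ! a, vs ! b} S))"
    using fin(1) by (simp add: sum.union_disjoint sum.reindex)
  then show ?case
    using ih1 ih2 by (simp add: e xs_def[symmetric] Let_def E'_def[symmetric] W_def[symmetric] g_def[symmetric] distrib_left)
qed

lemma kappa4_realises:
  assumes "realises vs (n, es) E" shows "kappa4 es [] 1 = kappa 4 E"
proof -
  have E: "E = (\<lambda>(a, b). {vs ! a, vs ! b}) ` set es" using assms by simp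
  have "kappa4 es [] 1 = 1 * (\<Sum>S\<in>Pow ((\<lambda>(a, b). {vs ! a, vs ! b}) ` set es).
      if card (((!) vs) ` set [] \<union> \<Union>S) = 4 then (-1) ^ card S else 0)"
  proof (intro kappa4_sum[of vs n])
    have "length es = card E" using assms by simp
    also have "\<dots> \<le> card (set es)" unfolding E by (intro card_image_le) simp
    finally show "distinct es" using card_length[of es] by (intro card_distinct) simp
  qed (use assms in auto)
  also have "\<dots> = (\<Sum>S\<in>Pow E. if card (\<Union>S) = 4 then (-1) ^ card S else 0)"
    using E by simp
  also have "\<dots> = kappa 4 E"
    unfolding kappa_def E by (intro sum.mono_neutral_cong_right) auto
  finally show ?thesis .
qed

section \<open>Enumeration of the graphs with up to six edges\<close>

definition next_graphs :: "nat list list \<Rightarrow> lgraph list \<Rightarrow> lgraph list" where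
  "next_graphs \<rho>s Gs = remdups (relabel_all \<rho>s (concat (map extensions Gs)))"

text \<open>The version without relabelling serves the last step, where graphs with twins are
  discarded first; \<open>relabellings6\<close> is aligned with the list that remains.\<close>

lemma next_graphs:
  assumes Gs: "\<And>E' :: 'v set set. card E' = k \<Longrightarrow> \<forall>e\<in>E'. card e = 2 \<Longrightarrow> \<exists>G\<in>set Gs. \<exists>vs. realises vs G E'"
    and E: "card E = Suc k" "\<forall>e\<in>E. card e = 2"
  shows "\<exists>G\<in>set (concat (map extensions Gs)). \<exists>vs. realises vs G (E :: 'v set set)"
    "\<exists>G\<in>set (next_graphs \<rho>s Gs). \<exists>vs. realises vs G E"
proof -
  obtain e E' where e: "E = insert e E'" "e \<notin> E'" "card E' = k" using E(1) by (auto simp: card_Suc_eq)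
  then obtain G vs where "G \<in> set Gs" "realises vs G E'" using Gs[of E'] E(2) by auto
  then show *: "\<exists>G\<in>set (concat (map extensions Gs)). \<exists>vs. realises vs G E"
    using realises_extension[of vs G E' e] E(2) e by auto
  then show "\<exists>G\<in>set (next_graphs \<rho>s Gs). \<exists>vs. realises vs G E"
    unfolding next_graphs_def set_remdups using realises_relabel_all by blast
qed

text \<open>The relabellings identify isomorphic graphs with \<open>2, \<dots>, 6\<close> edges. They only keep the lists
  short: no property of them is needed.\<close>

definition relabellings2 :: "nat list list" where
  "relabellings2 =
    [[0, 1, 2], [1, 0, 2], [0, 1, 2, 3]]"

definition relabellings3 :: "nat list list" where
  "relabellings3 =
    [[0, 1, 2], [0, 1, 2, 3], [0, 1, 2, 3], [0, 2, 1, 3], [0, 1, 2, 3, 4], [0, 2, 1, 3], [0, 2, 3, 1], [2, 0, 1,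
    3], [2, 0, 3, 1], [0, 1, 3, 4, 2], [1, 0, 3, 4, 2], [3, 4, 0, 1, 2], [3, 4, 1, 0, 2], [0, 1, 2, 3, 4, 5]]"

definition relabellings4 :: "nat list list" where
  "relabellings4 =
    [[0, 1, 2, 3], [1, 0, 2, 3], [1, 2, 0, 3], [0, 1, 2, 3, 4], [0, 1, 2, 3], [0, 1, 3, 2], [0, 3, 1, 2], [0, 1,
    2, 3, 4], [0, 1, 2, 3, 4], [0, 2, 1, 3, 4], [0, 2, 3, 1, 4], [0, 1, 2, 3, 4, 5], [0, 1, 3, 2], [1, 0, 2, 3],
    [0, 1, 2, 3], [0, 1, 2, 4, 3], [1, 0, 4, 2, 3], [0, 1, 2, 3, 4], [1, 0, 3, 2, 4], [0, 1, 2, 3, 4, 5], [0, 2,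
    3, 1, 4], [0, 2, 3, 4, 1], [0, 1, 2, 3, 4], [1, 0, 3, 2, 4], [1, 0, 3, 4, 2], [1, 3, 0, 2, 4], [1, 3, 0, 4,
    2], [0, 1, 2, 4, 5, 3], [0, 1, 2, 4, 5, 3], [0, 2, 1, 4, 5, 3], [0, 1, 2, 3, 4, 5], [0, 1, 2, 4, 3, 5], [0, 1,
    2, 3, 4, 5, 6], [0, 2, 1, 3, 4, 5], [0, 2, 3, 1, 4, 5], [0, 2, 4, 5, 1, 3], [0, 2, 4, 5, 3, 1], [2, 0, 1, 3,
    4, 5], [2, 0, 3, 1, 4, 5], [2, 0, 4, 5, 1, 3], [2, 0, 4, 5, 3, 1], [4, 5, 0, 2, 1, 3], [4, 5, 0, 2, 3, 1], [4,
    5, 2, 0, 1, 3], [4, 5, 2, 0, 3, 1], [0, 1, 3, 4, 5, 6, 2], [1, 0, 3, 4, 5, 6, 2], [3, 4, 0, 1, 5, 6, 2], [3,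
    4, 1, 0, 5, 6, 2], [3, 4, 5, 6, 0, 1, 2], [3, 4, 5, 6, 1, 0, 2], [0, 1, 2, 3, 4, 5, 6, 7]]"

definition relabellings5 :: "nat list list" where
  "relabellings5 =
    [[0, 1, 2, 3, 4], [0, 1, 3, 2, 4], [0, 1, 3, 4, 2], [0, 3, 1, 2, 4], [0, 3, 1, 4, 2], [0, 3, 4, 1, 2], [0, 1,
    2, 3, 4, 5], [0, 1, 2, 3, 4, 5], [0, 2, 1, 3, 4, 5], [0, 2, 3, 1, 4, 5], [0, 2, 3, 4, 1, 5], [0, 1, 2, 3, 4,
    5, 6], [0, 1, 2, 3], [0, 2, 1, 3], [0, 1, 2, 3, 4], [0, 1, 2, 3, 4], [0, 2, 1, 3, 4], [0, 1, 2, 3, 4], [0, 1,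
    2, 3, 4, 5], [0, 2, 3, 1], [2, 0, 1, 3], [0, 1, 2, 3, 4], [1, 0, 3, 2, 4], [1, 3, 0, 2, 4], [3, 1, 2, 0, 4],
    [0, 1, 2, 3, 4, 5], [0, 1, 3, 4, 2], [0, 1, 2, 3, 4], [0, 1, 3, 2, 4], [0, 3, 1, 2, 4], [0, 1, 2, 4, 3], [0,
    1, 4, 2, 3], [0, 1, 2, 3, 5, 4], [0, 1, 2, 3, 4, 5], [0, 1, 2, 3, 4, 5], [0, 1, 3, 2, 4, 5], [0, 1, 2, 3, 4,
    5], [0, 1, 2, 3, 4, 5, 6], [0, 1, 2, 3, 4], [0, 1, 2, 4, 3], [1, 0, 2, 3, 4], [1, 0, 2, 4, 3], [1, 2, 0, 3,
    4], [1, 2, 0, 4, 3], [0, 1, 2, 4, 5, 3], [1, 0, 2, 4, 5, 3], [1, 2, 0, 4, 5, 3], [0, 1, 2, 3, 4, 5], [0, 1, 2,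
    4, 3, 5], [0, 1, 2, 3, 4, 5, 6], [0, 1, 3, 2, 4], [0, 3, 1, 4, 2], [2, 0, 1, 3, 4], [1, 0, 3, 4, 2], [1, 3, 0,
    2, 4], [0, 1, 2, 3, 4], [0, 1, 2, 4, 5, 3], [1, 0, 4, 2, 5, 3], [1, 4, 0, 5, 2, 3], [0, 1, 2, 3, 4, 5], [0, 2,
    1, 4, 3, 5], [0, 1, 2, 3, 4, 5, 6], [0, 2, 3, 4, 1, 5], [0, 2, 3, 4, 5, 1], [0, 1, 2, 3, 4, 5], [0, 1, 3, 2,
    4, 5], [0, 1, 2, 3, 4, 5], [0, 1, 2, 3, 5, 4], [0, 3, 1, 2, 4, 5], [0, 2, 1, 3, 4, 5], [0, 2, 1, 3, 5, 4], [0,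
    2, 3, 1, 4, 5], [0, 2, 3, 1, 5, 4], [0, 1, 2, 3, 5, 6, 4], [0, 1, 2, 3, 5, 6, 4], [0, 2, 1, 3, 5, 6, 4], [0,
    2, 3, 1, 5, 6, 4], [0, 1, 2, 3, 4, 5, 6], [0, 1, 2, 3, 5, 4, 6], [0, 1, 2, 3, 4, 5, 6, 7], [0, 2, 3, 1, 4, 5],
    [0, 2, 3, 4, 1, 5], [0, 2, 3, 4, 5, 1], [0, 1, 2, 3, 4, 5], [4, 1, 5, 0, 2, 3], [2, 0, 4, 3, 1, 5], [2, 0, 4,
    3, 5, 1], [4, 5, 1, 0, 2, 3], [2, 4, 0, 3, 1, 5], [2, 4, 0, 3, 5, 1], [3, 4, 5, 0, 1, 2], [0, 1, 2, 4, 5, 6,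
    3], [0, 1, 2, 3, 4, 5, 6], [0, 2, 1, 3, 4, 5, 6], [4, 5, 6, 0, 1, 2, 3], [3, 4, 5, 0, 1, 2, 6], [3, 4, 5, 0,
    2, 1, 6], [0, 1, 2, 3, 4, 5, 6, 7], [0, 1, 3, 2, 4, 5], [0, 1, 3, 4, 2, 5], [0, 1, 3, 4, 5, 2], [1, 0, 2, 3,
    4, 5], [1, 0, 4, 3, 2, 5], [1, 0, 4, 3, 5, 2], [0, 1, 2, 3, 4, 5], [0, 2, 1, 4, 3, 5], [0, 2, 1, 4, 5, 3], [2,
    0, 4, 1, 3, 5], [2, 0, 4, 1, 5, 3], [0, 1, 2, 4, 5, 6, 3], [1, 0, 4, 2, 5, 6, 3], [0, 1, 2, 3, 5, 6, 4], [1,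
    0, 3, 2, 5, 6, 4], [0, 1, 2, 6, 3, 4, 5], [0, 1, 2, 6, 4, 3, 5], [0, 1, 2, 3, 4, 5, 6, 7], [0, 2, 3, 1, 4, 5,
    6], [0, 2, 3, 4, 1, 5, 6], [0, 2, 3, 5, 6, 1, 4], [0, 2, 3, 5, 6, 4, 1], [0, 1, 2, 3, 4, 5, 6], [1, 0, 3, 2,
    4, 5, 6], [1, 0, 3, 4, 2, 5, 6], [1, 0, 3, 5, 6, 2, 4], [1, 0, 3, 5, 6, 4, 2], [1, 3, 0, 2, 4, 5, 6], [1, 3,
    0, 4, 2, 5, 6], [1, 3, 0, 5, 6, 2, 4], [1, 3, 0, 5, 6, 4, 2], [3, 4, 5, 0, 2, 1, 6], [3, 4, 5, 0, 2, 6, 1],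
    [3, 4, 5, 2, 0, 1, 6], [3, 4, 5, 2, 0, 6, 1], [0, 1, 2, 4, 5, 6, 7, 3], [0, 1, 2, 4, 5, 6, 7, 3], [0, 2, 1, 4,
    5, 6, 7, 3], [0, 1, 2, 3, 4, 6, 7, 5], [0, 1, 2, 4, 3, 6, 7, 5], [0, 1, 2, 6, 7, 3, 4, 5], [0, 1, 2, 6, 7, 4,
    3, 5], [0, 1, 2, 3, 4, 5, 6, 7, 8], [0, 2, 1, 3, 4, 5, 6, 7], [0, 2, 3, 1, 4, 5, 6, 7], [0, 2, 4, 5, 1, 3, 6,
    7], [0, 2, 4, 5, 3, 1, 6, 7], [0, 2, 4, 5, 6, 7, 1, 3], [0, 2, 4, 5, 6, 7, 3, 1], [2, 0, 1, 3, 4, 5, 6, 7],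
    [2, 0, 3, 1, 4, 5, 6, 7], [2, 0, 4, 5, 1, 3, 6, 7], [2, 0, 4, 5, 3, 1, 6, 7], [2, 0, 4, 5, 6, 7, 1, 3], [2, 0,
    4, 5, 6, 7, 3, 1], [4, 5, 0, 2, 1, 3, 6, 7], [4, 5, 0, 2, 3, 1, 6, 7], [4, 5, 0, 2, 6, 7, 1, 3], [4, 5, 0, 2,
    6, 7, 3, 1], [4, 5, 2, 0, 1, 3, 6, 7], [4, 5, 2, 0, 3, 1, 6, 7], [4, 5, 2, 0, 6, 7, 1, 3], [4, 5, 2, 0, 6, 7,
    3, 1], [4, 5, 6, 7, 0, 2, 1, 3], [4, 5, 6, 7, 0, 2, 3, 1], [4, 5, 6, 7, 2, 0, 1, 3], [4, 5, 6, 7, 2, 0, 3, 1],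
    [0, 1, 3, 4, 5, 6, 7, 8, 2], [1, 0, 3, 4, 5, 6, 7, 8, 2], [3, 4, 0, 1, 5, 6, 7, 8, 2], [3, 4, 1, 0, 5, 6, 7,
    8, 2], [3, 4, 5, 6, 0, 1, 7, 8, 2], [3, 4, 5, 6, 1, 0, 7, 8, 2], [3, 4, 5, 6, 7, 8, 0, 1, 2], [3, 4, 5, 6, 7,
    8, 1, 0, 2], [0, 1, 2, 3, 4, 5, 6, 7, 8, 9]]"

definition relabellings6 :: "nat list list" where
  "relabellings6 =
    [[0, 1, 2, 3, 4], [0, 2, 1, 3, 4], [0, 1, 2, 3, 5, 4], [0, 2, 1, 3, 5, 4], [0, 1, 2, 3, 4], [0, 1, 2, 3, 4,
    5], [0, 1, 2, 3, 4, 5], [1, 0, 2, 4, 3, 5], [0, 1, 2, 3, 4, 5, 6], [0, 1, 3, 4, 2], [0, 3, 1, 4, 2], [0, 1, 2,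
    4, 3, 5], [0, 2, 1, 4, 3, 5], [0, 2, 3, 1, 4], [0, 3, 2, 4, 1], [2, 0, 1, 3, 4], [3, 0, 4, 2, 1], [3, 4, 0, 1,
    2], [0, 1, 2, 4, 5, 3], [1, 0, 4, 2, 5, 3], [1, 4, 0, 5, 2, 3], [4, 1, 5, 0, 2, 3], [4, 5, 1, 2, 0, 3], [0, 1,
    2, 3, 4, 5, 6], [0, 1, 2, 3, 4, 5], [0, 1, 2, 3, 5, 4], [0, 1, 3, 2, 4, 5], [0, 1, 3, 2, 5, 4], [1, 0, 2, 4,
    3, 5], [1, 0, 4, 2, 3, 5], [0, 1, 2, 3, 4, 5], [0, 1, 3, 2, 4, 5], [0, 1, 2, 3, 4, 5, 6], [0, 1, 3, 2, 4, 5,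
    6], [1, 0, 2, 4, 3, 5], [1, 0, 2, 4, 5, 3], [1, 2, 0, 4, 3, 5], [1, 2, 0, 4, 5, 3], [0, 1, 2, 3, 5, 6, 4], [0,
    2, 1, 3, 5, 6, 4], [0, 1, 2, 3, 4, 5], [0, 1, 3, 2, 4, 5], [0, 1, 2, 3, 5, 4], [0, 3, 1, 2, 5, 4], [0, 2, 1,
    3, 4, 5], [0, 1, 2, 3, 4, 5], [0, 1, 2, 3, 4, 5, 6], [0, 1, 2, 3, 4, 6, 5], [0, 2, 1, 3, 6, 4, 5], [0, 1, 2,
    3, 4, 5, 6, 7], [0, 2, 3, 1, 5, 4], [2, 0, 1, 3, 4, 5], [2, 4, 0, 1, 3, 5], [1, 4, 0, 5, 3, 2], [4, 1, 5, 0,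
    2, 3], [0, 1, 2, 3, 4, 5], [0, 1, 2, 4, 6, 5, 3], [1, 0, 4, 2, 5, 6, 3], [0, 1, 2, 3, 4, 5, 6], [1, 0, 3, 2,
    5, 4, 6], [0, 1, 2, 3, 4, 5, 6, 7], [0, 1, 2, 3, 4, 5, 6], [0, 1, 3, 2, 4, 5, 6], [0, 2, 1, 3, 6, 4, 5], [0,
    2, 1, 3, 6, 5, 4], [0, 2, 3, 1, 6, 4, 5], [0, 2, 3, 1, 6, 5, 4], [0, 1, 2, 3, 4, 6, 7, 5], [0, 1, 3, 2, 4, 6,
    7, 5], [0, 1, 2, 4, 5, 3, 6], [0, 1, 2, 4, 5, 6, 3], [2, 0, 1, 3, 4, 5, 6], [1, 0, 4, 3, 5, 2, 6], [1, 0, 4,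
    3, 5, 6, 2], [1, 4, 0, 5, 3, 2, 6], [1, 4, 0, 5, 3, 6, 2], [0, 1, 2, 3, 4, 5, 6], [1, 0, 3, 2, 5, 4, 6], [1,
    0, 3, 2, 5, 6, 4], [1, 3, 0, 5, 2, 4, 6], [1, 3, 0, 5, 2, 6, 4], [0, 1, 2, 4, 5, 6, 7, 3], [0, 1, 2, 3, 4, 6,
    7, 5], [0, 2, 1, 4, 3, 6, 7, 5], [0, 1, 2, 3, 4, 5, 6, 7, 8], [0, 2, 3, 4, 1, 5, 6], [0, 2, 3, 4, 5, 1, 6],
    [2, 0, 6, 4, 1, 5, 3], [2, 0, 6, 4, 5, 1, 3], [1, 3, 0, 4, 2, 6, 5], [1, 3, 0, 4, 6, 2, 5], [3, 1, 5, 4, 2, 6,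
    0], [3, 1, 5, 4, 6, 2, 0], [0, 1, 2, 3, 4, 5, 6, 7], [0, 1, 2, 3, 5, 4, 6, 7], [2, 0, 4, 3, 1, 5, 6, 7], [2,
    0, 4, 3, 5, 1, 6, 7], [2, 4, 0, 3, 1, 5, 6, 7], [2, 4, 0, 3, 5, 1, 6, 7], [0, 1, 3, 4, 2, 5, 6, 7], [0, 1, 3,
    4, 5, 2, 6, 7], [0, 1, 3, 4, 6, 7, 2, 5], [0, 1, 3, 4, 6, 7, 5, 2], [1, 0, 4, 3, 2, 5, 6, 7], [1, 0, 4, 3, 5,
    2, 6, 7], [1, 0, 4, 3, 6, 7, 2, 5], [1, 0, 4, 3, 6, 7, 5, 2], [0, 2, 1, 4, 3, 5, 6, 7], [0, 2, 1, 4, 5, 3, 6,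
    7], [0, 2, 1, 4, 6, 7, 3, 5], [0, 2, 1, 4, 6, 7, 5, 3], [2, 0, 4, 1, 3, 5, 6, 7], [2, 0, 4, 1, 5, 3, 6, 7],
    [2, 0, 4, 1, 6, 7, 3, 5], [2, 0, 4, 1, 6, 7, 5, 3], [0, 1, 2, 6, 3, 5, 4, 7], [0, 1, 2, 6, 3, 5, 7, 4], [0, 1,
    2, 6, 5, 3, 4, 7], [0, 1, 2, 6, 5, 3, 7, 4], [0, 1, 2, 3, 5, 6, 7, 8, 4], [1, 0, 3, 2, 5, 6, 7, 8, 4], [0, 1,
    2, 3, 4, 5, 6, 7, 8, 9], [1, 0, 3, 2, 4, 5, 6, 7, 8], [1, 0, 3, 4, 2, 5, 6, 7, 8], [1, 0, 3, 5, 6, 2, 4, 7,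
    8], [1, 0, 3, 5, 6, 4, 2, 7, 8], [1, 0, 3, 5, 6, 7, 8, 2, 4], [1, 0, 3, 5, 6, 7, 8, 4, 2], [1, 3, 0, 2, 4, 5,
    6, 7, 8], [1, 3, 0, 4, 2, 5, 6, 7, 8], [1, 3, 0, 5, 6, 2, 4, 7, 8], [1, 3, 0, 5, 6, 4, 2, 7, 8], [1, 3, 0, 5,
    6, 7, 8, 2, 4], [1, 3, 0, 5, 6, 7, 8, 4, 2], [0, 1, 2, 4, 5, 6, 7, 8, 9, 3], [0, 2, 1, 4, 5, 6, 7, 8, 9, 3],
    [0, 2, 1, 3, 4, 5, 6, 7, 8, 9], [0, 2, 3, 1, 4, 5, 6, 7, 8, 9], [0, 2, 4, 5, 1, 3, 6, 7, 8, 9], [0, 2, 4, 5,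
    3, 1, 6, 7, 8, 9], [0, 2, 4, 5, 6, 7, 1, 3, 8, 9], [0, 2, 4, 5, 6, 7, 3, 1, 8, 9], [0, 2, 4, 5, 6, 7, 8, 9, 1,
    3], [0, 2, 4, 5, 6, 7, 8, 9, 3, 1], [2, 0, 1, 3, 4, 5, 6, 7, 8, 9], [2, 0, 3, 1, 4, 5, 6, 7, 8, 9], [2, 0, 4,
    5, 1, 3, 6, 7, 8, 9], [2, 0, 4, 5, 3, 1, 6, 7, 8, 9], [2, 0, 4, 5, 6, 7, 1, 3, 8, 9], [2, 0, 4, 5, 6, 7, 3, 1,
    8, 9], [2, 0, 4, 5, 6, 7, 8, 9, 1, 3], [2, 0, 4, 5, 6, 7, 8, 9, 3, 1], [4, 5, 0, 2, 1, 3, 6, 7, 8, 9], [4, 5,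
    0, 2, 3, 1, 6, 7, 8, 9], [4, 5, 0, 2, 6, 7, 1, 3, 8, 9], [4, 5, 0, 2, 6, 7, 3, 1, 8, 9], [4, 5, 0, 2, 6, 7, 8,
    9, 1, 3], [4, 5, 0, 2, 6, 7, 8, 9, 3, 1], [4, 5, 2, 0, 1, 3, 6, 7, 8, 9], [4, 5, 2, 0, 3, 1, 6, 7, 8, 9], [4,
    5, 2, 0, 6, 7, 1, 3, 8, 9], [4, 5, 2, 0, 6, 7, 3, 1, 8, 9], [4, 5, 2, 0, 6, 7, 8, 9, 1, 3], [4, 5, 2, 0, 6, 7,
    8, 9, 3, 1], [4, 5, 6, 7, 0, 2, 1, 3, 8, 9], [4, 5, 6, 7, 0, 2, 3, 1, 8, 9], [4, 5, 6, 7, 0, 2, 8, 9, 1, 3],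
    [4, 5, 6, 7, 0, 2, 8, 9, 3, 1], [4, 5, 6, 7, 2, 0, 1, 3, 8, 9], [4, 5, 6, 7, 2, 0, 3, 1, 8, 9], [4, 5, 6, 7,
    2, 0, 8, 9, 1, 3], [4, 5, 6, 7, 2, 0, 8, 9, 3, 1], [4, 5, 6, 7, 8, 9, 0, 2, 1, 3], [4, 5, 6, 7, 8, 9, 0, 2, 3,
    1], [4, 5, 6, 7, 8, 9, 2, 0, 1, 3], [4, 5, 6, 7, 8, 9, 2, 0, 3, 1], [0, 1, 2, 3, 4, 5, 6, 7, 8, 9, 10, 11]]"

definition graphs5 :: "lgraph list" where
  "graphs5 = next_graphs relabellings5 (next_graphs relabellings4 (next_graphs relabellings3
     (next_graphs relabellings2 [(2, [(0, 1)])])))"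

text \<open>In this order: the house, the net, the triangle with tails of lengths one and two, the
  half graph, and the pentagon with a pendant edge.\<close>

lemma twin_free_graphs6:
  "filter (\<lambda>G. kappa4 (snd G) [] 1 \<le> 0)
     (remdups (relabel_all relabellings6 (filter (\<lambda>G. \<not> has_twins G) (concat (map extensions graphs5))))) =
   [(5, [(0, 1), (0, 2), (0, 3), (1, 2), (1, 4), (3, 4)]),
    (6, [(0, 1), (0, 2), (0, 3), (1, 2), (1, 4), (2, 5)]),
    (6, [(0, 1), (0, 2), (0, 3), (1, 2), (1, 4), (3, 5)]),
    (6, [(0, 1), (0, 2), (0, 3), (1, 4), (1, 5), (2, 4)]),
    (6, [(0, 1), (0, 2), (0, 3), (1, 4), (2, 5), (4, 5)])]"
  by code_simp

lemma graphs1: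
  assumes "card E = 1" "\<forall>e\<in>E. card e = 2"
  shows "\<exists>G\<in>set [(2, [(0, 1)])]. \<exists>vs. realises vs G E"
proof -
  obtain e where "E = {e}" using assms(1) by (auto simp: card_1_singleton_iff)
  moreover from this obtain x y where "e = {x, y}" "x \<noteq> y" using assms(2) by (auto simp: card_2_iff)
  ultimately have "realises [x, y] (2, [(0, 1)]) E" by simp
  then show ?thesis by (metis list.set_intros(1))
qed

lemma six_edge_graphs:
  fixes E :: "'v set set"
  assumes "card E = 6" "\<forall>e\<in>E. card e = 2" "twin_free E" "kappa 4 E \<le> 0"
  obtains (house) a b c d f where "distinct [a, b, c, d, f]" "E = {{a, b}, {a, c}, {a, d}, {b, c}, {b, f}, {d, f}}"
  | (other) a b c d f g where "distinct [a, b, c, d, f, g]"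
      "E \<in> {{{a, b}, {a, c}, {a, d}, {b, c}, {b, f}, {c, g}},
        {{a, b}, {a, c}, {a, d}, {b, c}, {b, f}, {d, g}},
        {{a, b}, {a, c}, {a, d}, {b, f}, {b, g}, {c, f}},
        {{a, b}, {a, c}, {a, d}, {b, f}, {c, g}, {f, g}}}"
proof -
  let ?g2 = "next_graphs relabellings2 [(2, [(0, 1)])]"
  let ?g3 = "next_graphs relabellings3 ?g2"
  let ?g4 = "next_graphs relabellings4 ?g3"
  have 2: "\<exists>G\<in>set ?g2. \<exists>vs. realises vs G E'" if "card E' = 2" "\<forall>e\<in>E'. card e = 2" for E' :: "'v set set"
    by (rule next_graphs(2)[OF graphs1]) (use that in simp_all)
  have 3: "\<exists>G\<in>set ?g3. \<exists>vs. realises vs G E'" if "card E' = 3" "\<forall>e\<in>E'. card e = 2" for E' :: "'v set set"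
    by (rule next_graphs(2)[OF 2]) (use that in simp_all)
  have 4: "\<exists>G\<in>set ?g4. \<exists>vs. realises vs G E'" if "card E' = 4" "\<forall>e\<in>E'. card e = 2" for E' :: "'v set set"
    by (rule next_graphs(2)[OF 3]) (use that in simp_all)
  have 5: "\<exists>G\<in>set graphs5. \<exists>vs. realises vs G E'" if "card E' = 5" "\<forall>e\<in>E'. card e = 2" for E' :: "'v set set"
    unfolding graphs5_def by (rule next_graphs(2)[OF 4]) (use that in simp_all)
  have "\<exists>G\<in>set (concat (map extensions graphs5)). \<exists>vs. realises vs G E"
    by (rule next_graphs(1)[OF 5]) (use assms in simp_all)
  then obtain G vs where G: "G \<in> set (concat (map extensions graphs5))" "realises vs G E" by blast
  have "\<not> has_twins G" using realises_twins[OF G(2)] assms(3) by blast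
  with G(1) have "G \<in> set (filter (\<lambda>G. \<not> has_twins G) (concat (map extensions graphs5)))" by simp
  from realises_relabel_all[OF this G(2), of relabellings6]
  obtain G' ws where G': "G' \<in> set (relabel_all relabellings6 (filter (\<lambda>G. \<not> has_twins G) (concat (map extensions graphs5))))"
    "realises ws G' E" by blast
  have "kappa4 (snd G') [] 1 = kappa 4 E"
    using kappa4_realises[of ws "fst G'" "snd G'"] G'(2) by simp
  then have "G' \<in> set (filter (\<lambda>G. kappa4 (snd G) [] 1 \<le> 0)
     (remdups (relabel_all relabellings6 (filter (\<lambda>G. \<not> has_twins G) (concat (map extensions graphs5))))))"
    using G'(1) assms(4) by simp
  then have G'_cases: "G' \<in> set [(5, [(0, 1), (0, 2), (0, 3), (1, 2), (1, 4), (3, 4)]),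
    (6, [(0, 1), (0, 2), (0, 3), (1, 2), (1, 4), (2, 5)]),
    (6, [(0, 1), (0, 2), (0, 3), (1, 2), (1, 4), (3, 5)]),
    (6, [(0, 1), (0, 2), (0, 3), (1, 4), (1, 5), (2, 4)]),
    (6, [(0, 1), (0, 2), (0, 3), (1, 4), (2, 5), (4, 5)])]"
    unfolding twin_free_graphs6 .
  have len5: "ws = [ws ! 0, ws ! 1, ws ! 2, ws ! 3, ws ! 4]" if "length ws = 5"
    using that by (intro nth_equalityI) (auto simp: less_Suc_eq numeral_eq_Suc)
  have len6: "ws = [ws ! 0, ws ! 1, ws ! 2, ws ! 3, ws ! 4, ws ! 5]" if "length ws = 6"
    using that by (intro nth_equalityI) (auto simp: less_Suc_eq numeral_eq_Suc)
  from G'_cases consider "fst G' = 5" "snd G' = [(0, 1), (0, 2), (0, 3), (1, 2), (1, 4), (3, 4)]"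
    | "fst G' = 6" "snd G' \<in> {[(0, 1), (0, 2), (0, 3), (1, 2), (1, 4), (2, 5)],
        [(0, 1), (0, 2), (0, 3), (1, 2), (1, 4), (3, 5)],
        [(0, 1), (0, 2), (0, 3), (1, 4), (1, 5), (2, 4)],
        [(0, 1), (0, 2), (0, 3), (1, 4), (2, 5), (4, 5)]}"
    by auto
  then show thesis
  proof cases
    case 1
    have r: "realises ws (fst G', snd G') E" using G'(2) by simp
    have "distinct ws" "length ws = 5" using r 1 by auto
    then have "distinct [ws ! 0, ws ! 1, ws ! 2, ws ! 3, ws ! 4]" using len5 by metis
    moreover have "E = {{ws ! 0, ws ! 1}, {ws ! 0, ws ! 2}, {ws ! 0, ws ! 3}, {ws ! 1, ws ! 2}, {ws ! 1, ws ! 4}, {ws ! 3, ws ! 4}}"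
      using r unfolding 1 by simp
    ultimately show thesis by (rule house)
  next
    case 2
    have r: "realises ws (fst G', snd G') E" using G'(2) by simp
    have "distinct ws" "length ws = 6" using r 2(1) by auto
    then have "distinct [ws ! 0, ws ! 1, ws ! 2, ws ! 3, ws ! 4, ws ! 5]" using len6 by metis
    moreover have E: "E = (\<lambda>(a, b). {ws ! a, ws ! b}) ` set (snd G')" using r unfolding realises.simps by blast
    have "E \<in> {{{ws ! 0, ws ! 1}, {ws ! 0, ws ! 2}, {ws ! 0, ws ! 3}, {ws ! 1, ws ! 2}, {ws ! 1, ws ! 4}, {ws ! 2, ws ! 5}},
        {{ws ! 0, ws ! 1}, {ws ! 0, ws ! 2}, {ws ! 0, ws ! 3}, {ws ! 1, ws ! 2}, {ws ! 1, ws ! 4}, {ws ! 3, ws ! 5}},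
        {{ws ! 0, ws ! 1}, {ws ! 0, ws ! 2}, {ws ! 0, ws ! 3}, {ws ! 1, ws ! 4}, {ws ! 1, ws ! 5}, {ws ! 2, ws ! 4}},
        {{ws ! 0, ws ! 1}, {ws ! 0, ws ! 2}, {ws ! 0, ws ! 3}, {ws ! 1, ws ! 4}, {ws ! 2, ws ! 5}, {ws ! 4, ws ! 5}}}"
      using 2(2) by (elim insertE emptyE) (simp_all only: E list.set image_insert image_empty case_prod_conv insert_iff simp_thms)
    ultimately show thesis by (rule other)
  qed
qed

section \<open>The congruence of a binomial ideal\<close>

text \<open>A linear functional that vanishes on I as soon as P is a union of classes of the
  congruence; it is the test by which membership in I is refuted.\<close>

definition class_sum :: "('v monomial \<Rightarrow> bool) \<Rightarrow> ('v, 'k::comm_ring_1) mpoly \<Rightarrow> 'k" where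
  "class_sum P f = (\<Sum>m\<in>Poly_Mapping.keys f. if P m then Poly_Mapping.lookup f m else 0)"

lemma class_sum_plus: "class_sum P (f + g) = class_sum P f + class_sum P g"
  unfolding class_sum_def by (rule setsum_keys_plus_distrib) auto

lemma class_sum_0 [simp]: "class_sum P 0 = 0"
  by (simp add: class_sum_def)

lemma class_sum_sum: "class_sum P (\<Sum>i\<in>A. f i) = (\<Sum>i\<in>A. class_sum P (f i))"
  by (induction A rule: infinite_finite_induct) (auto simp: class_sum_plus)

lemma class_sum_single: "class_sum P (Poly_Mapping.single m a) = (if P m then a else 0)"
  by (simp add: class_sum_def)

lemma class_sum_mono_poly: "class_sum P (mono_poly m) = (if P m then 1 else 0)"
  by (simp add: mono_poly_def class_sum_single)

lemma class_sum_binomial: "class_sum P (mono_poly u - mono_poly v) = (if P u then 1 else 0) - (if P v then 1 else 0)"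
proof -
  have "class_sum P (mono_poly u - mono_poly v) + class_sum P (mono_poly v) = class_sum P (mono_poly u)"
    by (simp flip: class_sum_plus)
  then show ?thesis by (simp add: class_sum_mono_poly algebra_simps)
qed

text \<open>The set \<open>P\<close> is a union of classes of the congruence generated by the binomials of \<open>B\<close>.\<close>

lemma class_sum_ideal:
  assumes "f \<in> ideal_gen B"
    and B: "\<And>b. b \<in> B \<Longrightarrow> \<exists>u v. b = mono_poly u - mono_poly v \<and> (\<forall>t. P (t + u) \<longleftrightarrow> P (t + v))"
  shows "class_sum P f = 0"
  using assms(1)
proof (induction rule: ideal.span_induct_alt)
  case (step c b f)
  obtain u v where b: "b = mono_poly u - mono_poly v" and P: "\<And>t. P (t + u) \<longleftrightarrow> P (t + v)"
    using B[OF step(1)] by blast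
  have "c * mono_poly w = (\<Sum>m\<in>Poly_Mapping.keys c. Poly_Mapping.single (m + w) (Poly_Mapping.lookup c m))" for w
    using single_times_sum[of w 1 c] by (simp add: mono_poly_def mult.commute add.commute)
  then have "class_sum P (c * mono_poly w) = (\<Sum>m\<in>Poly_Mapping.keys c. if P (m + w) then Poly_Mapping.lookup c m else 0)" for w
    by (simp add: class_sum_sum class_sum_single)
  then have "class_sum P (c * mono_poly u) = class_sum P (c * mono_poly v)"
    by (simp add: P)
  moreover have "class_sum P (c * b) + class_sum P (c * mono_poly v) = class_sum P (c * mono_poly u)"
    by (simp add: b algebra_simps flip: class_sum_plus)
  ultimately show ?case using step(2) by (simp add: class_sum_plus)
qed simp

section \<open>Leading monomials\<close>

lemma finite_linear_order_greatest:
  assumes "linear_order r" "finite A" "A \<noteq> {}"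
  shows "\<exists>m\<in>A. \<forall>a\<in>A. (a, m) \<in> r"
  using assms(2,3)
proof (induction rule: finite_ne_induct)
  case (singleton x)
  then show ?case using assms(1) by (auto simp: order_on_defs refl_on_def)
next
  case (insert x A)
  then obtain m where m: "m \<in> A" "\<forall>a\<in>A. (a, m) \<in> r" by blast
  have *: "trans r" "total r" "refl r" using assms(1) by (auto simp: order_on_defs)
  show ?case
  proof (cases "(x, m) \<in> r")
    case False
    then have "(m, x) \<in> r" using *(2,3) by (cases "x = m") (auto simp: total_on_def refl_on_def)
    then have "\<forall>a\<in>A. (a, x) \<in> r" using m(2) *(1) by (meson transD)
    then show ?thesis using *(3) by (auto simp: refl_on_def)
  qed (use m in auto)
qed

lemma leading_monomial:
  assumes "linear_order r" "f \<noteq> 0"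
  shows "leading_monomial r f \<in> Poly_Mapping.keys f"
    "m \<in> Poly_Mapping.keys f \<Longrightarrow> (m, leading_monomial r f) \<in> r"
proof -
  obtain m where m: "m \<in> Poly_Mapping.keys f" "\<forall>a\<in>Poly_Mapping.keys f. (a, m) \<in> r"
    using finite_linear_order_greatest[OF assms(1), of "Poly_Mapping.keys f"] assms(2) by auto
  have anti: "antisym r" using assms(1) by (auto simp: order_on_defs)
  have "leading_monomial r f \<in> Poly_Mapping.keys f \<and> (\<forall>m'\<in>Poly_Mapping.keys f. (m', leading_monomial r f) \<in> r)"
    unfolding leading_monomial_def by (rule theI[of _ m]) (use m anti in \<open>auto dest: antisymD\<close>)
  then show "leading_monomial r f \<in> Poly_Mapping.keys f"
    "m \<in> Poly_Mapping.keys f \<Longrightarrow> (m, leading_monomial r f) \<in> r" for m by auto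
qed

lemma initial_ideal_alt: "initial_ideal r I = ideal_gen (mono_poly ` {leading_monomial r f | f. f \<in> I \<and> f \<noteq> 0})"
  unfolding initial_ideal_def by (rule arg_cong[of _ _ ideal_gen]) auto

lemma edge_ideal_alt: "edge_ideal E = ideal_gen (mono_poly ` {X u + X v | u v. {u, v} \<in> E})"
  unfolding edge_ideal_def
  by (rule arg_cong[of _ _ ideal_gen]) (auto simp: var_def mono_poly_times X_def)

lemma mono_in_edge_ideal_iff:
  assumes "\<And>e. e \<in> E \<Longrightarrow> card e = 2"
  shows "mono_poly m \<in> (edge_ideal E :: ('v::finite, 'k::comm_ring_1) mpoly set) \<longleftrightarrow> (\<exists>e\<in>E. e \<subseteq> msupp m)"
proof
  assume "mono_poly m \<in> (edge_ideal E :: ('v, 'k) mpoly set)"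
  then obtain u v t where "{u, v} \<in> E" "m = X u + X v + t"
    unfolding edge_ideal_alt mono_in_monomial_ideal_iff by auto
  then show "\<exists>e\<in>E. e \<subseteq> msupp m" by (intro bexI[of _ "{u, v}"]) auto
next
  assume "\<exists>e\<in>E. e \<subseteq> msupp m"
  then obtain e where e: "e \<in> E" "e \<subseteq> msupp m" by blast
  obtain u v where uv: "e = {u, v}" "u \<noteq> v" using assms[OF e(1)] by (auto simp: card_2_iff)
  have "u \<in> msupp m" using e uv by auto
  then obtain m1 where m1: "m = X u + m1" by (rule monom_split)
  have "v \<in> msupp m1" using e uv m1 by auto
  then obtain m2 where "m1 = X v + m2" by (rule monom_split)
  then have "m = X u + X v + m2" using m1 by (simp add: ac_simps)
  then show "mono_poly m \<in> (edge_ideal E :: ('v, 'k) mpoly set)"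
    unfolding edge_ideal_alt mono_in_monomial_ideal_iff using e uv by blast
qed

definition ideal_eqv :: "('v, 'k::comm_ring_1) mpoly set \<Rightarrow> 'v monomial \<Rightarrow> 'v monomial \<Rightarrow> bool" where
  "ideal_eqv I u v \<longleftrightarrow> mono_poly u - mono_poly v \<in> I"

locale binomial_initial_ideal =
  fixes I :: "('v::finite, 'k::field) mpoly set" and B r E
  assumes gen: "I = ideal_gen B"
    and binom: "\<And>f. f \<in> B \<Longrightarrow> squarefree_quadratic_binomial f"
    and prime: "is_prime_ideal I"
    and order: "monomial_order r"
    and edges: "\<And>e. e \<in> E \<Longrightarrow> card e = 2"
    and init: "initial_ideal r I = edge_ideal E"
begin

lemma eqv_refl: "ideal_eqv I u u"
  by (simp add: ideal_eqv_def gen ideal.span_zero)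

lemma eqv_sym: "ideal_eqv I u v \<Longrightarrow> ideal_eqv I v u"
  using ideal.span_neg[of "mono_poly u - mono_poly v" B] by (simp add: ideal_eqv_def gen)

lemma eqv_trans: "ideal_eqv I u v \<Longrightarrow> ideal_eqv I v w \<Longrightarrow> ideal_eqv I u w"
  using ideal.span_add[of "mono_poly u - mono_poly v" B "mono_poly v - mono_poly w"]
  by (simp add: ideal_eqv_def gen)

lemma mono_times_binomial:
  "mono_poly t * (mono_poly u - mono_poly v) = mono_poly (t + u) - mono_poly (t + v)"
  by (simp add: right_diff_distrib mono_poly_times)

lemma eqv_add: "ideal_eqv I u v \<Longrightarrow> ideal_eqv I (t + u) (t + v)"
  using ideal.span_scale[of "mono_poly u - mono_poly v" B "mono_poly t"]
  by (simp add: ideal_eqv_def gen mono_times_binomial)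

lemma class_sum_binom:
  assumes "f \<in> I"
    and "\<And>u v t. mdeg u = 2 \<Longrightarrow> mdeg v = 2 \<Longrightarrow> squarefree_monomial u \<Longrightarrow> squarefree_monomial v \<Longrightarrow> P (t + u) = P (t + v)"
  shows "class_sum P f = 0"
  using assms(1) unfolding gen
proof (rule class_sum_ideal)
  fix b assume "b \<in> B"
  then show "\<exists>u v. b = mono_poly u - mono_poly v \<and> (\<forall>t. P (t + u) \<longleftrightarrow> P (t + v))"
    using binom assms(2) unfolding squarefree_quadratic_binomial_def by metis
qed

text \<open>With P always true, \<open>class_sum\<close> is evaluation at the point with all
  coordinates 1, where the binomials vanish and the monomials do not.\<close>

lemma mono_notin: "mono_poly m \<notin> I"
proof
  assume "mono_poly m \<in> I"
  then have "class_sum (\<lambda>_. True) (mono_poly m :: ('v, 'k) mpoly) = 0"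
    by (rule class_sum_binom) simp
  then show False by (simp add: class_sum_mono_poly)
qed

text \<open>This is where primality enters: the monomial factor is not in I, so the binomial factor
  is.\<close>

lemma eqv_cancel:
  assumes "ideal_eqv I (t + u) (t + v)" shows "ideal_eqv I u v"
proof -
  have "mono_poly t * (mono_poly u - mono_poly v) \<in> I"
    using assms by (simp add: ideal_eqv_def mono_times_binomial)
  then show ?thesis
    using prime mono_notin[of t] unfolding ideal_eqv_def is_prime_ideal_def by blast
qed

text \<open>On a binomial, \<open>class_sum P\<close> is the difference of the two truth values of
  P. It is applied to having a given degree, to being a given variable, and to squarefreeness in
  degree two.\<close>

lemma eqv_iff:
  assumes "ideal_eqv I u v"
    and "\<And>u v t. mdeg u = 2 \<Longrightarrow> mdeg v = 2 \<Longrightarrow> squarefree_monomial u \<Longrightarrow> squarefree_monomial v \<Longrightarrow> P (t + u) = P (t + v)"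
  shows "P u \<longleftrightarrow> P v"
proof -
  have "class_sum P (mono_poly u - mono_poly v :: ('v, 'k) mpoly) = 0"
    using assms(1) unfolding ideal_eqv_def by (rule class_sum_binom) (rule assms(2))
  then show ?thesis by (simp add: class_sum_binomial split: if_splits)
qed

lemma eqv_mdeg: "ideal_eqv I u v \<Longrightarrow> mdeg u = mdeg v"
  using eqv_iff[of u v "\<lambda>w. mdeg w = mdeg u"] by simp

lemma eqv_deg1: assumes "ideal_eqv I (X x) (X y)" shows "x = y"
proof -
  have no: "t + w \<noteq> X x" if "mdeg w = 2" for t w using that mdeg_X[of x] mdeg_plus[of t w] by force
  have "X x = X x \<longleftrightarrow> X y = X x"
    by (rule eqv_iff[OF assms, of "\<lambda>w. w = X x"]) (use no in blast)
  then have "Poly_Mapping.lookup (X y) x = Poly_Mapping.lookup (X x) x" by simp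
  then show ?thesis by (simp add: lookup_X split: if_splits)
qed

lemma eqv_squarefree:
  assumes "ideal_eqv I u v" "mdeg u = 2" "squarefree_monomial u" shows "squarefree_monomial v"
proof -
  \<comment> \<open>The guard on the degree makes the property stable: in degree two the cofactor is
    trivial and both monomials are squarefree, and in other degrees the property holds
    vacuously.\<close>
  have "(mdeg u = 2 \<longrightarrow> squarefree_monomial u) \<longleftrightarrow> (mdeg v = 2 \<longrightarrow> squarefree_monomial v)"
    by (rule eqv_iff[OF assms(1)]) auto
  then show ?thesis using assms eqv_mdeg by metis
qed

text \<open>The coefficients of t f within one class add up to zero. The factor t is there for
  monomials that a leading monomial divides properly.\<close>

lemma eqv_class_sum:
  assumes "f \<in> I" shows "class_sum (\<lambda>m. ideal_eqv I (t + m) u) f = 0"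
  using assms unfolding gen
proof (rule class_sum_ideal)
  fix b assume b: "b \<in> B"
  then obtain w v where wv: "b = mono_poly w - mono_poly v"
    using binom unfolding squarefree_quadratic_binomial_def by metis
  have e: "ideal_eqv I w v" using b by (simp add: ideal_eqv_def gen ideal.span_base flip: wv)
  have "ideal_eqv I (t + (s + w)) (t + (s + v))" for s using eqv_add[OF eqv_add[OF e]] .
  then have "ideal_eqv I (t + (s + w)) u \<longleftrightarrow> ideal_eqv I (t + (s + v)) u" for s
    using eqv_sym eqv_trans by metis
  then show "\<exists>w v. b = mono_poly w - mono_poly v \<and> (\<forall>s. ideal_eqv (ideal_gen B) (t + (s + w)) u = ideal_eqv (ideal_gen B) (t + (s + v)) u)"
    using wv unfolding gen by blast
qed

lemma linear_order_r: "linear_order r"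
  using order by (simp add: monomial_order_def)

lemma order_add: "(s, t) \<in> r \<Longrightarrow> (u + s, u + t) \<in> r"
  using order by (simp add: monomial_order_def add.commute)

lemma mono_in_edge_ideal:
  "mono_poly m \<in> (edge_ideal E :: ('v, 'k) mpoly set) \<longleftrightarrow> (\<exists>e\<in>E. e \<subseteq> msupp m)"
  by (rule mono_in_edge_ideal_iff) (rule edges)

text \<open>The normal form is the least monomial v of the class, which is finite because the degree
  is fixed on it. If v were t times the leading monomial of some f in I, the coefficients of t f in
  the class of v could only cancel if another, smaller monomial of the class occurred.\<close>

lemma normal_form_ex: "\<exists>v. ideal_eqv I u v \<and> (\<forall>e\<in>E. \<not> e \<subseteq> msupp v)"
proof -
  have "finite {v. ideal_eqv I u v}"
    by (rule finite_subset[OF _ finite_mdeg[of "mdeg u"]]) (auto dest: eqv_mdeg)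
  moreover have "linear_order (r\<inverse>)" using linear_order_r by simp
  ultimately have "\<exists>v\<in>{v. ideal_eqv I u v}. \<forall>w\<in>{v. ideal_eqv I u v}. (w, v) \<in> r\<inverse>"
    using eqv_refl by (intro finite_linear_order_greatest) auto
  then obtain v where v: "ideal_eqv I u v" "\<And>w. ideal_eqv I u w \<Longrightarrow> (v, w) \<in> r"
    by auto
  have "mono_poly v \<notin> initial_ideal r I"
  proof
    assume "mono_poly v \<in> initial_ideal r I"
    then obtain f t where f: "f \<in> I" "f \<noteq> 0" "v = leading_monomial r f + t"
      unfolding initial_ideal_alt mono_in_monomial_ideal_iff by auto
    define l where "l = leading_monomial r f"
    note l = leading_monomial[OF linear_order_r f(2), folded l_def]
    have tl: "t + l = v" using f(3) by (simp add: l_def add.commute)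
    have "\<exists>k\<in>Poly_Mapping.keys f. k \<noteq> l \<and> ideal_eqv I (t + k) v"
    proof (rule ccontr)
      assume no: "\<not> ?thesis"
      have "class_sum (\<lambda>m. ideal_eqv I (t + m) v) f =
          (\<Sum>m\<in>Poly_Mapping.keys f. if m = l then Poly_Mapping.lookup f m else 0)"
        unfolding class_sum_def using no tl eqv_refl by (intro sum.cong) auto
      also have "\<dots> = Poly_Mapping.lookup f l" using l(1) by simp
      finally show False using eqv_class_sum[OF f(1)] l(1) by (simp add: in_keys_iff)
    qed
    then obtain k where k: "k \<in> Poly_Mapping.keys f" "k \<noteq> l" "ideal_eqv I (t + k) v" by blast
    have "(t + k, v) \<in> r" using order_add[OF l(2)[OF k(1)], of t] by (simp add: tl)
    moreover have "(v, t + k) \<in> r" using v k(3) eqv_sym eqv_trans by metis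
    ultimately have "t + k = v" using linear_order_r by (auto simp: order_on_defs dest: antisymD)
    then show False using k(2) by (simp flip: tl)
  qed
  then show ?thesis using v(1) unfolding init mono_in_edge_ideal by blast
qed

text \<open>Otherwise u - v would be a nonzero element of I whose leading monomial, u or v, contains
  no edge.\<close>

lemma normal_form_unique:
  assumes uv: "ideal_eqv I u v" "\<forall>e\<in>E. \<not> e \<subseteq> msupp u" "\<forall>e\<in>E. \<not> e \<subseteq> msupp v"
  shows "u = v"
proof (rule ccontr)
  assume ne: "u \<noteq> v"
  define f :: "('v, 'k) mpoly" where "f = mono_poly u - mono_poly v"
  have keys: "Poly_Mapping.keys f = {u, v}"
    using ne by (auto simp: f_def in_keys_iff lookup_minus lookup_mono_poly split: if_splits)
  then have "f \<noteq> 0" by auto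
  then have l: "leading_monomial r f \<in> {u, v}" using leading_monomial(1)[OF linear_order_r] keys by metis
  have "f \<in> I" using uv(1) by (simp add: f_def ideal_eqv_def)
  then have "mono_poly (leading_monomial r f) \<in> initial_ideal r I"
    unfolding initial_ideal_def using \<open>f \<noteq> 0\<close> by (intro ideal.span_base) auto
  then have "\<exists>e\<in>E. e \<subseteq> msupp (leading_monomial r f)"
    unfolding init mono_in_edge_ideal .
  then show False using l uv by auto
qed

sublocale toric_congruence "ideal_eqv I" E
proof
  show "ideal_eqv I u v \<Longrightarrow> ideal_eqv I (u + w) (v + w)" for u v w
    using eqv_add[of u v w] by (simp add: add.commute)
  show "ideal_eqv I (u + w) (v + w) \<Longrightarrow> ideal_eqv I u v" for u v w
    using eqv_cancel[of w u v] by (simp add: add.commute)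
qed (fact eqv_refl eqv_sym eqv_trans eqv_mdeg eqv_deg1 eqv_squarefree edges normal_form_ex normal_form_unique)+

end


section \<open>Counting monomials\<close>

lemma sum_Pow_alternating: "finite A \<Longrightarrow> (\<Sum>S\<in>Pow A. (-1) ^ card S) = (if A = {} then 1 else 0 :: int)"
proof (induction rule: finite_induct)
  case (insert x A)
  have "(\<Sum>S\<in>Pow (insert x A). (-1) ^ card S) =
      (\<Sum>S\<in>Pow A. (-1) ^ card S) + (\<Sum>S\<in>insert x ` Pow A. (-1) ^ card S :: int)"
    unfolding Pow_insert using insert by (intro sum.union_disjoint) auto
  also have "(\<Sum>S\<in>insert x ` Pow A. (-1) ^ card S :: int) = (\<Sum>S\<in>Pow A. - ((-1) ^ card S))"
  proof (subst sum.reindex)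
    show "inj_on (insert x) (Pow A)" using insert by (intro inj_onI) (metis Pow_iff insert_ident subset_iff)
    show "(\<Sum>S\<in>Pow A. ((\<lambda>S. (-1) ^ card S) \<circ> insert x) S) = (\<Sum>S\<in>Pow A. - ((-1) ^ card S) :: int)"
    proof (intro sum.cong refl)
      fix S assume "S \<in> Pow A"
      then have "x \<notin> S" "finite S" using insert by (auto dest: finite_subset)
      then show "((\<lambda>S. (-1) ^ card S) \<circ> insert x) S = - ((-1) ^ card S :: int)" by simp
    qed
  qed
  finally show ?case by (simp add: sum_negf)
qed simp

definition monomials :: "nat \<Rightarrow> 'v::finite monomial set" where
  "monomials d = {m. mdeg m = d}"

lemma finite_monomials [simp]: "finite (monomials d)"
  unfolding monomials_def by (rule finite_mdeg)

lemma card_divisible: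
  "card {m :: 'v::finite monomial. mdeg m = d \<and> U \<subseteq> msupp m} =
    (if card U \<le> d then card (monomials (d - card U) :: 'v monomial set) else 0)"
proof -
  define x where "x = monom_of (\<lambda>v. if v \<in> U then 1 else 0)"
  have dx: "mdeg x = card U" by (simp add: mdeg_def x_def sum.If_cases)
  have eq: "{m. mdeg m = d \<and> U \<subseteq> msupp m} = (+) x ` {m. card U + mdeg m = d}"
  proof (intro equalityI subsetI)
    fix m assume m: "m \<in> {m. mdeg m = d \<and> U \<subseteq> msupp m}"
    then have "m = x + (m - x)"
      by (auto simp: monomial_eq_iff lookup_minus x_def msupp_def)
    moreover from this have "card U + mdeg (m - x) = d" using m dx mdeg_plus[of x "m - x"] by simp
    ultimately show "m \<in> (+) x ` {m. card U + mdeg m = d}" by blast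
  next
    fix m assume "m \<in> (+) x ` {m. card U + mdeg m = d}"
    then show "m \<in> {m. mdeg m = d \<and> U \<subseteq> msupp m}"
      using dx by (auto simp: msupp_def x_def)
  qed
  have "card {m. mdeg m = d \<and> U \<subseteq> msupp m} = card {m :: 'v monomial. card U + mdeg m = d}"
    unfolding eq by (intro card_image) (auto intro: inj_onI)
  also have "{m :: 'v monomial. card U + mdeg m = d} = (if card U \<le> d then monomials (d - card U) else {})"
    by (auto simp: monomials_def)
  finally show ?thesis by simp
qed

text \<open>Inclusion-exclusion over the sets of edges contained in the support of a monomial.\<close>

lemma card_edge_free:
  fixes E :: "'v::finite set set"
  shows "int (card {m. mdeg m = d \<and> (\<forall>e\<in>E. \<not> e \<subseteq> msupp m)}) =
    (\<Sum>j\<le>d. kappa j E * int (card (monomials (d - j) :: 'v monomial set)))"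
proof -
  define M :: "'v monomial set" where "M = monomials d"
  have fin: "finite E" "finite M" by (auto simp: M_def)
  have "int (card {m. mdeg m = d \<and> (\<forall>e\<in>E. \<not> e \<subseteq> msupp m)}) =
      int (card {m \<in> M. \<forall>e\<in>E. \<not> e \<subseteq> msupp m})"
    by (simp add: M_def monomials_def)
  also have "\<dots> = (\<Sum>m\<in>M. if \<forall>e\<in>E. \<not> e \<subseteq> msupp m then 1 else 0)"
    using fin by (simp add: sum.If_cases Int_def)
  also have "\<dots> = (\<Sum>m\<in>M. \<Sum>S\<in>Pow E. if \<Union>S \<subseteq> msupp m then (-1) ^ card S else 0)"
  proof (intro sum.cong refl)
    fix m
    have "(\<Sum>S\<in>Pow E. if \<Union>S \<subseteq> msupp m then (-1) ^ card S else 0) =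
        (\<Sum>S\<in>Pow {e \<in> E. e \<subseteq> msupp m}. (-1) ^ card S :: int)"
      using fin by (intro sum.mono_neutral_cong_right) auto
    also have "\<dots> = (if {e \<in> E. e \<subseteq> msupp m} = {} then 1 else 0)"
      using fin by (intro sum_Pow_alternating) auto
    finally show "(if \<forall>e\<in>E. \<not> e \<subseteq> msupp m then 1 else 0) =
        (\<Sum>S\<in>Pow E. if \<Union>S \<subseteq> msupp m then (-1) ^ card S else 0 :: int)" by auto
  qed
  also have "\<dots> = (\<Sum>S\<in>Pow E. \<Sum>m\<in>M. if \<Union>S \<subseteq> msupp m then (-1) ^ card S else 0)"
    by (rule sum.swap)
  also have "\<dots> = (\<Sum>S\<in>Pow E. \<Sum>j\<le>d. if card (\<Union>S) = j then (-1) ^ card S * int (card (monomials (d - j) :: 'v monomial set)) else 0)"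
  proof (intro sum.cong refl)
    fix S :: "'v set set"
    have "{m \<in> M. \<Union>S \<subseteq> msupp m} = {m. mdeg m = d \<and> \<Union>S \<subseteq> msupp m}"
      by (auto simp: M_def monomials_def)
    then have "(\<Sum>m\<in>M. if \<Union>S \<subseteq> msupp m then (-1) ^ card S else 0 :: int) =
        (-1) ^ card S * int (card {m. mdeg m = d \<and> \<Union>S \<subseteq> msupp m})"
      using fin by (simp add: sum.If_cases Int_def)
    then show "(\<Sum>m\<in>M. if \<Union>S \<subseteq> msupp m then (-1) ^ card S else 0) =
       (\<Sum>j\<le>d. if card (\<Union>S) = j then (-1) ^ card S * int (card (monomials (d - j) :: 'v monomial set)) else 0)"
      by (simp add: card_divisible)
  qed
  also have "\<dots> = (\<Sum>j\<le>d. \<Sum>S\<in>Pow E. if card (\<Union>S) = j then (-1) ^ card S * int (card (monomials (d - j) :: 'v monomial set)) else 0)"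
    by (rule sum.swap)
  also have "\<dots> = (\<Sum>j\<le>d. kappa j E * int (card (monomials (d - j) :: 'v monomial set)))"
  proof (intro sum.cong refl)
    fix j
    have "(\<Sum>S\<in>Pow E. if card (\<Union>S) = j then (-1) ^ card S * int (card (monomials (d - j) :: 'v monomial set)) else 0) =
        (\<Sum>S | S \<subseteq> E \<and> card (\<Union>S) = j. (-1) ^ card S * int (card (monomials (d - j) :: 'v monomial set)))"
      using fin by (intro sum.mono_neutral_cong_right) auto
    then show "(\<Sum>S\<in>Pow E. if card (\<Union>S) = j then (-1) ^ card S * int (card (monomials (d - j) :: 'v monomial set)) else 0) =
        kappa j E * int (card (monomials (d - j) :: 'v monomial set))"
      by (simp add: kappa_def sum_distrib_right)
  qed
  finally show ?thesis .
qed

text \<open>As every edge has two vertices, a set of edges that covers at most two vertices is empty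
  or a single edge.\<close>

lemma kappa_small:
  fixes E :: "'v::finite set set"
  assumes "\<And>e. e \<in> E \<Longrightarrow> card e = 2"
  shows "kappa 0 E = 1" "kappa (Suc 0) E = 0" "kappa 2 E = - int (card E)"
proof -
  have ge: "2 \<le> card (\<Union>S)" if "S \<subseteq> E" "e \<in> S" for S e
  proof -
    have "card e \<le> card (\<Union>S)" using that by (intro card_mono) auto
    then show ?thesis using assms that by auto
  qed
  have empty: "S = {}" if "S \<subseteq> E" "card (\<Union>S) < 2" for S
    using ge[OF that(1)] that(2) by (meson equals0I not_le)
  have "{S. S \<subseteq> E \<and> card (\<Union>S) = 0} = {{}}"
  proof (intro equalityI subsetI)
    fix S assume "S \<in> {S. S \<subseteq> E \<and> card (\<Union>S) = 0}"
    then have "S \<subseteq> E" "card (\<Union>S) = 0" by blast+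
    moreover from this(2) have "card (\<Union>S) < 2" by linarith
    ultimately show "S \<in> {{}}" using empty by blast
  qed simp
  then show "kappa 0 E = 1" unfolding kappa_def by (simp only: sum.insert sum.empty) simp
  have "{S. S \<subseteq> E \<and> card (\<Union>S) = Suc 0} = {}"
  proof (intro equals0I)
    fix S assume "S \<in> {S. S \<subseteq> E \<and> card (\<Union>S) = Suc 0}"
    then show False using empty[of S] by simp
  qed
  then show "kappa (Suc 0) E = 0" unfolding kappa_def by (simp only: sum.empty)
  have "{S. S \<subseteq> E \<and> card (\<Union>S) = 2} = (\<lambda>e. {e}) ` E"
  proof (intro equalityI subsetI)
    fix S assume "S \<in> {S. S \<subseteq> E \<and> card (\<Union>S) = 2}"
    then have S: "S \<subseteq> E" "card (\<Union>S) = 2" by auto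
    then obtain e where e: "e \<in> S" by (cases "S = {}") auto
    have "f = \<Union>S" if "f \<in> S" for f
      using that S assms by (intro card_subset_eq) auto
    then have "S = {e}" using e by blast
    then show "S \<in> (\<lambda>e. {e}) ` E" using e S by auto
  qed (use assms in auto)
  then show "kappa 2 E = - int (card E)"
    by (simp add: kappa_def sum.reindex)
qed

lemma monomials_0: "monomials 0 = {0}"
  by (auto simp: monomials_def)

text \<open>These numbers will be matched with the dimensions of the graded pieces of I;
  \<open>kappa 3\<close> and \<open>kappa 4\<close> are left to be compared with syzygies.\<close>

lemma card_not_edge_free:
  fixes E :: "'v::finite set set"
  assumes E: "\<forall>e\<in>E. card e = 2"
  defines "t d \<equiv> int (card {m. mdeg m = d \<and> \<not> (\<forall>e\<in>E. \<not> e \<subseteq> msupp m)})"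
    and "N d \<equiv> int (card (monomials d :: 'v monomial set))"
  shows "t 2 = int (card E)" "t 3 = int (card E) * N 1 - kappa 3 E"
    "t 4 = int (card E) * N 2 - kappa 3 E * N 1 - kappa 4 E"
proof -
  have split: "t d = N d - int (card {m. mdeg m = d \<and> (\<forall>e\<in>E. \<not> e \<subseteq> msupp m)})" for d
  proof -
    let ?P = "\<lambda>m. \<forall>e\<in>E. \<not> e \<subseteq> msupp m"
    have "monomials d = {m. mdeg m = d \<and> \<not> ?P m} \<union> {m. mdeg m = d \<and> ?P m}"
      by (auto simp: monomials_def)
    moreover have "finite {m. mdeg m = d \<and> \<not> ?P m}" "finite {m. mdeg m = d \<and> ?P m}"
      by (auto intro: finite_subset[OF _ finite_mdeg[of d]])
    moreover have "{m. mdeg m = d \<and> \<not> ?P m} \<inter> {m. mdeg m = d \<and> ?P m} = {}" by auto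
    ultimately have "card (monomials d :: 'v monomial set) = card {m. mdeg m = d \<and> \<not> ?P m} + card {m. mdeg m = d \<and> ?P m}"
      using card_Un_disjoint[of "{m. mdeg m = d \<and> \<not> ?P m}" "{m. mdeg m = d \<and> ?P m}"] by (simp only:)
    then show ?thesis by (simp add: t_def N_def)
  qed
  have N0: "N 0 = 1" by (simp add: N_def monomials_0)
  have k: "kappa 0 E = 1" "kappa (Suc 0) E = 0" "kappa 2 E = - int (card E)"
    using kappa_small[of E] E by blast+
  have at: "{..2} = {0, Suc 0, 2}" "{..3} = {0, Suc 0, 2, 3}" "{..4} = {0, Suc 0, 2, 3, 4 :: nat}" by auto
  show "t 2 = int (card E)" "t 3 = int (card E) * N 1 - kappa 3 E"
    "t 4 = int (card E) * N 2 - kappa 3 E * N 1 - kappa 4 E"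
    unfolding split card_edge_free N_def[symmetric] at using N0 k by simp_all
qed

section \<open>Linear presentations\<close>

text \<open>Elements of a free module of rank b are represented by functions on the natural numbers
  that vanish from b on. Unlike vectors of a fixed dimension they live in a type with total
  pointwise addition, on which \<open>vector_space\<close> can be interpreted.\<close>

definition tuple_scale :: "'k \<Rightarrow> (nat \<Rightarrow> ('v::finite, 'k::field) mpoly) \<Rightarrow> nat \<Rightarrow> ('v, 'k) mpoly" where
  "tuple_scale c h = (\<lambda>i. cpoly c * h i)"

lemma tuple_scale_apply [simp]: "tuple_scale c h i = cpoly c * h i"
  by (simp add: tuple_scale_def)

lemma vector_space_tuples:
  "vector_space (tuple_scale :: 'k::field \<Rightarrow> (nat \<Rightarrow> ('v::finite, 'k) mpoly) \<Rightarrow> _)"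
proof
  fix a b :: 'k and x y :: "nat \<Rightarrow> ('v, 'k) mpoly"
  show "tuple_scale a (x + y) = tuple_scale a x + tuple_scale a y"
    unfolding fun_eq_iff tuple_scale_apply plus_fun_apply by (intro allI distrib_left)
  show "tuple_scale (a + b) x = tuple_scale a x + tuple_scale b x"
    unfolding fun_eq_iff tuple_scale_apply plus_fun_apply cpoly_simps by (intro allI distrib_right)
  show "tuple_scale a (tuple_scale b x) = tuple_scale (a * b) x"
    unfolding fun_eq_iff tuple_scale_apply cpoly_simps by (intro allI mult.assoc[symmetric])
  show "tuple_scale 1 x = x"
    unfolding fun_eq_iff tuple_scale_apply cpoly_simps by simp
qed

interpretation tuple: vector_space "tuple_scale :: 'k::field \<Rightarrow> (nat \<Rightarrow> ('v::finite, 'k) mpoly) \<Rightarrow> _"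
  by (rule vector_space_tuples)

interpretation tuple_poly: vector_space_pair
  "tuple_scale :: 'k::field \<Rightarrow> (nat \<Rightarrow> ('v::finite, 'k) mpoly) \<Rightarrow> _"
  "\<lambda>(c :: 'k::field) (f :: ('v::finite, 'k) mpoly). cpoly c * f" ..

interpretation tuple_tuple: vector_space_pair
  "tuple_scale :: 'k::field \<Rightarrow> (nat \<Rightarrow> ('v::finite, 'k) mpoly) \<Rightarrow> _"
  "tuple_scale :: 'k::field \<Rightarrow> (nat \<Rightarrow> ('v::finite, 'k) mpoly) \<Rightarrow> _" ..

lemma sum_fun_apply_at: "(\<Sum>a\<in>A. f a) i = (\<Sum>a\<in>A. f a i)"
  by (induction A rule: infinite_finite_induct) auto

definition tuples :: "nat \<Rightarrow> nat \<Rightarrow> (nat \<Rightarrow> ('v::finite, 'k::field) mpoly) set" where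
  "tuples b d = {h. (\<forall>c<b. homogeneous d (h c)) \<and> (\<forall>c\<ge>b. h c = 0)}"

definition unit_tuple :: "nat \<times> 'v::finite monomial \<Rightarrow> nat \<Rightarrow> ('v, 'k::field) mpoly" where
  "unit_tuple = (\<lambda>(c, m) i. if i = c then mono_poly m else 0)"

lemma lookup_unit_tuple:
  "Poly_Mapping.lookup (unit_tuple x i) m = (if x = (i, m) then 1 else 0)"
  by (cases x) (simp add: unit_tuple_def lookup_mono_poly)

lemma unit_tuple_sum:
  assumes "finite M"
  shows "Poly_Mapping.lookup ((\<Sum>x\<in>{..<b} \<times> M. tuple_scale (k x) (unit_tuple x)) i) m =
    (if i < b \<and> m \<in> M then k (i, m) else 0)"
proof -
  have "Poly_Mapping.lookup ((\<Sum>x\<in>{..<b} \<times> M. tuple_scale (k x) (unit_tuple x)) i) m =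
      (\<Sum>x\<in>{..<b} \<times> M. k x * Poly_Mapping.lookup (unit_tuple x i) m)"
    by (simp add: sum_fun_apply_at lookup_sum)
  also have "\<dots> = (\<Sum>x\<in>{..<b} \<times> M. if x = (i, m) then k (i, m) else 0)"
    by (intro sum.cong) (auto simp: lookup_unit_tuple)
  also have "\<dots> = (if i < b \<and> m \<in> M then k (i, m) else 0)" using assms by simp
  finally show ?thesis .
qed

lemma tuples_basis:
  fixes T :: "(nat \<Rightarrow> ('v::finite, 'k::field) mpoly) set"
  assumes T_def: "T = tuples b d"
  shows "tuple.subspace T" "T \<subseteq> tuple.span (unit_tuple ` ({..<b} \<times> monomials d))"
    "tuple.dim T = b * card (monomials d :: 'v monomial set)"
proof -
  show "tuple.subspace T"
  proof (rule tuple.subspaceI)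
    show "0 \<in> T" by (simp add: T_def tuples_def homogeneous_def)
    show "x + y \<in> T" if "x \<in> T" "y \<in> T" for x y
      using that by (simp add: T_def tuples_def homogeneous_plus)
    show "tuple_scale c x \<in> T" if "x \<in> T" for c x
      using that by (simp add: T_def tuples_def homogeneous_cpoly_times)
  qed
  show span: "T \<subseteq> tuple.span (unit_tuple ` ({..<b} \<times> monomials d))"
  proof
    fix h assume h: "h \<in> T"
    have "h = (\<Sum>x\<in>{..<b} \<times> monomials d. tuple_scale (Poly_Mapping.lookup (h (fst x)) (snd x)) (unit_tuple x))"
    proof (rule ext, rule poly_mapping_eqI)
      fix i m
      have "Poly_Mapping.lookup (h i) m = 0" if "\<not> (i < b \<and> m \<in> monomials d)"
      proof (cases "i < b")
        case True
        then have "homogeneous d (h i)" "mdeg m \<noteq> d" using that h by (auto simp: T_def tuples_def monomials_def)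
        then have "m \<notin> Poly_Mapping.keys (h i)" by (auto simp: homogeneous_def)
        then show ?thesis by (simp add: in_keys_iff)
      qed (use h in \<open>auto simp: T_def tuples_def\<close>)
      then show "Poly_Mapping.lookup (h i) m = Poly_Mapping.lookup
          ((\<Sum>x\<in>{..<b} \<times> monomials d. tuple_scale (Poly_Mapping.lookup (h (fst x)) (snd x)) (unit_tuple x)) i) m"
        unfolding unit_tuple_sum[OF finite_monomials] by auto
    qed
    also have "\<dots> \<in> tuple.span (unit_tuple ` ({..<b} \<times> monomials d))"
      by (intro tuple.span_sum tuple.span_scale tuple.span_base) auto
    finally show "h \<in> tuple.span (unit_tuple ` ({..<b} \<times> monomials d))" .
  qed
  have "tuple.dim T = card ({..<b} \<times> monomials d :: (nat \<times> 'v monomial) set)"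
  proof (rule tuple.dim_family[where g = unit_tuple])
    fix k :: "nat \<times> 'v monomial \<Rightarrow> 'k"
    assume 0: "(\<Sum>x\<in>{..<b} \<times> monomials d. tuple_scale (k x) (unit_tuple x)) = 0"
    show "\<forall>x\<in>{..<b} \<times> monomials d. k x = 0"
    proof
      fix x :: "nat \<times> 'v monomial" assume x: "x \<in> {..<b} \<times> monomials d"
      obtain i m where im: "x = (i, m)" by (cases x)
      show "k x = 0"
        using unit_tuple_sum[OF finite_monomials[of d], where b = b and k = k and i = i and m = m] x unfolding 0 im by simp
    qed
  next
    fix x :: "nat \<times> 'v monomial" assume "x \<in> {..<b} \<times> monomials d"
    moreover have "homogeneous d (mono_poly m :: ('v, 'k) mpoly)" if "mdeg m = d" for m
      using that homogeneous_mono_poly[of m] by simp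
    moreover have "homogeneous d (0 :: ('v, 'k) mpoly)" by (simp add: homogeneous_def)
    ultimately show "unit_tuple x \<in> T"
      by (auto simp: T_def tuples_def unit_tuple_def monomials_def)
  qed (use span in auto)
  then show "tuple.dim T = b * card (monomials d :: 'v monomial set)"
    by (simp add: card_cartesian_product)
qed


text \<open>The right end of a linear resolution: \<open>a\<close> is the row of quadratic
  generators and \<open>s j\<close> the j-th column of the matrix of linear syzygies, extended by
  zero so that it is a tuple.\<close>

locale linear_presentation =
  fixes a :: "nat \<Rightarrow> ('v::finite, 'k::field) mpoly" and b :: nat
    and s :: "nat \<Rightarrow> nat \<Rightarrow> ('v, 'k) mpoly" and b' :: nat and I
  assumes quadric: "c < b \<Longrightarrow> homogeneous 2 (a c)"
    and linear: "j < b' \<Longrightarrow> c < b \<Longrightarrow> homogeneous 1 (s j c)"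
    and outside: "j < b' \<Longrightarrow> b \<le> c \<Longrightarrow> s j c = 0"
    and generate: "I = range (\<lambda>w. \<Sum>c<b. a c * w c)"
    and syzygy: "j < b' \<Longrightarrow> (\<Sum>c<b. a c * s j c) = 0"
    and syzygies: "(\<Sum>c<b. a c * w c) = 0 \<Longrightarrow> \<exists>u. \<forall>c<b. w c = (\<Sum>j<b'. s j c * u j)"
begin

definition present :: "(nat \<Rightarrow> ('v, 'k) mpoly) \<Rightarrow> ('v, 'k) mpoly" where
  "present w = (\<Sum>c<b. a c * w c)"

definition syz :: "nat \<Rightarrow> (nat \<Rightarrow> ('v, 'k) mpoly) set" where
  "syz d = {h \<in> tuples b d. present h = 0}"

lemma linear_present: "Vector_Spaces.linear tuple_scale (\<lambda>(c :: 'k) (f :: ('v, 'k) mpoly). cpoly c * f) present"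
proof (rule Vector_Spaces.linear.intro)
  show "module_hom tuple_scale (\<lambda>(c :: 'k) (f :: ('v, 'k) mpoly). cpoly c * f) present"
  proof
    fix x y :: "nat \<Rightarrow> ('v, 'k) mpoly" and k :: 'k
    show "present (x + y) = present x + present y"
      by (simp add: present_def distrib_left sum.distrib)
    show "present (tuple_scale k x) = cpoly k * present x"
      unfolding present_def tuple_scale_apply sum_distrib_left by (intro sum.cong refl mult.left_commute)
  qed
qed (rule vector_space_tuples vector_space_poly)+

lemma present_tuples: "present ` tuples b d = {f \<in> I. homogeneous (2 + d) f}"
proof (intro equalityI subsetI)
  fix f assume "f \<in> present ` tuples b d"
  then obtain h where h: "h \<in> tuples b d" "f = present h" by auto
  have "homogeneous (2 + d) f"
    unfolding h(2) present_def using h(1) quadric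
    by (intro homogeneous_sum homogeneous_times) (auto simp: tuples_def)
  moreover have "f \<in> I" using h unfolding generate present_def by blast
  ultimately show "f \<in> {f \<in> I. homogeneous (2 + d) f}" by simp
next
  fix f assume f: "f \<in> {f \<in> I. homogeneous (2 + d) f}"
  then obtain w where w: "f = (\<Sum>c<b. a c * w c)" unfolding generate by auto
  define h where "h c = (if c < b then component d (w c) else 0)" for c
  have "f = component (2 + d) f" using f component_homogeneous by force
  also have "\<dots> = (\<Sum>c<b. a c * component d (w c))"
    unfolding w component_sum using quadric by (intro sum.cong component_times) auto
  also have "\<dots> = present h" by (simp add: present_def h_def)
  finally show "f \<in> present ` tuples b d" by (auto simp: h_def tuples_def)
qed

lemma dim_tuples:
  "b * card (monomials d :: 'v monomial set) = poly.dim {f \<in> I. homogeneous (2 + d) f} + tuple.dim (syz d)"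
proof -
  note T = tuples_basis[where T = "tuples b d :: (nat \<Rightarrow> ('v, 'k) mpoly) set", OF refl]
  have "tuple.dim (tuples b d :: (nat \<Rightarrow> ('v, 'k) mpoly) set) = poly.dim (present ` tuples b d) + tuple.dim {h \<in> tuples b d. present h = 0}"
    by (rule tuple_poly.rank_nullity[OF linear_present T(1,2)]) simp
  then show ?thesis unfolding T(3) present_tuples syz_def .
qed

lemma syzygy_component:
  assumes "h \<in> syz d"
  obtains u where "\<And>c. c < b \<Longrightarrow> h c = component d (\<Sum>j<b'. s j c * u j)"
proof -
  obtain u where "\<forall>c<b. h c = (\<Sum>j<b'. s j c * u j)"
    using assms syzygies[of h] by (auto simp: syz_def present_def)
  then show thesis
    using assms by (intro that[of u]) (simp add: syz_def tuples_def component_homogeneous)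
qed

text \<open>Linear columns generate no nonzero constant syzygy. So the quadrics \<open>a\<close> are
  linearly independent, which identifies b later.\<close>

lemma dim_syz_0: "tuple.dim (syz 0) = 0"
proof -
  have "h = 0" if h: "h \<in> syz 0" for h
  proof
    fix c
    obtain u where u: "\<And>c. c < b \<Longrightarrow> h c = component 0 (\<Sum>j<b'. s j c * u j)"
      using syzygy_component[OF h] by metis
    show "h c = 0 c"
    proof (cases "c < b")
      case True
      have "component 0 (s j c * u j) = 0" if "j < b'" for j
        using component_times_less[OF linear[OF that True]] by simp
      then show ?thesis using u[OF True] by (simp add: component_sum)
    qed (use h in \<open>auto simp: syz_def tuples_def\<close>)
  qed
  then have "syz 0 \<subseteq> {0}" by auto
  then have "tuple.dim (syz 0) \<le> card ({} :: (nat \<Rightarrow> ('v, 'k) mpoly) set)"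
    by (intro tuple.dim_le_card) (auto simp: tuple.span_zero)
  then show ?thesis by simp
qed

definition times_tuple :: "'v monomial \<Rightarrow> (nat \<Rightarrow> ('v, 'k) mpoly) \<Rightarrow> nat \<Rightarrow> ('v, 'k) mpoly" where
  "times_tuple m h = (\<lambda>c. mono_poly m * h c)"

lemma linear_times_tuple: "Vector_Spaces.linear tuple_scale tuple_scale (times_tuple m)"
proof (rule Vector_Spaces.linear.intro)
  show "module_hom tuple_scale tuple_scale (times_tuple m)"
  proof
    fix x y :: "nat \<Rightarrow> ('v, 'k) mpoly" and k :: 'k
    show "times_tuple m (x + y) = times_tuple m x + times_tuple m y"
      unfolding fun_eq_iff times_tuple_def plus_fun_apply by (intro allI distrib_left)
    show "times_tuple m (tuple_scale k x) = tuple_scale k (times_tuple m x)"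
      unfolding fun_eq_iff times_tuple_def tuple_scale_apply by (intro allI mult.left_commute)
  qed
qed (rule vector_space_tuples)+

lemma homogeneous_sum_mono:
  assumes "homogeneous d f"
  shows "f = (\<Sum>m\<in>monomials d. cpoly (Poly_Mapping.lookup f m) * mono_poly m)"
proof -
  have "f = (\<Sum>m\<in>Poly_Mapping.keys f. cpoly (Poly_Mapping.lookup f m) * mono_poly m)" by (rule poly_sum_mono)
  also have "\<dots> = (\<Sum>m\<in>monomials d. cpoly (Poly_Mapping.lookup f m) * mono_poly m)"
    using assms by (intro sum.mono_neutral_left)
      (auto simp: monomials_def homogeneous_def in_keys_iff cpoly_simps finite_mdeg)
  finally show ?thesis .
qed

text \<open>Since the syzygies are generated by linear ones, \<open>syz 2\<close> is the product of the linear forms with \<open>syz 1\<close>.\<close>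

lemma dim_syz_2: "tuple.dim (syz 2) \<le> card (monomials 1 :: 'v monomial set) * tuple.dim (syz 1)"
proof -
  obtain Q where Q: "Q \<subseteq> syz 1" "tuple.independent Q" "syz 1 \<subseteq> tuple.span Q" "card Q = tuple.dim (syz 1)"
    by (rule tuple.basis_exists)
  have "syz 1 \<subseteq> tuples b 1" by (auto simp: syz_def)
  then have "Q \<subseteq> tuple.span (unit_tuple ` ({..<b} \<times> monomials 1))"
    by (rule subset_trans[OF subset_trans[OF Q(1)] tuples_basis(2)[OF refl]])
  moreover have "finite (unit_tuple ` ({..<b} \<times> monomials 1) :: (nat \<Rightarrow> ('v, 'k) mpoly) set)" by simp
  ultimately have finQ: "finite Q" using tuple.independent_span_bound[OF _ Q(2)] by (meson finite_subset)
  \<comment> \<open>Products of a variable and an element of the basis \<open>Q\<close>; their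
    number has the required bound.\<close>
  define R where "R = (\<Union>m\<in>monomials 1. times_tuple m ` Q)"
  have "syz 2 \<subseteq> tuple.span R"
  proof
    fix h assume h: "h \<in> syz 2"
    obtain u where u: "\<And>c. c < b \<Longrightarrow> h c = component 2 (\<Sum>j<b'. s j c * u j)"
      using syzygy_component[OF h] by metis
    \<comment> \<open>As the columns \<open>s j\<close> are linear, only the linear part of
      \<open>u j\<close> contributes in degree two; these are its coefficients.\<close>
    define l where "l j m = Poly_Mapping.lookup (component 1 (u j)) m" for j m
    have "h = (\<Sum>j<b'. \<Sum>m\<in>monomials 1. tuple_scale (l j m) (times_tuple m (s j)))"
    proof
      fix c
      show "h c = (\<Sum>j<b'. \<Sum>m\<in>monomials 1. tuple_scale (l j m) (times_tuple m (s j))) c"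
      proof (cases "c < b")
        case True
        have "component 2 (s j c * u j) = (\<Sum>m\<in>monomials 1. cpoly (l j m) * (mono_poly m * s j c))" if "j < b'" for j
        proof -
          have "component (1 + 1) (s j c * u j) = s j c * component 1 (u j)"
            by (rule component_times[OF linear[OF that True]])
          also have "component 1 (u j) = (\<Sum>m\<in>monomials 1. cpoly (l j m) * mono_poly m)"
            unfolding l_def by (rule homogeneous_sum_mono) simp
          finally have "component 2 (s j c * u j) = (\<Sum>m\<in>monomials 1. s j c * (cpoly (l j m) * mono_poly m))"
            unfolding sum_distrib_left one_add_one .
          then show ?thesis by (simp only: mult.commute mult.left_commute)
        qed
        then show ?thesis
          using u[OF True] by (simp add: component_sum sum_fun_apply_at times_tuple_def)
      next
        case False
        then show ?thesis
          using h outside by (simp add: sum_fun_apply_at times_tuple_def syz_def tuples_def)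
      qed
    qed
    also have "\<dots> \<in> tuple.span R"
    proof (intro tuple.span_sum tuple.span_scale)
      fix j m assume jm: "j \<in> {..<b'}" "m \<in> (monomials 1 :: 'v monomial set)"
      have "s j \<in> syz 1"
        using jm linear outside syzygy by (auto simp: syz_def tuples_def present_def)
      then have "times_tuple m (s j) \<in> times_tuple m ` tuple.span Q" by (intro imageI subsetD[OF Q(3)])
      also have "\<dots> = tuple.span (times_tuple m ` Q)"
        by (rule tuple_tuple.linear_span_image[OF linear_times_tuple, symmetric])
      also have "\<dots> \<subseteq> tuple.span R"
        using jm by (intro tuple.span_mono) (auto simp: R_def)
      finally show "times_tuple m (s j) \<in> tuple.span R" .
    qed
    finally show "h \<in> tuple.span R" .
  qed
  moreover have "finite R" using finQ by (simp add: R_def)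
  ultimately have "tuple.dim (syz 2) \<le> card R" by (intro tuple.dim_le_card)
  also have "\<dots> \<le> (\<Sum>m\<in>(monomials 1 :: 'v monomial set). card (times_tuple m ` Q))"
    unfolding R_def by (rule card_UN_le) simp
  also have "\<dots> \<le> (\<Sum>m\<in>(monomials 1 :: 'v monomial set). card Q)"
    by (intro sum_mono card_image_le finQ)
  finally show ?thesis using Q(4) by simp
qed

end

text \<open>The augmentation \<open>A 0\<close> supplies the generators and \<open>A 1\<close> their
  syzygies. The basis degrees 2 and 3 make the entries quadratic and linear.\<close>

lemma linear_presentation_resolution:
  fixes I :: "('v::finite, 'k::field) mpoly set"
  assumes "has_linear_resolution 2 I"
  obtains a b s b' where "linear_presentation a b s b' I"
proof -
  obtain D A where res: "minimal_graded_free_resolution I D A" and D: "\<And>i x. x \<in> set (D i) \<Longrightarrow> x = int (2 + i)"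
    using assms unfolding has_linear_resolution_def by blast
  define b b' where "b = length (D 0)" and "b' = length (D 1)"
  define a where "a c = A 0 $$ (0, c)" for c
  define s where "s j c = (if c < b then A 1 $$ (c, j) else 0)" for j c
  have gr: "graded_map (D 0) [0] (A 0)" "graded_map (D 1) (D 0) (A 1)"
    and im: "mat_image (A 0) = {v \<in> carrier_vec 1. v $ 0 \<in> I}" "mat_image (A 1) = mat_kernel (A 0)"
    using res unfolding minimal_graded_free_resolution_def graded_free_resolution_def by (auto simp: numeral_eq_Suc)
  have car: "A 0 \<in> carrier_mat 1 b" "A 1 \<in> carrier_mat b b'"
    using gr by (auto simp: graded_map_def b_def b'_def)
  have D0: "D 0 ! c = 2" if "c < b" for c using D[of "D 0 ! c" 0] that by (simp add: b_def)
  have D1: "D 1 ! c = 3" if "c < b'" for c using D[of "D 1 ! c" 1] that by (simp add: b'_def)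
  have mult0: "(A 0 *\<^sub>v w) $ 0 = (\<Sum>c<b. a c * w $ c)" if "w \<in> carrier_vec b" for w
    using that car(1) by (auto simp: scalar_prod_def a_def lessThan_atLeast0 intro!: sum.cong)
  have mult1: "(A 1 *\<^sub>v w) $ c = (\<Sum>j<b'. s j c * w $ j)" if "w \<in> carrier_vec b'" "c < b" for w c
    using that car(2) by (auto simp: scalar_prod_def s_def lessThan_atLeast0 intro!: sum.cong)
  have kernel: "w \<in> mat_kernel (A 0) \<longleftrightarrow> w \<in> carrier_vec b \<and> (\<Sum>c<b. a c * w $ c) = 0" for w
  proof -
    have "A 0 *\<^sub>v w = 0\<^sub>v 1 \<longleftrightarrow> (A 0 *\<^sub>v w) $ 0 = 0"
      using car(1) by (auto simp del: index_mult_mat_vec intro!: eq_vecI)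
    then show ?thesis using mult0 car(1) by (auto simp: mat_kernel_def)
  qed
  have "linear_presentation a b s b' I"
  proof
    show "homogeneous 2 (a c)" if "c < b" for c
      using gr(1) that D0[OF that] by (force simp: graded_map_def homogeneous_def a_def b_def)
    show "homogeneous 1 (s j c)" if "j < b'" "c < b" for j c
      using gr(2) that D0[OF that(2)] D1[OF that(1)] by (force simp: graded_map_def homogeneous_def s_def b_def b'_def)
    show "s j c = 0" if "j < b'" "b \<le> c" for j c using that by (simp add: s_def)
    show "I = range (\<lambda>w. \<Sum>c<b. a c * w c)"
    proof (intro equalityI subsetI)
      fix f assume "f \<in> I"
      then have "vec 1 (\<lambda>_. f) \<in> mat_image (A 0)" unfolding im by simp
      then obtain w where w: "w \<in> carrier_vec b" "vec 1 (\<lambda>_. f) = A 0 *\<^sub>v w"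
        using car by (auto simp: mat_image_def)
      have "f = (A 0 *\<^sub>v w) $ 0" by (simp flip: w(2))
      then show "f \<in> range (\<lambda>w. \<Sum>c<b. a c * w c)" using mult0[OF w(1)] by auto
    next
      fix f assume "f \<in> range (\<lambda>w. \<Sum>c<b. a c * w c)"
      then obtain w where w: "f = (\<Sum>c<b. a c * w c)" by auto
      have "A 0 *\<^sub>v vec b w \<in> mat_image (A 0)" using car by (auto simp: mat_image_def)
      then have "(A 0 *\<^sub>v vec b w) $ 0 \<in> I" unfolding im by simp
      then show "f \<in> I" using mult0[of "vec b w"] w by simp
    qed
    show "(\<Sum>c<b. a c * s j c) = 0" if "j < b'" for j
    proof -
      have "A 1 *\<^sub>v unit_vec b' j \<in> mat_image (A 1)" using car by (auto simp: mat_image_def)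
      then have "(\<Sum>c<b. a c * (A 1 *\<^sub>v unit_vec b' j) $ c) = 0" unfolding im kernel by simp
      moreover have "(A 1 *\<^sub>v unit_vec b' j) $ c = s j c" if "c < b" for c
      proof -
        have "(A 1 *\<^sub>v unit_vec b' j) $ c = (\<Sum>i<b'. s i c * unit_vec b' j $ i)" by (rule mult1) (use that in auto)
        also have "\<dots> = (\<Sum>i<b'. if i = j then s j c else 0)"
          using \<open>j < b'\<close> by (intro sum.cong) auto
        finally show ?thesis using \<open>j < b'\<close> by simp
      qed
      ultimately show ?thesis by simp
    qed
    show "\<exists>u. \<forall>c<b. w c = (\<Sum>j<b'. s j c * u j)" if "(\<Sum>c<b. a c * w c) = 0" for w
    proof -
      have "vec b w \<in> mat_image (A 1)" unfolding im kernel using that by simp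
      then obtain u where u: "u \<in> carrier_vec b'" "vec b w = A 1 *\<^sub>v u" using car by (auto simp: mat_image_def)
      have "w c = (\<Sum>j<b'. s j c * u $ j)" if "c < b" for c
      proof -
        have "w c = vec b w $ c" using that by simp
        then show ?thesis unfolding u(2) mult1[OF u(1) that] .
      qed
      then show ?thesis by blast
    qed
  qed
  then show thesis by (rule that)
qed


section \<open>Hilbert function of the ideal, the sign of \<open>kappa 4\<close>, and the half
  graph\<close>

context binomial_initial_ideal
begin

text \<open>Macaulay's basis theorem in this setting: the differences of the non-normal monomials of
  degree d and their normal forms are a basis of the graded piece of I.\<close>

lemma dim_graded:
  "poly.dim {f \<in> I. homogeneous d f} = card {m. mdeg m = d \<and> \<not> (\<forall>e\<in>E. \<not> e \<subseteq> msupp m)}"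
proof -
  define T where "T = {m. mdeg m = d \<and> \<not> (\<forall>e\<in>E. \<not> e \<subseteq> msupp m)}"
  have finT: "finite T" unfolding T_def by (rule finite_subset[OF _ finite_mdeg[of d]]) auto
  obtain n where n: "\<And>m. ideal_eqv I m (n m)" "\<And>m. \<forall>e\<in>E. \<not> e \<subseteq> msupp (n m)"
    using normal_form_ex by metis
  \<comment> \<open>The support of \<open>n m\<close> contains no edge, so at a monomial k whose
    support does, only the summand of k contributes.\<close>
  have look: "Poly_Mapping.lookup (\<Sum>m\<in>T. cpoly (c m) * (mono_poly m - mono_poly (n m))) k = (if k \<in> T then c k else 0)"
    if k: "\<not> (\<forall>e\<in>E. \<not> e \<subseteq> msupp k)" for c :: "'v monomial \<Rightarrow> 'k" and k
  proof -
    have "n m \<noteq> k" for m using n(2)[of m] k by auto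
    then have "Poly_Mapping.lookup (\<Sum>m\<in>T. cpoly (c m) * (mono_poly m - mono_poly (n m))) k = (\<Sum>m\<in>T. if m = k then c m else 0)"
      unfolding lookup_sum lookup_cpoly_times lookup_minus lookup_mono_poly by (intro sum.cong) auto
    then show ?thesis using finT by simp
  qed
  have "poly.dim {f \<in> I. homogeneous d f} = card T"
  proof (rule poly.dim_family[OF finT])
    fix c :: "'v monomial \<Rightarrow> 'k"
    assume 0: "(\<Sum>m\<in>T. cpoly (c m) * (mono_poly m - mono_poly (n m))) = 0"
    show "\<forall>m\<in>T. c m = 0"
    proof
      fix k assume k: "k \<in> T"
      then show "c k = 0" using look[of k c] unfolding 0 by (simp add: T_def)
    qed
  next
    fix m assume m: "m \<in> T"
    have "homogeneous d (mono_poly m - mono_poly (n m) :: ('v, 'k) mpoly)"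
      using m eqv_mdeg[OF n(1)[of m]]
      by (auto simp: homogeneous_def in_keys_iff lookup_minus lookup_mono_poly T_def split: if_splits)
    then show "mono_poly m - mono_poly (n m) \<in> {f \<in> I. homogeneous d f}"
      using n(1)[of m] by (simp add: ideal_eqv_def)
  next
    show "{f \<in> I. homogeneous d f} \<subseteq> poly.span ((\<lambda>m. mono_poly m - mono_poly (n m)) ` T)"
    proof
      fix f assume f: "f \<in> {f \<in> I. homogeneous d f}"
      define h where "h = (\<Sum>m\<in>T. cpoly (Poly_Mapping.lookup f m) * (mono_poly m - mono_poly (n m)))"
      define g where "g = f - h"
      have "h \<in> I"
        unfolding h_def gen using n(1)
        by (intro ideal.span_sum ideal.span_scale) (simp add: ideal_eqv_def flip: gen)
      then have gI: "g \<in> I" using f unfolding g_def gen by (intro ideal.span_diff) auto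
      have keys: "\<forall>e\<in>E. \<not> e \<subseteq> msupp k" if "k \<in> Poly_Mapping.keys g" for k
      proof (rule ccontr)
        assume k: "\<not> ?thesis"
        have "Poly_Mapping.lookup f k = 0" if "k \<notin> T"
          using that k f by (auto simp: T_def homogeneous_def in_keys_iff)
        then have "Poly_Mapping.lookup g k = 0"
          unfolding g_def lookup_minus h_def look[OF k] by simp
        then show False using that by (simp add: in_keys_iff)
      qed
      have "g = 0"
      proof (rule ccontr)
        assume "g \<noteq> 0"
        then have "Poly_Mapping.keys g \<noteq> {}" by simp
        then obtain k where k: "k \<in> Poly_Mapping.keys g" by blast
        \<comment> \<open>All monomials of g are normal, so k is the only one in its class and the
          class sum is its coefficient.\<close>
        have "class_sum (\<lambda>m. ideal_eqv I (0 + m) k) g = (\<Sum>m\<in>Poly_Mapping.keys g. if m = k then Poly_Mapping.lookup g m else 0)"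
          unfolding class_sum_def using normal_form_unique keys k eqv_refl by (intro sum.cong) auto
        also have "\<dots> = Poly_Mapping.lookup g k" using k by simp
        finally show False using eqv_class_sum[OF gI, of 0 k] k by (simp add: in_keys_iff)
      qed
      then have "f = h" by (simp add: g_def)
      also have "h \<in> poly.span ((\<lambda>m. mono_poly m - mono_poly (n m)) ` T)"
        unfolding h_def by (intro poly.span_sum poly.span_scale poly.span_base) auto
      finally show "f \<in> poly.span ((\<lambda>m. mono_poly m - mono_poly (n m)) ` T)" .
    qed
  qed
  then show ?thesis unfolding T_def .
qed

text \<open>A minimal generating set in a single degree is a basis of the lowest graded piece over
  the field, and the dimension of that piece counts the edges.\<close>

lemma card_edges:
  assumes "minimally_generates B I" shows "card E = card B"
proof -
  have hom: "homogeneous 2 f" if "f \<in> B" for f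
    using binom[OF that] unfolding squarefree_quadratic_binomial_def
    by (auto simp: homogeneous_def in_keys_iff lookup_minus lookup_mono_poly split: if_splits)
  have "B \<subseteq> {f \<in> I. homogeneous 2 f}" using hom by (auto simp: gen ideal.span_base)
  moreover have "{f \<in> I. homogeneous 2 f} \<subseteq> poly.span B"
  proof
    fix f assume f: "f \<in> {f \<in> I. homogeneous 2 f}"
    then have "component 2 f \<in> poly.span B" using hom by (intro ideal_lowest_degree(1)) (auto simp: gen)
    then show "f \<in> poly.span B" using f component_homogeneous[of 2 f] by simp
  qed
  moreover have "poly.independent B"
    unfolding poly.dependent_def
  proof (intro notI, elim bexE)
    fix b assume b: "b \<in> B" "b \<in> poly.span (B - {b})"
    have "poly.span (B - {b}) \<subseteq> ideal_gen (B - {b})"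
      by (intro poly.span_minimal poly.subspaceI ideal.span_superset ideal.span_zero ideal.span_add ideal.span_scale)
    then have "b \<in> ideal_gen (B - {b})" using b(2) by (rule subsetD)
    then have "x \<in> ideal_gen (B - {b})" if "x \<in> B" for x
      using that ideal.span_base[of x "B - {b}"] by (cases "x = b") auto
    then have "ideal_gen B \<subseteq> ideal_gen (B - {b})"
      by (intro ideal.span_minimal ideal.subspace_span subsetI)
    moreover have "ideal_gen (B - {b}) \<subseteq> ideal_gen B" by (rule ideal.span_mono) auto
    ultimately have "ideal_gen (B - {b}) = I" unfolding gen by (rule equalityI[rotated])
    then show False using assms b(1) unfolding minimally_generates_def by blast
  qed
  ultimately have "card B = poly.dim {f \<in> I. homogeneous 2 f}" by (rule poly.basis_card_eq_dim)
  then have "int (card B) = int (poly.dim {f \<in> I. homogeneous 2 f})" by simp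
  also have "\<dots> = int (card E)"
    unfolding dim_graded by (rule card_not_edge_free(1)) (simp add: edges)
  finally show ?thesis by simp
qed

text \<open>Rank-nullity in degrees 2, 3 and 4 shows that b is \<open>card E\<close>, that
  \<open>syz 1\<close> has dimension \<open>kappa 3 E\<close>, and that \<open>syz 2\<close> has
  dimension \<open>kappa 3 E * N 1 + kappa 4 E\<close>. By \<open>dim_syz_2\<close> the last number
  is at most \<open>N 1 * kappa 3 E\<close>.\<close>

lemma kappa4_nonpos:
  assumes "has_linear_resolution 2 I" shows "kappa 4 E \<le> 0"
proof -
  obtain a b s b' where "linear_presentation a b s b' I"
    using linear_presentation_resolution[OF assms] by metis
  then interpret linear_presentation a b s b' I .
  define N t where "N d = int (card (monomials d :: 'v monomial set))"
    and "t d = int (card {m :: 'v monomial. mdeg m = d \<and> \<not> (\<forall>e\<in>E. \<not> e \<subseteq> msupp m)})" for d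
  have t: "t 2 = int (card E)" "t 3 = int (card E) * N 1 - kappa 3 E"
    "t 4 = int (card E) * N 2 - kappa 3 E * N 1 - kappa 4 E"
    unfolding t_def N_def by (rule card_not_edge_free; simp add: edges)+
  have dim: "int b * N d = t (2 + d) + int (tuple.dim (syz d))" for d
  proof -
    have "int b * N d = int (b * card (monomials d :: 'v monomial set))" by (simp add: N_def)
    also have "\<dots> = int (poly.dim {f \<in> I. homogeneous (2 + d) f}) + int (tuple.dim (syz d))"
      unfolding dim_tuples by (rule of_nat_add)
    also have "int (poly.dim {f \<in> I. homogeneous (2 + d) f}) = t (2 + d)"
      unfolding t_def dim_graded ..
    finally show ?thesis .
  qed
  have "N 0 = 1" by (simp add: N_def monomials_0)
  then have b: "int b = int (card E)" using dim[of 0] t(1) dim_syz_0 by simp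
  have "int (tuple.dim (syz 1)) = kappa 3 E" using dim[of 1] t(2) unfolding b by simp
  moreover have "int (tuple.dim (syz 2)) = kappa 3 E * N 1 + kappa 4 E" using dim[of 2] t(3) unfolding b by simp
  moreover have "int (tuple.dim (syz 2)) \<le> N 1 * int (tuple.dim (syz 1))"
    unfolding N_def of_nat_mult[symmetric] of_nat_le_iff by (rule dim_syz_2)
  ultimately show ?thesis by (simp add: mult.commute)
qed

lemma twin_free: "twin_free E"
  unfolding twin_free_def
proof (intro allI impI)
  fix x y assume "x \<noteq> y" "graph_nbh E x - {y} = graph_nbh E y - {x}"
  then show "graph_nbh E x - {y} = {}"
    using no_twins[of x y] by (auto simp: graph_nbh_def nbh_def)
qed

theorem half_graph:
  assumes "minimally_generates B I" "card B = 6" "has_linear_resolution 2 I"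
  obtains a b c d f g where "distinct [a, b, c, d, f, g]"
    "E = {{a, b}, {a, c}, {a, d}, {b, f}, {b, g}, {c, f}}"
proof -
  have "card E = 6" "\<forall>e\<in>E. card e = 2" using card_edges assms edges by auto
  from this twin_free kappa4_nonpos[OF assms(3)] show thesis
  proof (cases rule: six_edge_graphs)
    case (house a b c d f)
    \<comment> \<open>In the order a, f, c, d, b the vertices run along the path whose complement is
      the house.\<close>
    have "E = {{a, c}, {a, d}, {a, b}, {f, d}, {f, b}, {c, b}}"
      unfolding house(2) by (auto simp: insert_commute)
    then have False by (rule no_house) (use house(1) in auto)
    then show thesis ..
  next
    case (other a b c d f g)
    from other(2) consider "E = {{a, b}, {a, c}, {a, d}, {b, c}, {b, f}, {c, g}}"
      | "E = {{a, b}, {a, c}, {a, d}, {b, c}, {b, f}, {d, g}}"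
      | "E = {{a, b}, {a, c}, {a, d}, {b, f}, {b, g}, {c, f}}"
      | "E = {{a, b}, {a, c}, {a, d}, {b, f}, {c, g}, {f, g}}"
      unfolding insert_iff empty_iff simp_thms by (elim disjE) iprover+
    then show thesis
    proof cases
      case 1
      have "E = {{a, b}, {a, c}, {b, c}, {d, a}, {f, b}, {g, c}}"
        unfolding 1 by (auto simp: insert_commute)
      then have False by (rule no_net) (rule other(1))
      then show thesis ..
    next
      case 2
      then have False by (rule no_triangle_with_tails) (rule other(1))
      then show thesis ..
    next
      case 3
      then show thesis by (rule that[OF other(1)])
    next
      case 4
      then have False by (rule no_pendant_pentagon) (rule other(1))
      then show thesis ..
    qed
  qed
qed

end

section \<open>The initial ideal of the generic minors\<close>

lemma lex_orderI:
  assumes "k < length xs" "Poly_Mapping.lookup s (xs ! k) < Poly_Mapping.lookup t (xs ! k)"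
    and "\<And>l. l < k \<Longrightarrow> Poly_Mapping.lookup s (xs ! l) = Poly_Mapping.lookup t (xs ! l)"
  shows "(s, t) \<in> lex_order xs"
  unfolding lex_order_def using assms by auto

lemma linear_order_lex:
  assumes "set xs = UNIV" shows "linear_order (lex_order xs)"
proof -
  have less: "(s, t) \<in> lex_order xs \<longleftrightarrow> s = t \<or> (\<exists>i < length xs. Poly_Mapping.lookup s (xs ! i) < Poly_Mapping.lookup t (xs ! i) \<and>
      (\<forall>j < i. Poly_Mapping.lookup s (xs ! j) = Poly_Mapping.lookup t (xs ! j)))" for s t
    unfolding lex_order_def mem_Collect_eq prod.case ..
  have diff: "\<exists>i<length xs. Poly_Mapping.lookup s (xs ! i) \<noteq> Poly_Mapping.lookup t (xs ! i) \<and>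
      (\<forall>j < i. Poly_Mapping.lookup s (xs ! j) = Poly_Mapping.lookup t (xs ! j))" if ne: "s \<noteq> t" for s t :: "'a monomial"
  proof -
    obtain v where v: "Poly_Mapping.lookup s v \<noteq> Poly_Mapping.lookup t v"
      using ne by (auto simp: monomial_eq_iff)
    obtain k where k: "k < length xs" "xs ! k = v" using assms using in_set_conv_nth[of v xs] by blast
    define P where "P i \<longleftrightarrow> Poly_Mapping.lookup s (xs ! i) \<noteq> Poly_Mapping.lookup t (xs ! i)" for i
    have "P k" using v k by (simp add: P_def)
    then have "P (Least P)" "Least P \<le> k" by (rule LeastI, rule Least_le)
    moreover have "\<not> P j" if "j < Least P" for j using that by (rule not_less_Least)
    ultimately show ?thesis using k(1) unfolding P_def[symmetric] by (metis P_def order.strict_trans1)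
  qed
  show ?thesis
    unfolding order_on_defs
  proof (intro conjI)
    show "lex_order xs \<subseteq> UNIV \<times> UNIV" by simp
    show "refl (lex_order xs)" by (simp add: refl_on_def less)
    show "total (lex_order xs)"
      unfolding total_on_def
    proof (intro ballI impI)
      fix s t :: "'a monomial" assume "s \<noteq> t"
      then obtain i where i: "i < length xs" "Poly_Mapping.lookup s (xs ! i) \<noteq> Poly_Mapping.lookup t (xs ! i)"
          "\<forall>j < i. Poly_Mapping.lookup s (xs ! j) = Poly_Mapping.lookup t (xs ! j)"
        using diff by blast
      then consider "Poly_Mapping.lookup s (xs ! i) < Poly_Mapping.lookup t (xs ! i)"
        | "Poly_Mapping.lookup t (xs ! i) < Poly_Mapping.lookup s (xs ! i)" by linarith
      then show "(s, t) \<in> lex_order xs \<or> (t, s) \<in> lex_order xs"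
        using i(1,3) by cases (auto intro: lex_orderI)
    qed
    show "antisym (lex_order xs)"
    proof (rule antisymI, rule ccontr)
      fix s t assume st: "(s, t) \<in> lex_order xs" "(t, s) \<in> lex_order xs" "s \<noteq> t"
      then obtain i j where
        "Poly_Mapping.lookup s (xs ! i) < Poly_Mapping.lookup t (xs ! i)" "\<forall>k < i. Poly_Mapping.lookup s (xs ! k) = Poly_Mapping.lookup t (xs ! k)"
        "Poly_Mapping.lookup t (xs ! j) < Poly_Mapping.lookup s (xs ! j)" "\<forall>k < j. Poly_Mapping.lookup t (xs ! k) = Poly_Mapping.lookup s (xs ! k)"
        unfolding less by blast
      then show False by (cases i j rule: linorder_cases) auto
    qed
    show "trans (lex_order xs)"
    proof (rule transI)
      fix s t u assume st: "(s, t) \<in> lex_order xs" "(t, u) \<in> lex_order xs"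
      show "(s, u) \<in> lex_order xs"
      proof (cases "s = t \<or> t = u")
        case False
        then obtain i j where ij: "i < length xs" "j < length xs"
          "Poly_Mapping.lookup s (xs ! i) < Poly_Mapping.lookup t (xs ! i)" "\<forall>k < i. Poly_Mapping.lookup s (xs ! k) = Poly_Mapping.lookup t (xs ! k)"
          "Poly_Mapping.lookup t (xs ! j) < Poly_Mapping.lookup u (xs ! j)" "\<forall>k < j. Poly_Mapping.lookup t (xs ! k) = Poly_Mapping.lookup u (xs ! k)"
          using st unfolding less by blast
        then have "Poly_Mapping.lookup s (xs ! min i j) < Poly_Mapping.lookup u (xs ! min i j)"
          by (cases i j rule: linorder_cases) (auto simp: min_def)
        moreover have "\<forall>k < min i j. Poly_Mapping.lookup s (xs ! k) = Poly_Mapping.lookup u (xs ! k)" using ij by auto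
        moreover have "min i j < length xs" using ij by auto
        ultimately show ?thesis unfolding less by blast
      qed (use st in auto)
    qed
  qed
qed

lemma exhaust_4: "x = 0 \<or> x = 1 \<or> x = 2 \<or> x = 3" for x :: 4
proof (cases x)
  case (of_int z)
  then have "0 \<le> z" "z < 4" by simp_all
  then have "z = 0 \<or> z = 1 \<or> z = 2 \<or> z = 3" by presburger
  then show ?thesis using of_int(1) by (elim disjE) simp_all
qed

lemma less_4_iff: "i < j \<longleftrightarrow> (i, j) \<in> {(0, 1), (0, 2), (0, 3), (1, 2), (1, 3), (2, 3)}" for i j :: 4
  using exhaust_4[of i] exhaust_4[of j]
  by (elim disjE) (simp_all add: less_bit0_def bit0.Rep_numeral bit0.Rep_0 bit0.Rep_1)

text \<open>Since i is the smaller index, the exponent of \<open>Inl i\<close> decides; this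
  variable stands at position i of the list.\<close>

lemma lex_minor:
  assumes "i < (j::4)"
  shows "(X (Inl j) + X (Inr i), X (Inl i) + X (Inr j)) \<in> minors_lex"
proof -
  consider (0) "i = 0" "j \<noteq> 0" | (1) "i = 1" "j \<noteq> 0" "j \<noteq> 1" | (2) "i = 2" "j = 3"
    using assms by (auto simp: less_4_iff)
  then show ?thesis
  proof cases
    case 0
    then show ?thesis unfolding minors_lex_def by (intro lex_orderI[of 0]) (simp_all add: lookup_X)
  next
    case 1
    then show ?thesis unfolding minors_lex_def by (intro lex_orderI[of 1]) (simp_all add: lookup_X)
  next
    case 2
    then show ?thesis unfolding minors_lex_def
      by (intro lex_orderI[of 2]) (auto simp: lookup_X numeral_2_eq_2 less_Suc_eq)
  qed
qed

text \<open>For i < j the leading monomial of the minor of columns i and j; for i > j the trailing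
  monomial of the minor of columns j and i.\<close>

definition minor_lead :: "4 \<Rightarrow> 4 \<Rightarrow> (4 + 4) monomial" where
  "minor_lead i j = X (Inl i) + X (Inr j)"

lemma minor_lead_inject: "minor_lead i j = minor_lead k l \<longleftrightarrow> i = k \<and> j = l"
proof
  assume *: "minor_lead i j = minor_lead k l"
  have "msupp (minor_lead i j) = msupp (minor_lead k l)" by (simp only: *)
  then show "i = k \<and> j = l" by (auto simp: minor_lead_def doubleton_eq_iff)
qed simp

lemma mdeg_minor_lead [simp]: "mdeg (minor_lead i j) = 2"
  by (simp add: minor_lead_def)

definition minors :: "(4 + 4, 'k::comm_ring_1) mpoly set" where
  "minors = {mono_poly (minor_lead i j) - mono_poly (minor_lead j i) | i j. i < j}"

lemma minors_ideal_alt: "minors_ideal = ideal_gen minors"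
  unfolding minors_ideal_def minors_def
  by (simp add: var_def mono_poly_times minor_lead_def X_def)

lemma homogeneous_minors: "f \<in> minors \<Longrightarrow> homogeneous 2 f"
  by (auto simp: minors_def homogeneous_def in_keys_iff lookup_minus lookup_mono_poly split: if_splits)

text \<open>Both properties hold for a single minor and pass to linear combinations. By antisymmetry
  the two monomials of a minor can only occur together.\<close>

lemma span_minors:
  assumes "f \<in> poly.span (minors :: (4 + 4, 'k::field) mpoly set)"
  shows "Poly_Mapping.lookup f (minor_lead i j) = - Poly_Mapping.lookup f (minor_lead j i)"
    "m \<in> Poly_Mapping.keys f \<Longrightarrow> \<exists>i j. i \<noteq> j \<and> m = minor_lead i j"
proof -
  have "(\<forall>i j. Poly_Mapping.lookup f (minor_lead i j) = - Poly_Mapping.lookup f (minor_lead j i)) \<and>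
      (\<forall>m. Poly_Mapping.lookup f m \<noteq> 0 \<longrightarrow> (\<exists>i j. i \<noteq> j \<and> m = minor_lead i j))"
    using assms
  proof (induction rule: poly.span_induct_alt)
    case base
    then show ?case by simp
  next
    case (step c g f)
    obtain k l where kl: "k < l" "g = mono_poly (minor_lead k l) - mono_poly (minor_lead l k)"
      using step(1) by (auto simp: minors_def)
    have g: "Poly_Mapping.lookup g m = (if m = minor_lead k l then 1 else 0) - (if m = minor_lead l k then 1 else 0)" for m
      unfolding kl(2) lookup_minus lookup_mono_poly by (simp only: eq_commute)
    have "Poly_Mapping.lookup g (minor_lead i j) = - Poly_Mapping.lookup g (minor_lead j i)" for i j
      unfolding g minor_lead_inject minus_diff_eq by (simp only: conj_commute)
    then have 1: "Poly_Mapping.lookup (cpoly c * g + f) (minor_lead i j) = - Poly_Mapping.lookup (cpoly c * g + f) (minor_lead j i)" for i j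
    proof -
      have "Poly_Mapping.lookup f (minor_lead i j) = - Poly_Mapping.lookup f (minor_lead j i)"
        using conjunct1[OF step(2)] by blast
      moreover have "Poly_Mapping.lookup g (minor_lead i j) = - Poly_Mapping.lookup g (minor_lead j i)" by fact
      ultimately show ?thesis unfolding lookup_add lookup_cpoly_times by (simp only: minus_add_distrib mult_minus_right)
    qed
    have 2: "\<exists>i j. i \<noteq> j \<and> m = minor_lead i j" if "Poly_Mapping.lookup (cpoly c * g + f) m \<noteq> 0" for m
    proof (cases "Poly_Mapping.lookup f m = 0")
      case True
      then have "m = minor_lead k l \<or> m = minor_lead l k"
        using that by (auto simp: lookup_add g split: if_splits)
      moreover have "k \<noteq> l" "l \<noteq> k" using kl(1) by auto
      ultimately show ?thesis by blast
    next
      case False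
      then show ?thesis using conjunct2[OF step(2)] by simp
    qed
    show ?case by (intro conjI allI impI; (rule 1 | erule 2))
  qed
  note * = this
  show "Poly_Mapping.lookup f (minor_lead i j) = - Poly_Mapping.lookup f (minor_lead j i)"
    using conjunct1[OF *] by blast
  show "\<exists>i j. i \<noteq> j \<and> m = minor_lead i j" if "m \<in> Poly_Mapping.keys f"
    using conjunct2[OF *] that unfolding in_keys_iff by blast
qed

lemma linear_order_minors_lex: "linear_order minors_lex"
  unfolding minors_lex_def
proof (rule linear_order_lex)
  show "set [Inl 0, Inl 1, Inl 2, Inl 3, Inr 0, Inr 1, Inr 2, Inr 3] = (UNIV :: (4 + 4) set)"
  proof (rule UNIV_eq_I[symmetric])
    fix x :: "4 + 4"
    show "x \<in> set [Inl 0, Inl 1, Inl 2, Inl 3, Inr 0, Inr 1, Inr 2, Inr 3]"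
    proof (cases x)
      case (Inl i)
      then show ?thesis using exhaust_4[of i] by auto
    next
      case (Inr i)
      then show ?thesis using exhaust_4[of i] by auto
    qed
  qed
qed

text \<open>Members of the ideal of minors have no terms of degree below two, so a quadric divisible
  by the leading monomial of such an f is this leading monomial. It occurs in the quadratic part of
  f, a combination of minors, together with the other term of its minor; being leading, it is the
  larger of the two.\<close>

lemma quadrics_initial_minors:
  assumes "mdeg m = 2"
  shows "mono_poly m \<in> initial_ideal minors_lex (minors_ideal :: (4 + 4, 'k::field) mpoly set) \<longleftrightarrow>
    (\<exists>i j. i < j \<and> m = minor_lead i j)"
proof
  assume "mono_poly m \<in> initial_ideal minors_lex (minors_ideal :: (4 + 4, 'k) mpoly set)"
  then obtain f :: "(4 + 4, 'k) mpoly" and t where f: "f \<in> ideal_gen minors" "f \<noteq> 0" "m = leading_monomial minors_lex f + t"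
    unfolding initial_ideal_alt mono_in_monomial_ideal_iff minors_ideal_alt by auto
  define l where "l = leading_monomial minors_lex f"
  note l = leading_monomial[OF linear_order_minors_lex f(2), folded l_def]
  have "mdeg l + mdeg t = 2" using f(3) assms mdeg_plus[of l t] by (simp add: l_def)
  moreover have "\<not> mdeg l < 2"
  proof
    assume "mdeg l < 2"
    then have "component (mdeg l) f = 0" using ideal_lowest_degree(2)[OF f(1) homogeneous_minors] by blast
    then have "Poly_Mapping.lookup f l = 0" using lookup_component[of "mdeg l" f l] by simp
    then show False using l(1) by (simp add: in_keys_iff)
  qed
  ultimately have "mdeg l = 2" "mdeg t = 0" by linarith+
  then have ml: "m = l" using f(3) by (simp add: l_def)
  define g where "g = component 2 f"
  have g: "g \<in> poly.span minors" unfolding g_def using ideal_lowest_degree(1)[OF f(1) homogeneous_minors] by blast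
  have gf: "Poly_Mapping.lookup g k = (if mdeg k = 2 then Poly_Mapping.lookup f k else 0)" for k
    unfolding g_def by (rule lookup_component)
  have gl: "l \<in> Poly_Mapping.keys g" using l(1) \<open>mdeg l = 2\<close> by (simp add: in_keys_iff gf)
  then obtain i j where ij: "i \<noteq> j" "l = minor_lead i j" using span_minors(2)[OF g] by blast
  have "\<not> j < i"
  proof
    assume "j < i"
    have "Poly_Mapping.lookup g (minor_lead j i) \<noteq> 0"
      using span_minors(1)[OF g, of j i] gl ij(2) by (simp add: in_keys_iff)
    then have "minor_lead j i \<in> Poly_Mapping.keys f" by (simp add: in_keys_iff gf)
    then have "(minor_lead j i, minor_lead i j) \<in> minors_lex" using l(2) ij(2) by simp
    moreover have "(minor_lead i j, minor_lead j i) \<in> minors_lex"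
      unfolding minor_lead_def by (rule lex_minor[OF \<open>j < i\<close>])
    ultimately have "minor_lead i j = minor_lead j i"
      using linear_order_minors_lex by (auto simp: order_on_defs dest: antisymD)
    then show False using ij(1) by (simp add: minor_lead_inject)
  qed
  then show "\<exists>i j. i < j \<and> m = minor_lead i j" using ij ml by (metis linorder_neqE)
next
  assume "\<exists>i j. i < j \<and> m = minor_lead i j"
  then obtain i j where ij: "i < j" "m = minor_lead i j" by blast
  define f :: "(4 + 4, 'k) mpoly" where "f = mono_poly (minor_lead i j) - mono_poly (minor_lead j i)"
  have ne: "minor_lead i j \<noteq> minor_lead j i" using ij by (auto simp: minor_lead_inject)
  have keys: "Poly_Mapping.keys f = {minor_lead i j, minor_lead j i}"
    using ne by (auto simp: f_def in_keys_iff lookup_minus lookup_mono_poly split: if_splits)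
  then have "f \<noteq> 0" by auto
  note l = leading_monomial[OF linear_order_minors_lex this]
  have "(minor_lead j i, minor_lead i j) \<in> minors_lex"
    unfolding minor_lead_def by (rule lex_minor[OF ij(1)])
  moreover have "(minor_lead i j, leading_monomial minors_lex f) \<in> minors_lex"
    by (rule l(2)) (simp add: keys)
  ultimately have "leading_monomial minors_lex f = m"
    using l(1) linear_order_minors_lex unfolding keys ij(2) by (auto simp: order_on_defs dest: antisymD)
  moreover have "f \<in> minors_ideal" unfolding minors_ideal_alt f_def using ij(1)
    by (intro ideal.span_base) (auto simp: minors_def)
  ultimately show "mono_poly m \<in> initial_ideal minors_lex (minors_ideal :: (4 + 4, 'k) mpoly set)"
    unfolding initial_ideal_def using \<open>f \<noteq> 0\<close> by (intro ideal.span_base) blast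
qed

text \<open>An edge ideal determines its edges through its squarefree quadrics, so degree two of the
  initial ideal determines H.\<close>

lemma initial_minors_edges:
  assumes "finite_simple_graph V E"
    and "initial_ideal minors_lex (minors_ideal :: (4 + 4, 'k::field) mpoly set) = edge_ideal E"
  shows "E = {{Inl 0, Inr 1}, {Inl 0, Inr 2}, {Inl 0, Inr 3}, {Inl 1, Inr 2}, {Inl 1, Inr 3}, {Inl 2, Inr 3}}"
proof -
  have card: "card e = 2" if "e \<in> E" for e using assms(1) that by (auto simp: finite_simple_graph_def)
  have iff: "{p, q} \<in> E \<longleftrightarrow> (\<exists>i j. i < j \<and> {p, q} = {Inl i, Inr j})" if "p \<noteq> q" for p q
  proof -
    have "{p, q} \<in> E \<longleftrightarrow> (\<exists>e\<in>E. e \<subseteq> msupp (X p + X q))"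
    proof
      assume "\<exists>e\<in>E. e \<subseteq> msupp (X p + X q)"
      then obtain e where e: "e \<in> E" "e \<subseteq> {p, q}" by auto
      have "e = {p, q}" by (rule card_subset_eq) (use e that card[OF e(1)] in auto)
      then show "{p, q} \<in> E" using e(1) by simp
    next
      assume "{p, q} \<in> E"
      then show "\<exists>e\<in>E. e \<subseteq> msupp (X p + X q)" by (rule rev_bexI) simp
    qed
    also have "\<dots> \<longleftrightarrow> mono_poly (X p + X q) \<in> (edge_ideal E :: (4 + 4, 'k) mpoly set)"
      by (rule mono_in_edge_ideal_iff[symmetric]) (rule card)
    also have "\<dots> \<longleftrightarrow> (\<exists>i j. i < j \<and> X p + X q = minor_lead i j)"
      unfolding assms(2)[symmetric] by (rule quadrics_initial_minors) simp
    also have "\<dots> \<longleftrightarrow> (\<exists>i j. i < j \<and> {p, q} = {Inl i, Inr j})"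
    proof -
      have "X p + X q = minor_lead i j \<longleftrightarrow> {p, q} = {Inl i, Inr j}" for i j
      proof
        assume "X p + X q = minor_lead i j"
        then have "msupp (X p + X q) = msupp (minor_lead i j)" by simp
        then show "{p, q} = {Inl i, Inr j}" by (simp add: minor_lead_def insert_commute)
      next
        assume "{p, q} = {Inl i, Inr j}"
        then show "X p + X q = minor_lead i j" by (auto simp: minor_lead_def doubleton_eq_iff add.commute)
      qed
      then show ?thesis by simp
    qed
    finally show ?thesis .
  qed
  have "E = {{Inl i, Inr j} | i j. i < j}"
  proof (intro equalityI subsetI)
    fix e assume e: "e \<in> E"
    obtain p q where pq: "e = {p, q}" "p \<noteq> q" using card[OF e] by (auto simp: card_2_iff)
    then obtain i j where "i < j" "{p, q} = {Inl i, Inr j}" using iff[OF pq(2)] e by metis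
    then show "e \<in> {{Inl i, Inr j} | i j. i < j}" using pq(1) by blast
  next
    fix e :: "(4 + 4) set" assume "e \<in> {{Inl i, Inr j} | i j. i < j}"
    then obtain i j where "e = {Inl i, Inr j}" "i < j" by blast
    then show "e \<in> E" using iff[of "Inl i" "Inr j"] by blast
  qed
  also have "{{Inl i, Inr j} | i j. i < j} = (\<lambda>(i, j). {Inl i, Inr j}) ` {(i, j). i < (j :: 4)}"
    by auto
  also have "{(i, j). i < (j :: 4)} = {(0, 1), (0, 2), (0, 3), (1, 2), (1, 3), (2, 3)}"
    by (intro equalityI subrelI) (simp_all only: mem_Collect_eq prod.case less_4_iff)
  finally show ?thesis by (simp only: image_insert image_empty prod.case)
qed

section \<open>Comparison of the two graphs\<close>

lemma graph_isomorphic_image: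
  assumes inj: "inj_on \<phi> V" and V: "V = \<Union>E" and E: "\<forall>e\<in>E. card e = 2"
    and W: "W = \<Union>F" and F: "F = (`) \<phi> ` E"
  shows "graph_isomorphic V E W F"
  unfolding graph_isomorphic_def
proof (intro exI conjI ballI)
  show "bij_betw \<phi> V W" using inj unfolding bij_betw_def W F V by auto
  fix u v assume uv: "u \<in> V" "v \<in> V"
  show "{u, v} \<in> E \<longleftrightarrow> {\<phi> u, \<phi> v} \<in> F"
  proof
    assume "{u, v} \<in> E"
    then have "\<phi> ` {u, v} \<in> F" unfolding F by blast
    then show "{\<phi> u, \<phi> v} \<in> F" by simp
  next
    assume "{\<phi> u, \<phi> v} \<in> F"
    then obtain e where e: "e \<in> E" "\<phi> ` {u, v} = \<phi> ` e" unfolding F by auto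
    have "{u, v} = e" using inj_on_image_eq_iff[OF inj, of "{u, v}" e] uv e V by auto
    then show "{u, v} \<in> E" using e(1) by simp
  qed
qed

lemma simple_graph_vertices:
  assumes "finite_simple_graph V E" "no_isolated_vertices V E" shows "V = \<Union>E"
  using assms unfolding finite_simple_graph_def no_isolated_vertices_def by blast

theorem theorem3p11:
  fixes I :: "('v::finite, 'k::field) mpoly set"
    and r :: "'v monomial rel"
    and VG :: "'v set" and EG :: "'v set set"
    and VH :: "(4 + 4) set" and EH :: "(4 + 4) set set"
  assumes "\<exists>B. card B = 6 \<and> (\<forall>f \<in> B. squarefree_quadratic_binomial f) \<and> minimally_generates B I"
    and "is_prime_ideal I"
    and "monomial_order r"
    and "\<exists>M. (\<forall>m \<in> M. mdeg m = 2 \<and> squarefree_monomial m) \<and>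
           initial_ideal r I = ideal_gen (mono_poly ` M)"
    and "has_linear_resolution 2 I"
    and "finite_simple_graph VG EG" and "no_isolated_vertices VG EG"
    and "initial_ideal r I = edge_ideal EG"
    and "finite_simple_graph VH EH" and "no_isolated_vertices VH EH"
    and "initial_ideal minors_lex (minors_ideal :: (4 + 4, 'k) mpoly set) = edge_ideal EH"
  shows "graph_isomorphic VG EG VH EH"
proof -
  obtain B where B: "card B = 6" "\<forall>f\<in>B. squarefree_quadratic_binomial f" "minimally_generates B I"
    using assms(1) by blast
  interpret binomial_initial_ideal I B r EG
  proof
    show "I = ideal_gen B" using B(3) by (simp add: minimally_generates_def)
    show "card e = 2" if "e \<in> EG" for e using assms(6) that by (simp add: finite_simple_graph_def)
  qed (use B(2) assms(2,3,8) in auto)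
  obtain a b c d f g where dist: "distinct [a, b, c, d, f, g]"
      and EG: "EG = {{a, b}, {a, c}, {a, d}, {b, f}, {b, g}, {c, f}}"
    using half_graph[OF B(3,1) assms(5)] by metis
  have EH: "EH = {{Inl 0, Inr 1}, {Inl 0, Inr 2}, {Inl 0, Inr 3}, {Inl 1, Inr 2}, {Inl 1, Inr 3}, {Inl 2, Inr 3}}"
    by (rule initial_minors_edges[OF assms(9,11)])
  \<comment> \<open>Both graphs are bipartite with degrees 3, 2, 1 on each side, and \<phi> matches
    the degrees: a, f, g go to x_1, x_2, x_3 and b, c, d to y_4, y_3, y_2. The default value is the
    image of g.\<close>
  define \<phi> :: "'v \<Rightarrow> 4 + 4" where
    "\<phi> = (\<lambda>_. Inl 2)(a := Inl 0, b := Inr 3, c := Inr 2, d := Inr 1, f := Inl 1)"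
  have \<phi>: "\<phi> a = Inl 0" "\<phi> b = Inr 3" "\<phi> c = Inr 2" "\<phi> d = Inr 1" "\<phi> f = Inl 1" "\<phi> g = Inl 2"
    using dist by (auto simp: \<phi>_def)
  have V: "VG = {a, b, c, d, f, g}"
    unfolding simple_graph_vertices[OF assms(6,7)] EG by auto
  show ?thesis
  proof (rule graph_isomorphic_image)
    show "inj_on \<phi> VG" unfolding V by (auto simp: inj_on_def \<phi>)
    show "VG = \<Union>EG" "VH = \<Union>EH" using simple_graph_vertices assms by blast+
    show "\<forall>e\<in>EG. card e = 2" using edges by blast
    show "EH = (`) \<phi> ` EG" unfolding EG EH by (simp add: \<phi> insert_commute)
  qed
qed

end
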